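(* Let $i, k \in \mathbb{Z}$ with $k \geq i$ and $k \geq 2$. If $G$ is a graph with $|G| \geq 16k + 3i$ and $|H_k(G)| \geq |L_k(G)| + 3k - i$, then $c(G) \geq k$, i.e. $G$ contains at least $k$ disjoint cycles.
   Context: All graphs are finite and simple (no loops or multiple edges). $|G|$ denotes the number of vertices of $G$. For a positive integer $k$, $H_k(G)$ is the set of vertices of $G$ of degree at least $2k$, and $L_k(G)$ is the set of vertices of $G$ of degree at most $2k-2$. Cycles (as subgraphs) are disjoint if they pairwise have no common vertices. $c(G)$ is the maximum number of disjoint cycles in $G$. Note that $i$ may be any integer, including negative, with $i \leq k$. *)

theory Defs
  imports Main
begin

locale simple_graph =
  fixes V :: "'a set" and E :: "'a set set"
  assumes finite_verts: "finite V"
    and edge_subset: "e \<in> E \<Longrightarrow> e \<subseteq> V"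
    and edge_card: "e \<in> E \<Longrightarrow> card e = 2"

definition degree :: "'a set set \<Rightarrow> 'a \<Rightarrow> nat" where
  "degree E v = card {e \<in> E. v \<in> e}"

(* The parameter k is an integer, so that 2 * k - 2 is not truncated subtraction. *)
definition high_verts :: "'a set \<Rightarrow> 'a set set \<Rightarrow> int \<Rightarrow> 'a set" where
  "high_verts V E k = {v \<in> V. int (degree E v) \<ge> 2 * k}"

definition low_verts :: "'a set \<Rightarrow> 'a set set \<Rightarrow> int \<Rightarrow> 'a set" where
  "low_verts V E k = {v \<in> V. int (degree E v) \<le> 2 * k - 2}"

(* (W, F) is a cycle graph: the list xs enumerates its vertices in cyclic order. *)
definition is_cycle :: "'a set \<Rightarrow> 'a set set \<Rightarrow> bool" where
  "is_cycle W F \<longleftrightarrow> (\<exists>xs. distinct xs \<and> 3 \<le> length xs \<and> W = set xs \<and>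
     F = {{xs ! j, xs ! (Suc j mod length xs)} | j. j < length xs})"

definition cycles :: "'a set \<Rightarrow> 'a set set \<Rightarrow> ('a set \<times> 'a set set) set" where
  "cycles V E = {(W, F). is_cycle W F \<and> W \<subseteq> V \<and> F \<subseteq> E}"

definition disjoint_cycles :: "'a set \<Rightarrow> 'a set set \<Rightarrow> ('a set \<times> 'a set set) set \<Rightarrow> bool" where
  "disjoint_cycles V E S \<longleftrightarrow> S \<subseteq> cycles V E \<and> pairwise (\<lambda>C D. fst C \<inter> fst D = {}) S"

definition max_disjoint_cycles :: "'a set \<Rightarrow> 'a set set \<Rightarrow> nat" where
  "max_disjoint_cycles V E = Max {card S | S. disjoint_cycles V E S}"

(* The maximum above is over a finite nonempty set, hence meaningful. *)
lemma (in simple_graph) le_max_disjoint_cycles_iff: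
  "n \<le> max_disjoint_cycles V E \<longleftrightarrow> (\<exists>S. disjoint_cycles V E S \<and> n \<le> card S)"
proof -
  have "finite (Pow V \<times> Pow (Pow V))"
    using finite_verts by simp
  moreover have "cycles V E \<subseteq> Pow V \<times> Pow (Pow V)"
    using edge_subset by (auto simp: cycles_def)
  ultimately have "finite (cycles V E)"
    by (rule rev_finite_subset)
  then have "finite (card ` Pow (cycles V E))"
    by simp
  moreover have "{card S | S. disjoint_cycles V E S} \<subseteq> card ` Pow (cycles V E)"
    by (auto simp: disjoint_cycles_def)
  ultimately have fin: "finite {card S | S. disjoint_cycles V E S}"
    by (rule rev_finite_subset)
  have "disjoint_cycles V E {}"
    by (simp add: disjoint_cycles_def)
  then have "{card S | S. disjoint_cycles V E S} \<noteq> {}"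
    by blast
  with fin show ?thesis
    unfolding max_disjoint_cycles_def by (subst Max_ge_iff) auto
qed

end

theory Submission
  imports Defs
begin

text \<open>
  A set is dense if it spans at least as many edges as it has vertices; dense sets contain cycles,
  so it suffices to find \<open>k\<close> disjoint dense sets. In a minimal counterexample vertices of degree at most
  \<open>2k - 3\<close> (the set \<open>L\<close>) are independent with all neighbours of degree about \<open>2k\<close>, and every edge at a
  vertex of degree at most \<open>2k - 2\<close> lies in a triangle: otherwise delete or contract an edge.
  Take a maximum family of disjoint short cycles with at most four vertices outside \<open>L\<close>, then of least
  total size, then with as many edges as possible in the remainder \<open>U\<close>. Comparing degree sums with
  upper bounds for the edges between the family and \<open>U\<close>, which come from exchanging cycles, shows that the
  family consists of \<open>k - 1\<close> triangles and quadrilaterals, that the rest \<open>N\<close> of \<open>U\<close> outside \<open>L\<close> is a forest,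
  and that one vertex \<open>b\<close> of \<open>N\<close> separates it into components seeing every cycle at most twice. Then
  many leaves at \<open>b\<close> have the same \<open>2k - 1\<close> neighbours, which is incompatible with the degree hypothesis
  on the remaining vertices.
\<close>

section \<open>Dense sets and minimal cycles\<close>

text \<open>Vertices of \<open>L\<close> have weight -1 under both \<open>ff\<close> and
  \<open>om\<close>, so however many of them a cycle contains, it takes at most 4 of
  \<open>ff\<close> and 8 of \<open>om\<close> out of the total. This is why the family is
  restricted by its vertices outside \<open>L\<close> and not by length. Twice the \<open>om\<close>
  of the remainder is then at least \<open>25k - 16t\<close>, which is \<open>9k + 16\<close> or
  more; most numerical contradictions play this against degrees of order \<open>2k\<close>. The
  obstacle is that a vertex may be joined to all three vertices of a triangle, while the degree
  count tolerates only two edges per vertex and cycle on average; the exchanges restore this average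
  up to an additive constant. Finally, the common neighbourhood of the leaves has one vertex more
  than the \<open>2k - 2\<close> that are needed for \<open>k - 1\<close> quadrilaterals through the
  leaves. Any one of its vertices can be spared, so the rest of the graph is a forest that stays one
  when such a vertex is added.\<close>

definition dg :: "('a \<Rightarrow> 'a \<Rightarrow> bool) \<Rightarrow> 'a set \<Rightarrow> 'a \<Rightarrow> nat" where
  "dg R X v = card {u \<in> X. R v u}"

definition eb :: "('a \<Rightarrow> 'a \<Rightarrow> bool) \<Rightarrow> 'a set \<Rightarrow> 'a set \<Rightarrow> nat" where
  "eb R X Y = (\<Sum>x\<in>X. dg R Y x)"

text \<open>\<open>eb R X X\<close> sees every edge from both ends, whence the factor 2. An edge
  count is stable under contraction and disjoint union, where explicit cycles would have to be
  rerouted.\<close>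

definition dense :: "('a \<Rightarrow> 'a \<Rightarrow> bool) \<Rightarrow> 'a set \<Rightarrow> bool" where
  "dense R X \<longleftrightarrow> finite X \<and> X \<noteq> {} \<and> 2 * card X \<le> eb R X X"

text \<open>Connectivity by cuts: every proper nonempty part has an edge leaving it. Growing a
  largest good subset and absorbing one set into another then work without paths.\<close>

definition conn :: "('a \<Rightarrow> 'a \<Rightarrow> bool) \<Rightarrow> 'a set \<Rightarrow> bool" where
  "conn R K \<longleftrightarrow> finite K \<and> K \<noteq> {} \<and>
     (\<forall>A. A \<subset> K \<longrightarrow> A \<noteq> {} \<longrightarrow> (\<exists>x\<in>A. \<exists>y\<in>K - A. R x y))"

definition packs :: "('a \<Rightarrow> 'a \<Rightarrow> bool) \<Rightarrow> 'a set \<Rightarrow> nat \<Rightarrow> bool" where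
  "packs R V n \<longleftrightarrow> (\<exists>F. finite F \<and> card F = n \<and> (\<forall>X\<in>F. X \<subseteq> V \<and> dense R X) \<and>
     pairwise disjnt F)"

lemma dg_empty [simp]: "dg R {} v = 0"
  by (simp add: dg_def)

lemma dg_mono: "finite Y \<Longrightarrow> X \<subseteq> Y \<Longrightarrow> dg R X v \<le> dg R Y v"
  unfolding dg_def by (rule card_mono) auto

lemma dg_le_card: "finite X \<Longrightarrow> dg R X v \<le> card X"
  unfolding dg_def by (rule card_mono) auto

lemma dg_Un: "finite X \<Longrightarrow> finite Y \<Longrightarrow> X \<inter> Y = {} \<Longrightarrow> dg R (X \<union> Y) v = dg R X v + dg R Y v"
  unfolding dg_def by (subst card_Un_disjoint [symmetric]) (auto intro!: arg_cong [where f = card])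

lemma dg_insert: "finite X \<Longrightarrow> a \<notin> X \<Longrightarrow> dg R (insert a X) v = dg R X v + (if R v a then 1 else 0)"
proof -
  assume "finite X" "a \<notin> X"
  moreover have "{u \<in> insert a X. R v u} = (if R v a then insert a {u \<in> X. R v u} else {u \<in> X. R v u})"
    by auto
  ultimately show ?thesis by (simp add: dg_def)
qed

lemma dg_Diff: "finite X \<Longrightarrow> Y \<subseteq> X \<Longrightarrow> dg R (X - Y) v + dg R Y v = dg R X v"
  using dg_Un [of "X - Y" Y R v] by (simp add: finite_subset Un_absorb2 Diff_disjoint Int_commute)

lemma dg_pos_iff: "finite X \<Longrightarrow> 0 < dg R X v \<longleftrightarrow> (\<exists>u\<in>X. R v u)"
  unfolding dg_def by (auto simp: card_gt_0_iff)

lemma dg_ge_2_iff: "finite X \<Longrightarrow> 2 \<le> dg R X v \<longleftrightarrow> (\<exists>u\<in>X. \<exists>w\<in>X. u \<noteq> w \<and> R v u \<and> R v w)"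
proof
  assume "2 \<le> dg R X v" then obtain T where "T \<subseteq> {u \<in> X. R v u}" "card T = 2"
    unfolding dg_def by (meson obtain_subset_with_card_n)
  then show "\<exists>u\<in>X. \<exists>w\<in>X. u \<noteq> w \<and> R v u \<and> R v w" by (auto simp: card_2_iff)
next
  assume "finite X" "\<exists>u\<in>X. \<exists>w\<in>X. u \<noteq> w \<and> R v u \<and> R v w"
  then obtain u w where "u \<in> X" "w \<in> X" "u \<noteq> w" "R v u" "R v w" by blast
  then have "card {u, w} \<le> card {u \<in> X. R v u}" using \<open>finite X\<close> by (intro card_mono) auto
  with \<open>u \<noteq> w\<close> show "2 \<le> dg R X v" by (simp add: dg_def)
qed

lemma two_nbrs:
  assumes "finite X" "\<not> dg R X v \<le> 1"
  obtains x y where "x \<in> X" "y \<in> X" "x \<noteq> y" "R v x" "R v y"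
  using assms dg_ge_2_iff [of X R v] by (auto simp: not_le Suc_le_eq numeral_2_eq_2)

lemma dg_disjoint_Union:
  "finite F \<Longrightarrow> (\<And>X. X \<in> F \<Longrightarrow> finite X) \<Longrightarrow> pairwise disjnt F \<Longrightarrow> dg R (\<Union>F) v = (\<Sum>X\<in>F. dg R X v)"
proof (induction F rule: finite_induct)
  case (insert X F)
  have "X \<inter> \<Union>F = {}" using insert by (auto simp: pairwise_insert disjnt_def)
  then show ?case using insert by (simp add: dg_Un pairwise_insert)
qed simp

lemma eb_empty [simp]: "eb R {} Y = 0" "eb R X {} = 0"
  by (simp_all add: eb_def)

lemma eb_Un_left: "finite X \<Longrightarrow> finite Y \<Longrightarrow> X \<inter> Y = {} \<Longrightarrow> eb R (X \<union> Y) Z = eb R X Z + eb R Y Z"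
  by (simp add: eb_def sum.union_disjoint)

lemma eb_Un_right:
  "finite X \<Longrightarrow> finite Y \<Longrightarrow> X \<inter> Y = {} \<Longrightarrow> eb R Z (X \<union> Y) = eb R Z X + eb R Z Y"
  by (simp add: eb_def dg_Un sum.distrib)

lemma eb_insert_left: "finite X \<Longrightarrow> a \<notin> X \<Longrightarrow> eb R (insert a X) Z = dg R Z a + eb R X Z"
  by (simp add: eb_def)

lemma eb_singleton: "eb R {a} Z = dg R Z a"
  by (simp add: eb_def)

lemma eb_mono: "finite X' \<Longrightarrow> finite Y' \<Longrightarrow> X \<subseteq> X' \<Longrightarrow> Y \<subseteq> Y' \<Longrightarrow> eb R X Y \<le> eb R X' Y'"
  unfolding eb_def
  by (rule order_trans [OF sum_mono sum_mono2]) (auto intro: dg_mono)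

lemma eb_Diff_left: "finite X \<Longrightarrow> Y \<subseteq> X \<Longrightarrow> eb R (X - Y) Z + eb R Y Z = eb R X Z"
  using eb_Un_left [of "X - Y" Y R Z] by (simp add: finite_subset Un_absorb2 Int_commute)

lemma eb_Diff_right: "finite X \<Longrightarrow> Y \<subseteq> X \<Longrightarrow> eb R Z (X - Y) + eb R Z Y = eb R Z X"
  using eb_Un_right [of "X - Y" Y R Z] by (simp add: finite_subset Un_absorb2 Int_commute)

lemma denseI: "finite X \<Longrightarrow> X \<noteq> {} \<Longrightarrow> 2 * card X \<le> eb R X X \<Longrightarrow> dense R X"
  by (simp add: dense_def)

lemma conn_singleton [simp]: "conn R {a}"
  by (auto simp: conn_def)

lemma conn_finite: "conn R K \<Longrightarrow> finite K" and conn_ne: "conn R K \<Longrightarrow> K \<noteq> {}"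
  by (simp_all add: conn_def)

lemma dense_finite: "dense R X \<Longrightarrow> finite X" and dense_ne: "dense R X \<Longrightarrow> X \<noteq> {}"
  by (simp_all add: dense_def)

lemma connD: "conn R K \<Longrightarrow> A \<subset> K \<Longrightarrow> A \<noteq> {} \<Longrightarrow> \<exists>x\<in>A. \<exists>y\<in>K - A. R x y"
  by (simp add: conn_def)

lemma packs_0 [simp]: "packs R V 0"
  unfolding packs_def by (rule exI [of _ "{}"]) auto

lemma packs_mono: "packs R V n \<Longrightarrow> V \<subseteq> W \<Longrightarrow> packs R W n"
  unfolding packs_def by blast

lemma packsE:
  assumes "packs R V n"
  obtains F where "finite F" "card F = n" "\<forall>X\<in>F. X \<subseteq> V \<and> dense R X" "pairwise disjnt F"
  using assms by (auto simp: packs_def)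

lemma packs_1: "dense R X \<Longrightarrow> packs R X (Suc 0)"
  unfolding packs_def by (rule exI [of _ "{X}"]) auto

lemma packs_le: "packs R V n \<Longrightarrow> m \<le> n \<Longrightarrow> packs R V m"
proof -
  assume pk: "packs R V n" and "m \<le> n"
  obtain F where F: "finite F" "card F = n" "\<forall>Y\<in>F. Y \<subseteq> V \<and> dense R Y" "pairwise disjnt F"
    using packsE [OF pk] .
  then obtain F' where "F' \<subseteq> F" "card F' = m" using \<open>m \<le> n\<close> by (metis obtain_subset_with_card_n)
  then show ?thesis unfolding packs_def
    using F by (intro exI [of _ F']) (auto intro: finite_subset pairwise_subset)
qed

lemma packs_Un:
  assumes "packs R V n" "packs R W m" "V \<inter> W = {}"
  shows "packs R (V \<union> W) (n + m)"
proof -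
  obtain F where F: "finite F" "card F = n" "\<forall>Y\<in>F. Y \<subseteq> V \<and> dense R Y" "pairwise disjnt F"
    using packsE [OF assms(1)] .
  obtain G where G: "finite G" "card G = m" "\<forall>Y\<in>G. Y \<subseteq> W \<and> dense R Y" "pairwise disjnt G"
    using packsE [OF assms(2)] .
  have "F \<inter> G = {}"
  proof (rule ccontr)
    assume "F \<inter> G \<noteq> {}"
    then obtain Y where "Y \<in> F" "Y \<in> G" by blast
    then have "Y \<subseteq> V" "Y \<subseteq> W" "Y \<noteq> {}" using F(3) G(3) by (auto simp: dense_def)
    then show False using assms(3) by blast
  qed
  moreover have "pairwise disjnt (F \<union> G)"
    unfolding pairwise_def
  proof (intro ballI impI)
    fix x y assume xy: "x \<in> F \<union> G" "y \<in> F \<union> G" "x \<noteq> y"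
    have "disjnt x y" if "x \<in> F" "y \<in> G" for x y
    proof -
      have "x \<subseteq> V" "y \<subseteq> W" using F(3) G(3) that by auto
      then show ?thesis using assms(3) by (auto simp: disjnt_def)
    qed
    then show "disjnt x y"
      using xy pairwiseD [OF F(4)] pairwiseD [OF G(4)] by (metis Un_iff disjnt_sym)
  qed
  ultimately show ?thesis
    unfolding packs_def using F G by (intro exI [of _ "F \<union> G"]) (auto simp: card_Un_disjoint)
qed

lemma packs_Suc_Un: "packs R V n \<Longrightarrow> dense R X \<Longrightarrow> V \<inter> X = {} \<Longrightarrow> packs R (V \<union> X) (Suc n)"
  using packs_Un [OF _ packs_1, of R V n X] by simp

section \<open>Density from connectivity\<close>

locale rel =
  fixes R :: "'a \<Rightarrow> 'a \<Rightarrow> bool"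
  assumes sym: "R x y \<Longrightarrow> R y x" and irr: "\<not> R x x"
begin

lemma sym_iff: "R x y \<longleftrightarrow> R y x"
  using sym by blast

lemma dg_self: "finite X \<Longrightarrow> dg R (insert v X) v = dg R X v"
  by (cases "v \<in> X") (simp_all add: insert_absorb dg_insert irr)

lemma dg_singleton: "dg R {a} v = (if R v a then 1 else 0)"
  using dg_insert [of "{}" a R v] by simp

lemma dg_swap: assumes "finite X" "finite Y" shows "eb R X Y = eb R Y X"
proof -
  have "eb R X Y = (\<Sum>x\<in>X. \<Sum>y\<in>Y. if R x y then 1 else 0)"
    unfolding eb_def dg_def using assms by (intro sum.cong) (auto simp: sum.If_cases Int_def)
  also have "\<dots> = (\<Sum>y\<in>Y. \<Sum>x\<in>X. if R y x then 1 else 0)"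
    by (subst sum.swap) (simp add: sym_iff)
  also have "\<dots> = eb R Y X"
    unfolding eb_def dg_def using assms by (intro sum.cong) (auto simp: sum.If_cases Int_def)
  finally show ?thesis .
qed

lemma eb_singleton_right: "finite X \<Longrightarrow> eb R X {a} = dg R X a"
  by (subst dg_swap) (simp_all add: eb_singleton)

lemma ds_Un:
  assumes "finite X" "finite Y" "X \<inter> Y = {}"
  shows "eb R (X \<union> Y) (X \<union> Y) = eb R X X + eb R Y Y + 2 * eb R X Y"
  using assms by (simp add: eb_Un_left eb_Un_right dg_swap [of Y X])

lemma ds_insert:
  assumes "finite X" "a \<notin> X"
  shows "eb R (insert a X) (insert a X) = eb R X X + 2 * dg R X a"
  using ds_Un [of "{a}" X] assms by (simp add: eb_singleton dg_singleton irr)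

lemma ds_remove:
  assumes "finite X" "a \<in> X"
  shows "eb R X X = eb R (X - {a}) (X - {a}) + 2 * dg R X a"
proof -
  have "dg R X a = dg R (X - {a}) a" using dg_self [of "X - {a}" a] assms by (simp add: insert_absorb)
  then show ?thesis using ds_insert [of "X - {a}" a] assms by (simp add: insert_absorb)
qed

text \<open>A largest subset with at least \<open>card A - 1\<close> edges is all of
  \<open>K\<close>: an edge leaving it would add one vertex and at least one edge.\<close>

lemma conn_ds:
  assumes "conn R K" shows "2 * card K \<le> eb R K K + 2"
proof -
  have fin: "finite K" and ne: "K \<noteq> {}" using assms conn_finite conn_ne by auto
  let ?P = "\<lambda>A. A \<subseteq> K \<and> A \<noteq> {} \<and> 2 * card A \<le> eb R A A + 2"
  obtain v where "v \<in> K" using ne by blast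
  then have "?P {v}" by (simp add: eb_singleton)
  moreover have "\<forall>A. ?P A \<longrightarrow> card A < Suc (card K)" using card_mono [OF fin] by (simp add: less_Suc_eq_le)
  ultimately have "\<exists>A. ?P A \<and> (\<forall>B. ?P B \<longrightarrow> card B \<le> card A)"
    by (rule ex_has_greatest_nat)
  then obtain A where A: "?P A" and mx: "\<And>B. ?P B \<Longrightarrow> card B \<le> card A" by blast
  have "A = K"
  proof (rule ccontr)
    assume "A \<noteq> K"
    then obtain x y where "x \<in> A" "y \<in> K - A" "R x y"
      using connD [OF assms, of A] A by blast
    have finA: "finite A" using A fin finite_subset by blast
    have "0 < dg R A y" using \<open>x \<in> A\<close> \<open>R x y\<close> sym finA by (auto simp: dg_pos_iff)
    then have "?P (insert y A)"
      using A \<open>y \<in> K - A\<close> finA by (auto simp: ds_insert)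
    from mx [OF this] show False using \<open>y \<in> K - A\<close> finA by simp
  qed
  then show ?thesis using A by simp
qed

lemma conn_Un:
  assumes "conn R A" "conn R B" "a \<in> A" "b \<in> B" "a = b \<or> R a b"
  shows "conn R (A \<union> B)"
  unfolding conn_def
proof (intro conjI allI impI)
  show "finite (A \<union> B)" "A \<union> B \<noteq> {}" using assms conn_finite by auto
  fix C assume C: "C \<subset> A \<union> B" "C \<noteq> {}"
  have *: "\<exists>x\<in>C. \<exists>y\<in>K - C. R x y" if K: "conn R K" "C \<inter> K \<noteq> {}" "\<not> K \<subseteq> C" for K
  proof -
    have "C \<inter> K \<subset> K" using K(3) by auto
    then obtain x y where "x \<in> C \<inter> K" "y \<in> K - C \<inter> K" "R x y"
      using connD [OF K(1)] K(2) by blast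
    then show ?thesis by blast
  qed
  consider "C \<inter> A \<noteq> {} \<and> \<not> A \<subseteq> C" | "C \<inter> B \<noteq> {} \<and> \<not> B \<subseteq> C"
    | "(C \<inter> A = {} \<or> A \<subseteq> C) \<and> (C \<inter> B = {} \<or> B \<subseteq> C)" by blast
  then show "\<exists>x\<in>C. \<exists>y\<in>A \<union> B - C. R x y"
  proof cases
    case 1 then show ?thesis using * [OF assms(1)] by blast
  next
    case 2 then show ?thesis using * [OF assms(2)] by blast
  next
    case 3
    then have "(A \<subseteq> C \<and> C \<inter> B = {}) \<or> (B \<subseteq> C \<and> C \<inter> A = {})" using C by blast
    then show ?thesis using assms(3-5) C sym by blast
  qed
qed

lemma conn_insert: "conn R K \<Longrightarrow> b \<in> K \<Longrightarrow> R a b \<Longrightarrow> conn R (insert a K)"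
  using conn_Un [of "{a}" K a b] by simp

text \<open>A connected set is at most one edge short of being dense, and two edges to a new vertex
  bring one more than that vertex needs.\<close>

lemma conn_dense_insert:
  assumes "conn R K" "a \<notin> K" "2 \<le> dg R K a" shows "dense R (insert a K)"
  using assms conn_ds [OF assms(1)] conn_finite [OF assms(1)] by (intro denseI) (auto simp: ds_insert)

lemma conn_dense_Un:
  assumes "conn R A" "conn R B" "A \<inter> B = {}" "2 \<le> eb R A B" shows "dense R (A \<union> B)"
proof -
  have "finite A" "finite B" "A \<noteq> {}" using assms conn_finite conn_ne by blast+
  then show ?thesis
    using assms conn_ds [OF assms(1)] conn_ds [OF assms(2)]
    by (intro denseI) (auto simp: ds_Un card_Un_disjoint)
qed

lemma triangle_dense:
  assumes "R a b" "R a c" "R b c" shows "dense R {a, b, c}" "card {a, b, c} = 3"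
proof -
  have "conn R (insert b {c})" using conn_insert [OF conn_singleton, of c c b] assms by simp
  moreover have "a \<notin> {b, c}" using assms irr by auto
  moreover have "2 \<le> dg R (insert b {c}) a" using assms irr by (subst dg_ge_2_iff) auto
  ultimately show "dense R {a, b, c}" by (intro conn_dense_insert) auto
  show "card {a, b, c} = 3" using assms irr by (auto simp: card_insert_if)
qed

lemma quadrilateral_dense:
  assumes "R a c" "R a d" "R b c" "R b d" "a \<noteq> b" "c \<noteq> d" shows "dense R {a, c, b, d}"
proof -
  have "conn R (insert c (insert b {d}))"
    using conn_insert [OF conn_insert [OF conn_singleton, of d d b], of b c] assms sym by simp
  moreover have "a \<notin> {c, b, d}" using assms irr by auto
  moreover have "2 \<le> dg R (insert c (insert b {d})) a" using assms by (subst dg_ge_2_iff) auto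
  ultimately show ?thesis by (intro conn_dense_insert) auto
qed

lemma conn_successively: "successively R xs \<Longrightarrow> xs \<noteq> [] \<Longrightarrow> conn R (set xs)"
proof (induction xs)
  case (Cons x xs)
  show ?case
  proof (cases "xs = []")
    case False
    then show ?thesis using Cons by (auto simp: successively_Cons intro!: conn_insert [of _ "hd xs"])
  qed simp
qed simp

section \<open>Cycles as vertex lists, and inclusion-minimal dense sets\<close>

definition cyc :: "'a list \<Rightarrow> bool" where
  "cyc xs \<longleftrightarrow> distinct xs \<and> 3 \<le> length xs \<and> successively R xs \<and> R (last xs) (hd xs)"

lemma dense_remove:
  assumes "dense R X" "v \<in> X" "dg R X v \<le> 1" shows "dense R (X - {v})"
proof -
  have X: "finite X" "2 * card X \<le> eb R X X" using assms by (auto simp: dense_def)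
  have c: "card X = card (X - {v}) + 1" using X assms by (metis Suc_eq_plus1 card_Suc_Diff1)
  have "2 * card (X - {v}) \<le> eb R (X - {v}) (X - {v})"
    using ds_remove [OF X(1) assms(2)] X c assms(3) by linarith
  moreover have "X - {v} \<noteq> {}"
  proof
    assume "X - {v} = {}"
    then have "X = {v}" using assms(2) by blast
    then show False using X by (simp add: eb_singleton dg_singleton irr)
  qed
  ultimately show ?thesis using X by (intro denseI) auto
qed

lemma dense_min_subset:
  assumes "dense R X"
  obtains Y where "Y \<subseteq> X" "dense R Y" "\<And>Z. Z \<subset> Y \<Longrightarrow> \<not> dense R Z"
proof -
  have fin: "finite {Y. Y \<subseteq> X \<and> dense R Y}" using assms by (auto simp: dense_def)
  obtain Y where "Y \<in> {Y. Y \<subseteq> X \<and> dense R Y}" "\<forall>Z\<in>{Y. Y \<subseteq> X \<and> dense R Y}. Z \<subseteq> Y \<longrightarrow> Y = Z"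
    using finite_has_minimal [OF fin] assms by blast
  then show ?thesis using that by (metis (mono_tags, lifting) mem_Collect_eq order.strict_iff_not order.trans psubset_eq)
qed

text \<open>In a minimal dense subset all degrees are at least 2, since a vertex of smaller degree
  could be dropped. The head of a longest path there has all its neighbours on the path, and one
  that is not the next vertex closes a cycle.\<close>

lemma dense_cyc:
  assumes "dense R X" obtains xs where "cyc xs" "set xs \<subseteq> X"
proof -
  obtain Y where Y: "Y \<subseteq> X" "dense R Y" "\<And>Z. Z \<subset> Y \<Longrightarrow> \<not> dense R Z"
    using dense_min_subset [OF assms] by blast
  have fin: "finite Y" and ne: "Y \<noteq> {}" using Y by (auto simp: dense_def)
  have deg: "2 \<le> dg R Y v" if "v \<in> Y" for v
  proof (rule ccontr)
    assume "\<not> ?thesis"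
    then have "dense R (Y - {v})" using dense_remove [OF Y(2) that] by simp
    then show False using Y(3) that by blast
  qed
  let ?P = "\<lambda>xs. distinct xs \<and> xs \<noteq> [] \<and> successively R xs \<and> set xs \<subseteq> Y"
  obtain v where "v \<in> Y" using ne by blast
  then have "?P [v]" by simp
  moreover have "\<forall>xs. ?P xs \<longrightarrow> length xs < Suc (card Y)"
    using fin by (metis card_mono distinct_card less_Suc_eq_le)
  ultimately have "\<exists>xs. ?P xs \<and> (\<forall>ys. ?P ys \<longrightarrow> length ys \<le> length xs)"
    by (rule ex_has_greatest_nat)
  then obtain xs where xs: "?P xs" and mx: "\<And>ys. ?P ys \<Longrightarrow> length ys \<le> length xs" by blast
  let ?h = "hd xs"
  have hY: "?h \<in> Y" using xs by auto
  have nb: "u \<in> set xs" if "u \<in> Y" "R ?h u" for u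
  proof (rule ccontr)
    assume "u \<notin> set xs"
    then have "?P (u # xs)" using xs that sym by (auto simp: successively_Cons)
    from mx [OF this] show False by simp
  qed
  obtain u w where uw: "u \<in> Y" "w \<in> Y" "u \<noteq> w" "R ?h u" "R ?h w"
    using deg [OF hY] fin by (auto simp: dg_ge_2_iff)
  obtain rest where xs_eq: "xs = ?h # rest" using xs by (cases xs) auto
  have "u \<in> set rest" "w \<in> set rest"
    using nb [OF uw(1,4)] nb [OF uw(2,5)] uw irr xs_eq by (metis set_ConsD)+
  then have "rest \<noteq> []" by auto
  obtain z where z: "z \<in> set rest" "z \<noteq> hd rest" "R ?h z"
    using uw \<open>u \<in> set rest\<close> \<open>w \<in> set rest\<close> by metis
  obtain as bs where ab: "rest = as @ z # bs" using z by (metis split_list)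
  have asne: "as \<noteq> []" using z ab by auto
  have "cyc (?h # as @ [z])"
    unfolding cyc_def
  proof (intro conjI)
    have e: "xs = (?h # as @ [z]) @ bs" using xs_eq ab by simp
    show "distinct (?h # as @ [z])" using xs e by (metis distinct_append)
    show "successively R (?h # as @ [z])" using xs e by (metis successively_append_iff)
    show "3 \<le> length (?h # as @ [z])" using asne by (cases as) auto
    show "R (last (?h # as @ [z])) (hd (?h # as @ [z]))" using z sym by simp
  qed
  moreover have "set (?h # as @ [z]) \<subseteq> set xs" using arg_cong [OF xs_eq, of set] ab by auto
  then have "set (?h # as @ [z]) \<subseteq> X" using xs Y(1) by blast
  ultimately show ?thesis using that by blast
qed

lemma cyc_rotate: assumes "cyc (as @ bs)" shows "cyc (bs @ as)"
proof (cases "as = [] \<or> bs = []")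
  case False
  then show ?thesis using assms by (simp add: cyc_def successively_append_iff Int_commute)
qed (use assms in auto)

lemma cyc_dense: assumes "cyc xs" shows "dense R (set xs)"
proof -
  obtain x ys where xs: "xs = x # ys" using assms unfolding cyc_def by (cases xs) auto
  have "ys \<noteq> []" using assms xs by (auto simp: cyc_def)
  have "conn R (set ys)" using assms xs by (auto simp: cyc_def successively_Cons intro: conn_successively)
  moreover have "hd ys \<noteq> last ys"
    using assms xs by (cases ys) (auto simp: cyc_def)
  moreover have "R x (hd ys)" "R x (last ys)"
    using assms xs \<open>ys \<noteq> []\<close> sym by (auto simp: cyc_def successively_Cons)
  ultimately have "conn R (set ys)" "2 \<le> dg R (set ys) x"
    using \<open>ys \<noteq> []\<close> by (auto simp: dg_ge_2_iff intro: hd_in_set last_in_set)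
  moreover have "x \<notin> set ys" using assms xs by (auto simp: cyc_def)
  ultimately show ?thesis using xs conn_dense_insert by simp
qed

text \<open>These are the vertex sets of chordless cycles: \<open>mind_cyc\<close> lists one as a
  cycle, \<open>mind_dg\<close> excludes chords.\<close>

definition mind :: "'a set \<Rightarrow> bool" where
  "mind C \<longleftrightarrow> dense R C \<and> (\<forall>Z. Z \<subset> C \<longrightarrow> \<not> dense R Z)"

lemma mind_cyc: assumes "mind C" "c \<in> C"
  obtains ys where "cyc (c # ys)" "C = set (c # ys)"
proof -
  obtain xs where xs: "cyc xs" "set xs \<subseteq> C" using dense_cyc assms by (auto simp: mind_def)
  then have "set xs = C" using cyc_dense assms by (auto simp: mind_def)
  then obtain as bs where "xs = as @ c # bs" using assms by (metis split_list)
  then have "cyc ((c # bs) @ as)" "set ((c # bs) @ as) = C" using xs cyc_rotate [of as "c # bs"] \<open>set xs = C\<close> by auto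
  then show ?thesis using that by auto
qed

text \<open>A third neighbour \<open>u\<close> of \<open>c\<close> would close a cycle with the
  segment of \<open>ys\<close> up to \<open>u\<close>, which misses the last vertex of
  \<open>ys\<close> and contradicts minimality.\<close>

lemma mind_dg: assumes "mind C" "c \<in> C" shows "dg R C c = 2"
proof -
  obtain ys where ys: "cyc (c # ys)" "C = set (c # ys)" using mind_cyc [OF assms] by blast
  have fin: "finite C" using ys by simp
  have ge: "2 \<le> dg R C c"
  proof (rule ccontr)
    assume "\<not> ?thesis"
    then have "dense R (C - {c})" using dense_remove assms by (auto simp: mind_def)
    then show False using assms unfolding mind_def by blast
  qed
  have ysne: "ys \<noteq> []" using ys by (auto simp: cyc_def)
  have "{u \<in> C. R c u} \<subseteq> {hd ys, last ys}"
  proof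
    fix u assume u: "u \<in> {u \<in> C. R c u}"
    show "u \<in> {hd ys, last ys}"
    proof (rule ccontr)
      assume nu: "u \<notin> {hd ys, last ys}"
      have "u \<in> set ys" using u ys irr by auto
      then obtain as bs where ab: "ys = as @ u # bs" by (metis split_list)
      then have ne: "as \<noteq> []" "bs \<noteq> []" using nu by (auto simp: hd_append)
      let ?K = "set (as @ [u])"
      have dis: "distinct (c # ys)" and su: "successively R ys" "R c (hd ys)"
        using ys ysne by (auto simp: cyc_def successively_Cons)
      have "successively R (as @ [u])" using su ab by (auto simp: successively_append_iff)
      then have "conn R ?K" by (intro conn_successively) auto
      moreover have "c \<notin> ?K" using dis ab by auto
      moreover have "2 \<le> dg R ?K c"
        using u su ab ne nu by (subst dg_ge_2_iff) (auto intro!: bexI [of _ "hd as"] simp: hd_append)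
      ultimately have "dense R (insert c ?K)" using conn_dense_insert by blast
      moreover have "insert c ?K \<subset> C"
      proof
        show "insert c ?K \<subseteq> C" using ys ab by auto
        have "last bs \<in> C" "last bs \<notin> insert c ?K" using ys ab ne dis by (auto dest: last_in_set)
        then show "insert c ?K \<noteq> C" by blast
      qed
      ultimately show False using assms unfolding mind_def by blast
    qed
  qed
  then have "dg R C c \<le> card {hd ys, last ys}" unfolding dg_def by (intro card_mono) auto
  also have "\<dots> \<le> 2" by (cases "hd ys = last ys") auto
  finally show ?thesis using ge by simp
qed

text \<open>The interiors \<open>I\<close> and \<open>J\<close> of the two arcs between two vertices of a cycle.\<close>

lemma mind_arcs:
  assumes "mind C" "c \<in> C" "d \<in> C" "c \<noteq> d"
  obtains I J where "C = {c, d} \<union> I \<union> J" "{c, d} \<inter> I = {}" "{c, d} \<inter> J = {}" "I \<inter> J = {}"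
    "conn R ({c, d} \<union> I)" "conn R ({c, d} \<union> J)"
    "2 \<le> card I \<longrightarrow> (\<exists>x\<in>I. \<exists>y\<in>I. R x y)" "2 \<le> card J \<longrightarrow> (\<exists>x\<in>J. \<exists>y\<in>J. R x y)"
proof -
  obtain ys where ys: "cyc (c # ys)" "C = set (c # ys)" using mind_cyc [OF assms(1,2)] by blast
  then have "d \<in> set ys" using assms by auto
  then obtain as bs where ab: "ys = as @ d # bs" by (metis split_list)
  have s: "successively R (c # as @ d # bs)" "distinct (c # as @ d # bs)" "R (last (d # bs)) c"
    using ys ab by (auto simp: cyc_def)
  have "successively R ((c # as @ [d]) @ bs)" "successively R ((c # as) @ d # bs)" using s(1) by simp_all
  then have s1: "successively R (c # as @ [d])" "successively R (d # bs)" "successively R as" "successively R bs"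
    by (auto simp only: successively_append_iff) (auto simp: successively_Cons)
  have adj: "2 \<le> card (set zs) \<longrightarrow> (\<exists>x\<in>set zs. \<exists>y\<in>set zs. R x y)" if "successively R zs" for zs
  proof
    assume "2 \<le> card (set zs)"
    then have "2 \<le> length zs" using card_length order_trans by blast
    then obtain x y rest where "zs = x # y # rest" by (metis Suc_le_length_iff numeral_2_eq_2)
    then show "\<exists>x\<in>set zs. \<exists>y\<in>set zs. R x y" using that by auto
  qed
  have "conn R (set (c # as @ [d]))" using s1(1) by (intro conn_successively) auto
  moreover have "set (c # as @ [d]) = {c, d} \<union> set as" by auto
  ultimately have k1: "conn R ({c, d} \<union> set as)" by simp
  have "successively R ((d # bs) @ [c])"
    using s1(2) s(3) successively_append_iff [of R "d # bs" "[c]"] by simp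
  then have "conn R (set ((d # bs) @ [c]))" by (intro conn_successively) auto
  moreover have "set ((d # bs) @ [c]) = {c, d} \<union> set bs" by auto
  ultimately have k2: "conn R ({c, d} \<union> set bs)" by simp
  show ?thesis
  proof (rule that [of "set as" "set bs"])
    show "C = {c, d} \<union> set as \<union> set bs" using ys(2) ab by auto
    show "{c, d} \<inter> set as = {}" "{c, d} \<inter> set bs = {}" "set as \<inter> set bs = {}" using s(2) by auto
  qed (use k1 k2 adj [OF s1(3)] adj [OF s1(4)] in blast)+
qed

lemma dense_card: "dense R X \<Longrightarrow> 3 \<le> card X"
proof -
  assume "dense R X"
  then obtain xs where "cyc xs" "set xs \<subseteq> X" "finite X" using dense_cyc by (auto simp: dense_def)
  then show ?thesis unfolding cyc_def by (metis card_mono distinct_card order_trans)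
qed

lemma mind_remove_conn: assumes "mind C" "c \<in> C" shows "conn R (C - {c})"
proof -
  obtain ys where ys: "cyc (c # ys)" "C = set (c # ys)" using mind_cyc assms by blast
  then have "C - {c} = set ys" "ys \<noteq> []" by (auto simp: cyc_def)
  then show ?thesis using ys by (auto simp: cyc_def successively_Cons intro: conn_successively)
qed

end

section \<open>Minimal counterexamples\<close>

text \<open>Transfers a packing from a reduced graph back to the original one: \<open>g\<close> is
  the identity after deleting an edge, and restores the contracted vertex after a
  contraction.\<close>

lemma packs_map:
  assumes "packs R' V' n"
    and "\<And>X. X \<subseteq> V' \<Longrightarrow> dense R' X \<Longrightarrow> g X \<subseteq> V \<and> dense R (g X)"
    and "\<And>X Y. X \<inter> Y = {} \<Longrightarrow> X \<subseteq> V' \<Longrightarrow> Y \<subseteq> V' \<Longrightarrow> g X \<inter> g Y = {}"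
  shows "packs R V n"
proof -
  obtain F where F: "finite F" "card F = n" "\<forall>X\<in>F. X \<subseteq> V' \<and> dense R' X" "pairwise disjnt F"
    using packsE [OF assms(1)] .
  have dis: "g X \<inter> g Y = {}" if "X \<in> F" "Y \<in> F" "X \<noteq> Y" for X Y
    using assms(3) [of X Y] pairwiseD [OF F(4) that] F(3) that by (simp add: disjnt_def)
  have inj: "inj_on g F"
  proof (rule inj_onI, rule ccontr)
    fix X Y assume XY: "X \<in> F" "Y \<in> F" "g X = g Y" "X \<noteq> Y"
    then have "g X = {}" using dis [of X Y] by simp
    moreover have "dense R (g X)" using assms(2) F(3) XY by simp
    ultimately show False by (simp add: dense_def)
  qed
  have "pairwise disjnt (g ` F)"
  proof (rule pairwiseI)
    fix A B assume "A \<in> g ` F" "B \<in> g ` F" "A \<noteq> B"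
    then obtain X Y where "A = g X" "B = g Y" "X \<in> F" "Y \<in> F" "X \<noteq> Y" by blast
    then show "disjnt A B" using dis by (simp add: disjnt_def)
  qed
  moreover have "\<forall>A\<in>g ` F. A \<subseteq> V \<and> dense R A" using assms(2) F(3) by simp
  ultimately show ?thesis
    unfolding packs_def using F inj by (intro exI [of _ "g ` F"]) (simp add: card_image)
qed

lemma dg_rel_mono:
  "finite X \<Longrightarrow> (\<And>u. u \<in> X \<Longrightarrow> R v u \<Longrightarrow> S v u) \<Longrightarrow> dg R X v \<le> dg S X v"
  unfolding dg_def by (rule card_mono) auto

lemma dg_cong: "(\<And>u. u \<in> X \<Longrightarrow> R v u = S v u) \<Longrightarrow> dg R X v = dg S X v"
  unfolding dg_def by (rule arg_cong [where f = card]) auto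

lemma dense_rel_mono:
  assumes "dense R X" "\<And>u v. u \<in> X \<Longrightarrow> v \<in> X \<Longrightarrow> R u v \<Longrightarrow> S u v" shows "dense S X"
proof -
  have "eb R X X \<le> eb S X X"
    unfolding eb_def by (rule sum_mono, rule dg_rel_mono) (use assms in \<open>auto simp: dense_def\<close>)
  then show ?thesis using assms(1) by (auto simp: dense_def)
qed

text \<open>Summed over the degrees, \<open>ff\<close> gives \<open>|H| - |L|\<close>, and \<open>2 om \<ge> 1 + 3 ff\<close> brings in the order of
  the graph. Both weights survive the reductions below, which the hypotheses of the theorem do not.\<close>

definition ff :: "nat \<Rightarrow> nat \<Rightarrow> int" where
  "ff k d = (if 2 * k \<le> d then 1 else if d + 1 = 2 * k then 0 else - 1)"

definition om :: "nat \<Rightarrow> nat \<Rightarrow> int" where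
  "om k d = (if 2 * k \<le> d then 2 else if d + 1 = 2 * k then 1 else if d + 2 = 2 * k then 0 else - 1)"

text \<open>Since \<open>i \<le> k\<close>, the hypotheses of the theorem give
  \<open>3k - i \<ge> 2k\<close> for the first sum and \<open>16k + 3i + 3(3k - i) = 25k\<close> for
  twice the second one; \<open>i\<close> disappears here.\<close>

definition rich :: "('a \<Rightarrow> 'a \<Rightarrow> bool) \<Rightarrow> 'a set \<Rightarrow> nat \<Rightarrow> bool" where
  "rich R V k \<longleftrightarrow> 2 * int k \<le> (\<Sum>v\<in>V. ff k (dg R V v)) \<and> 25 * int k \<le> 2 * (\<Sum>v\<in>V. om k (dg R V v))"

section \<open>Reductions: deleting a vertex, deleting an edge, contracting an edge\<close>

locale graph = rel +
  fixes V :: "'a set" and k :: nat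
  assumes finV [simp]: "finite V" and k2: "2 \<le> k" and rich: "rich R V k" and nopack: "\<not> packs R V k"
begin

abbreviation "deg \<equiv> dg R V"

end

text \<open>Quantifying over relations on the same vertex type is enough, because the reductions
  create no new vertices. The measure is the number of vertices plus twice the number of edges, so
  that deleting an edge counts as progress.\<close>

locale min_graph = graph +
  assumes minimal: "\<And>(R' :: 'a \<Rightarrow> 'a \<Rightarrow> bool) V'. rel R' \<Longrightarrow> finite V' \<Longrightarrow> rich R' V' k \<Longrightarrow>
    card V' + eb R' V' V' < card V + eb R V V \<Longrightarrow> packs R' V' k"
begin

text \<open>Delete \<open>v\<close>. Its own weight is -1 under both functions because
  \<open>k \<ge> 2\<close>, and the single possible neighbour loses at most 1, as both functions
  change by at most 1 per unit of degree.\<close>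

lemma min_degree: assumes "v \<in> V" shows "2 \<le> deg v"
proof (rule ccontr)
  assume "\<not> ?thesis"
  then have dv: "deg v \<le> 1" by simp
  let ?W = "V - {v}"
  have eq: "deg u = dg R ?W u + (if R u v then 1 else 0)" for u
    using dg_Un [of ?W "{v}" R u] assms by (simp add: insert_absorb dg_singleton)
  have "(\<Sum>u\<in>?W. int (deg u) - int (dg R ?W u)) = (\<Sum>u\<in>?W. if R v u then 1 else 0)"
    by (rule sum.cong) (auto simp: eq sym_iff [of v])
  also have "\<dots> = int (card {u \<in> ?W. R v u})" by (simp add: sum.If_cases Int_def)
  also have "\<dots> \<le> 1"
    using dv card_mono [of "{u \<in> V. R v u}" "{u \<in> ?W. R v u}"] by (force simp: dg_def)
  finally have sm: "(\<Sum>u\<in>?W. int (deg u) - int (dg R ?W u)) \<le> 1" .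
  have lip: "\<phi> k (deg u) \<le> \<phi> k (dg R ?W u) + (int (deg u) - int (dg R ?W u))"
    if "\<phi> \<in> {ff, om}" for \<phi> u
    using that eq [of u] by (auto simp: ff_def om_def)
  have "(\<Sum>u\<in>V. \<phi> k (deg u)) \<le> (\<Sum>u\<in>?W. \<phi> k (dg R ?W u))" if "\<phi> \<in> {ff, om}" for \<phi>
  proof -
    have "(\<Sum>u\<in>V. \<phi> k (deg u)) = \<phi> k (deg v) + (\<Sum>u\<in>?W. \<phi> k (deg u))"
      using assms by (simp add: sum.remove)
    moreover have "(\<Sum>u\<in>?W. \<phi> k (deg u)) \<le> (\<Sum>u\<in>?W. \<phi> k (dg R ?W u) + (int (deg u) - int (dg R ?W u)))"
      by (rule sum_mono) (rule lip [OF that])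
    moreover have "\<phi> k (deg v) = - 1" using that dv k2 by (auto simp: ff_def om_def)
    ultimately show ?thesis using sm by (simp add: sum.distrib)
  qed
  from this [of ff] this [of om] have "rich R ?W k" using rich by (simp add: rich_def)
  moreover have "card ?W < card V" using assms by (intro card_Diff1_less) auto
  moreover have "eb R ?W ?W \<le> eb R V V" by (rule eb_mono) auto
  ultimately have "packs R ?W k" using minimal [of R ?W] rel_axioms by simp
  then show False using nopack packs_mono [of R ?W k V] by blast
qed

text \<open>Otherwise delete the edge. Both weights are constant on degrees up to
  \<open>2k - 3\<close> and on degrees from \<open>2k\<close> upwards, so neither end changes its
  weight.\<close>

lemma very_low_nbr:
  assumes "v \<in> V" "p \<in> V" "R v p" "deg v + 3 \<le> 2 * k"
  shows "2 * k \<le> deg p + 2 \<and> deg p \<le> 2 * k"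
proof (rule ccontr)
  assume neg: "\<not> ?thesis"
  define S where "S x y \<longleftrightarrow> R x y \<and> {x, y} \<noteq> {v, p}" for x y
  interpret S: rel S by standard (auto simp: S_def irr insert_commute intro: sym)
  have vp: "v \<noteq> p" using assms(3) irr by blast
  have eq: "deg u = dg S V u + (if u = v \<or> u = p then 1 else 0)" for u
  proof -
    have "u \<noteq> v \<Longrightarrow> u \<noteq> p \<Longrightarrow> deg u = dg S V u" by (rule dg_cong) (auto simp: S_def doubleton_eq_iff)
    moreover have "deg v = dg S V v + 1"
    proof -
      have "{u \<in> V. R v u} = insert p {u \<in> V. S v u}" using assms vp by (auto simp: S_def doubleton_eq_iff)
      moreover have "p \<notin> {u \<in> V. S v u}" by (simp add: S_def)
      ultimately show ?thesis by (simp add: dg_def)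
    qed
    moreover have "deg p = dg S V p + 1"
    proof -
      have "{u \<in> V. R p u} = insert v {u \<in> V. S p u}"
        using assms vp sym by (auto simp: S_def doubleton_eq_iff)
      moreover have "v \<notin> {u \<in> V. S p u}" by (auto simp: S_def)
      ultimately show ?thesis by (simp add: dg_def)
    qed
    ultimately show ?thesis by auto
  qed
  have "ff k (dg S V u) = ff k (deg u) \<and> om k (dg S V u) = om k (deg u)" for u
    using eq [of u] neg assms(4) by (auto simp: ff_def om_def split: if_splits)
  then have "rich S V k" using rich by (simp add: rich_def)
  moreover have "eb S V V < eb R V V"
    unfolding eb_def by (rule sum_strict_mono_ex1) (use assms eq in auto)
  ultimately have "packs S V k" using minimal [of S V] S.rel_axioms by simp
  moreover have "dense R X" if "dense S X" for X
    using that by (rule dense_rel_mono) (simp add: S_def)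
  ultimately have "packs R V k" by (intro packs_map [of S V k "\<lambda>X. X" V R]) simp_all
  then show False using nopack by blast
qed

text \<open>Otherwise contract the edge into \<open>b\<close>. Only common neighbours of
  \<open>a\<close> and \<open>b\<close> lose degree, one unit each, and above degree
  \<open>2k\<close> this costs no weight; \<open>b\<close> loses \<open>a\<close> but gains
  \<open>c\<close>; and the vertex \<open>a\<close> that disappears has weight at most 0.\<close>

lemma small_common_nbr:
  assumes "a \<in> V" "b \<in> V" "c \<in> V" "R a b" "R a c" "c \<noteq> b" "\<not> R c b" "deg a + 2 \<le> 2 * k"
  shows "\<exists>w\<in>V. R w a \<and> R w b \<and> deg w \<le> 2 * k"
proof (rule ccontr)
  assume neg: "\<not> ?thesis"
  then have big: "2 * k < deg w" if w: "w \<in> V" "R w a" "R w b" for w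
    using neg w not_le by blast
  let ?W = "V - {a}"
  define S where "S x y \<longleftrightarrow> R x y \<or> (x = b \<and> R a y \<and> y \<noteq> b) \<or> (y = b \<and> R a x \<and> x \<noteq> b)" for x y
  interpret S: rel S by standard (auto simp: S_def irr intro: sym)
  have ab: "a \<noteq> b" using assms irr by blast
  have eqW: "deg u = dg R ?W u + (if R u a then 1 else 0)" for u
    using dg_Un [of ?W "{a}" R u] assms by (simp add: insert_absorb dg_singleton)
  have other: "deg u = dg S ?W u + (if R u a \<and> R u b then 1 else 0)" if "u \<in> ?W" "u \<noteq> b" for u
  proof (cases "R u a \<and> \<not> R u b")
    case True
    have "{y \<in> ?W. S u y} = insert b {y \<in> ?W. R u y}"
      using True that assms ab sym by (auto simp: S_def)
    then have "dg S ?W u = dg R ?W u + 1" using True by (simp add: dg_def)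
    then show ?thesis using True eqW [of u] by simp
  next
    case False
    have "dg S ?W u = dg R ?W u"
      by (rule dg_cong) (use False that sym in \<open>auto simp: S_def\<close>)
    then show ?thesis using False eqW [of u] by auto
  qed
  have Sb: "{y \<in> ?W. S b y} = {y \<in> ?W. R b y} \<union> {y \<in> ?W. R a y \<and> y \<noteq> b}"
    by (auto simp: S_def)
  have b_ge: "deg b \<le> dg S ?W b"
  proof -
    have "card (insert c {y \<in> ?W. R b y}) \<le> dg S ?W b"
      unfolding dg_def using assms irr by (intro card_mono) (auto simp: S_def)
    moreover have "c \<notin> {y \<in> ?W. R b y}" using assms sym by blast
    ultimately have "dg R ?W b + 1 \<le> dg S ?W b" by (simp add: dg_def)
    then show ?thesis using eqW [of b] by (auto split: if_splits)
  qed
  have b_le: "dg S ?W b \<le> deg a + deg b"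
  proof -
    have "dg S ?W b \<le> dg R ?W b + card {y \<in> ?W. R a y \<and> y \<noteq> b}"
      unfolding dg_def Sb by (rule card_Un_le)
    also have "card {y \<in> ?W. R a y \<and> y \<noteq> b} \<le> deg a" unfolding dg_def by (intro card_mono) auto
    also have "dg R ?W b \<le> deg b" by (rule dg_mono) auto
    finally show ?thesis by simp
  qed
  have val: "\<phi> k (deg u) \<le> \<phi> k (dg S ?W u)" if "u \<in> ?W" "\<phi> \<in> {ff, om}" for u \<phi>
  proof (cases "u = b")
    case True then show ?thesis using b_ge that(2) by (auto simp: ff_def om_def)
  next
    case False
    then show ?thesis using other [OF that(1)] big [of u] that by (auto simp: ff_def om_def split: if_splits)
  qed
  have "(\<Sum>u\<in>V. \<phi> k (deg u)) \<le> (\<Sum>u\<in>?W. \<phi> k (dg S ?W u))" if "\<phi> \<in> {ff, om}" for \<phi>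
  proof -
    have "(\<Sum>u\<in>V. \<phi> k (deg u)) = \<phi> k (deg a) + (\<Sum>u\<in>?W. \<phi> k (deg u))"
      using assms by (simp add: sum.remove)
    moreover have "(\<Sum>u\<in>?W. \<phi> k (deg u)) \<le> (\<Sum>u\<in>?W. \<phi> k (dg S ?W u))"
      by (rule sum_mono) (rule val [OF _ that])
    moreover have "\<phi> k (deg a) \<le> 0" using that assms(8) by (auto simp: ff_def om_def)
    ultimately show ?thesis by simp
  qed
  from this [of ff] this [of om] have "rich S ?W k" using rich by (simp add: rich_def)
  moreover have "card ?W < card V" using assms by (intro card_Diff1_less) auto
  moreover have "eb S ?W ?W \<le> eb R V V"
  proof -
    have "eb S ?W ?W = dg S ?W b + (\<Sum>u\<in>?W - {b}. dg S ?W u)"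
      unfolding eb_def using assms ab by (subst sum.remove [of _ b]) auto
    also have "(\<Sum>u\<in>?W - {b}. dg S ?W u) \<le> (\<Sum>u\<in>?W - {b}. deg u)"
      by (rule sum_mono) (use other in force)
    also have "dg S ?W b + (\<Sum>u\<in>?W - {b}. deg u) \<le> deg a + (deg b + (\<Sum>u\<in>?W - {b}. deg u))"
      using b_le by simp
    also have "\<dots> = eb R V V"
      unfolding eb_def using assms ab by (simp add: sum.remove [of V a] sum.remove [of "V - {a}" b])
    finally show ?thesis by simp
  qed
  ultimately have pk: "packs S ?W k" using minimal [of S ?W] S.rel_axioms by simp
  have "packs R V k"
  \<comment> \<open>Restoring \<open>a\<close> next to \<open>b\<close> adds one vertex and the edge
    between them, while the edges inherited by \<open>b\<close> are at most those of
    \<open>a\<close> and \<open>b\<close> together; so density is kept.\<close>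
  proof (rule packs_map [OF pk, of "\<lambda>X. if b \<in> X then insert a X else X"])
    fix X assume X: "X \<subseteq> ?W" "dense S X"
    then have fin: "finite X" by (simp add: dense_def)
    show "(if b \<in> X then insert a X else X) \<subseteq> V \<and> dense R (if b \<in> X then insert a X else X)"
    proof (cases "b \<in> X")
      case True
      define Y where "Y = X - {b}"
      have Y: "X = insert b Y" "b \<notin> Y" "finite Y" "a \<notin> insert b Y" using True fin X ab by (auto simp: Y_def)
      have "{y \<in> Y. S b y} = {y \<in> Y. R b y} \<union> {y \<in> Y. R a y}" using Y by (auto simp: S_def)
      then have "dg S Y b \<le> dg R Y b + dg R Y a" unfolding dg_def by (simp add: card_Un_le)
      moreover have "eb S Y Y = eb R Y Y" unfolding eb_def
        by (intro sum.cong dg_cong) (use Y in \<open>auto simp: S_def\<close>)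
      moreover have "2 * card X \<le> eb S X X" using X by (simp add: dense_def)
      ultimately have "2 * card (insert a X) \<le> eb R (insert a X) (insert a X)"
        using Y assms(4) by (simp add: S.ds_insert ds_insert dg_insert)
      then show ?thesis using True X assms(1) fin by (auto intro: denseI)
    next
      case False
      then show ?thesis using X dense_rel_mono [OF X(2), of R] by (auto simp: S_def)
    qed
  next
    fix X Y assume "X \<inter> Y = {}" "X \<subseteq> ?W" "Y \<subseteq> ?W"
    then show "(if b \<in> X then insert a X else X) \<inter> (if b \<in> Y then insert a Y else Y) = {}"
      by auto
  qed
  then show False using nopack by blast
qed

end

text \<open>Exactly what the extremal argument takes from minimality; after this point the graph is
  fixed and never compared with a smaller one.\<close>

locale irred = graph +
  assumes min_deg: "v \<in> V \<Longrightarrow> 2 \<le> deg v"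
    and very_low: "\<lbrakk>v \<in> V; p \<in> V; R v p; deg v + 3 \<le> 2 * k\<rbrakk> \<Longrightarrow> 2 * k \<le> deg p + 2 \<and> deg p \<le> 2 * k"
    and small_nbr: "\<lbrakk>a \<in> V; b \<in> V; c \<in> V; R a b; R a c; c \<noteq> b; \<not> R c b; deg a + 2 \<le> 2 * k\<rbrakk>
      \<Longrightarrow> \<exists>w\<in>V. R w a \<and> R w b \<and> deg w \<le> 2 * k"
begin

lemma low_triangle:
  assumes "a \<in> V" "b \<in> V" "R a b" "deg a + 2 \<le> 2 * k"
  obtains w where "w \<in> V" "R w a" "R w b"
proof -
  obtain c where "c \<in> V" "R a c" "c \<noteq> b"
    using min_deg [OF assms(1)] by (auto simp: dg_ge_2_iff)
  then show ?thesis using small_nbr [of a b c] assms sym that by (cases "R c b") blast+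
qed

end

lemma (in min_graph) irred: "irred R V k"
  by unfold_locales (use min_degree very_low_nbr small_common_nbr in blast)+

section \<open>Degree sums in graphs with few disjoint cycles\<close>

context rel
begin

lemma dense_nbr_cover: "finite U \<Longrightarrow> U \<noteq> {} \<Longrightarrow> (\<And>v. v \<in> U \<Longrightarrow> 2 \<le> dg R U v) \<Longrightarrow> dense R U"
  using sum_bounded_below [of U 2 "dg R U"] by (intro denseI) (auto simp: eb_def mult.commute)

lemma eb_le_card: "(\<And>v. v \<in> X \<Longrightarrow> dg R Y v \<le> c) \<Longrightarrow> eb R X Y \<le> c * card X"
  using sum_bounded_above [of X "dg R Y" c] by (simp add: eb_def mult.commute)

lemma not_dense_eb: "finite U \<Longrightarrow> \<not> dense R U \<Longrightarrow> eb R U U \<le> 2 * card U"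
  by (cases "U = {}") (auto simp: dense_def)

text \<open>Passing to an inclusion-minimal subset does not enlarge the part outside
  \<open>Z\<close>, so shortness outside \<open>Z\<close> and chordlessness can be had
  together.\<close>

lemma min_dense:
  assumes "X \<subseteq> U" "dense R X"
  obtains C where "C \<subseteq> U" "mind C" "\<And>Y. Y \<subseteq> U \<Longrightarrow> dense R Y \<Longrightarrow> card (C - Z) \<le> card (Y - Z)"
proof -
  have "\<exists>C. (C \<subseteq> U \<and> dense R C) \<and> (\<forall>Y. Y \<subseteq> U \<and> dense R Y \<longrightarrow> card (C - Z) \<le> card (Y - Z))"
    by (rule ex_has_least_nat [where k = X]) (use assms in simp)
  then obtain B where B: "B \<subseteq> U" "dense R B" "\<And>Y. Y \<subseteq> U \<Longrightarrow> dense R Y \<Longrightarrow> card (B - Z) \<le> card (Y - Z)"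
    by blast
  obtain C where C: "C \<subseteq> B" "dense R C" "\<And>Y. Y \<subset> C \<Longrightarrow> \<not> dense R Y"
    using dense_min_subset [OF B(2)] by blast
  have "card (C - Z) \<le> card (B - Z)"
    using C(1) dense_finite [OF B(2)] by (intro card_mono) auto
  then show ?thesis using that [of C] B C by (auto simp: mind_def intro: order_trans)
qed

text \<open>Shortcut argument: a vertex with two links to a cycle that is minimal outside \<open>Z\<close>, each link
  being either an edge or a path through one vertex of \<open>Z\<close>, closes a cycle along one of the two arcs.\<close>

lemma no_two_links:
  assumes C: "C \<subseteq> U" "mind C" "\<And>Y. Y \<subseteq> U \<Longrightarrow> dense R Y \<Longrightarrow> card (C - Z) \<le> card (Y - Z)"
    and five: "\<And>Y. Y \<subseteq> U \<Longrightarrow> dense R Y \<Longrightarrow> 5 \<le> card (Y - Z)"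
    and a: "a \<in> U - C" and xy: "x \<in> U" "y \<in> U" "x \<noteq> y" "R a x" "R a y"
    and pq: "p \<in> C" "q \<in> C" and x: "x = p \<or> x \<in> Z \<and> R x p" and y: "y = q \<or> y \<in> Z \<and> R y q"
  shows False
proof (cases "p = q")
  case True
  let ?K = "insert x (insert y {p})"
  have "conn R (insert y {p})" using y True by (cases "y = p") (auto intro: conn_insert)
  then have "conn R ?K" using x by (cases "x = p") (auto intro: conn_insert simp: insert_absorb)
  moreover have "a \<notin> ?K" using a xy irr pq by auto
  moreover have "2 \<le> dg R ?K a" using xy by (auto simp: dg_ge_2_iff)
  ultimately have "dense R (insert a ?K)" by (rule conn_dense_insert)
  then have "5 \<le> card (insert a ?K - Z)" using five a xy pq C(1) by auto
  also have "\<dots> \<le> card {a, p}" using x y True by (intro card_mono) auto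
  also have "\<dots> \<le> 2" by (simp add: card_insert_if)
  finally show False by simp
next
  case False
  have finC: "finite C" using C(2) by (simp add: mind_def dense_def)
  have key: False if arc: "C = {p, q} \<union> I \<union> J" "{p, q} \<inter> J = {}" "I \<inter> J = {}" "conn R ({p, q} \<union> I)"
      "2 \<le> card (J - Z)" for I J
  proof -
    let ?K = "insert x (insert y ({p, q} \<union> I))"
    have "conn R (insert y ({p, q} \<union> I))"
      using y arc(4) by (cases "y = q") (auto intro: conn_insert simp: insert_absorb)
    then have "conn R ?K"
      using x by (cases "x = p") (auto intro: conn_insert simp: insert_absorb)
    moreover have "a \<notin> ?K" using a xy irr pq arc(1) by auto
    moreover have "2 \<le> dg R ?K a"
      using xy arc(1) finC by (subst dg_ge_2_iff) auto
    ultimately have "dense R (insert a ?K)" by (rule conn_dense_insert)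
    moreover have "insert a ?K \<subseteq> U" using a xy C(1) arc(1) by auto
    ultimately have "card (C - Z) \<le> card (insert a ?K - Z)" using C(3) by blast
    also have "\<dots> \<le> card (insert a ((C - Z) - (J - Z)))"
      using x y arc pq finC by (intro card_mono) auto
    also have "\<dots> \<le> Suc (card ((C - Z) - (J - Z)))" by (rule card_insert_le_m1) auto
    also have "card ((C - Z) - (J - Z)) = card (C - Z) - card (J - Z)"
      using arc(1) finC by (intro card_Diff_subset) auto
    finally have "card (C - Z) \<le> Suc (card (C - Z) - card (J - Z))" .
    moreover have "card (J - Z) \<le> card (C - Z)" using arc(1) finC by (intro card_mono) auto
    ultimately show False using arc(5) by linarith
  qed
  obtain I J where IJ: "C = {p, q} \<union> I \<union> J" "{p, q} \<inter> I = {}" "{p, q} \<inter> J = {}" "I \<inter> J = {}"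
    "conn R ({p, q} \<union> I)" "conn R ({p, q} \<union> J)"
    using mind_arcs [OF C(2) pq False] by metis
  have "card (C - Z) \<le> card ({p, q} \<union> (I - Z) \<union> (J - Z))"
    using IJ(1) finC by (intro card_mono) auto
  also have "\<dots> \<le> card {p, q} + card (I - Z) + card (J - Z)"
    by (meson add_le_mono1 card_Un_le order_trans)
  also have "card {p, q} \<le> 2" by (simp add: card_insert_if)
  finally have "card (C - Z) \<le> 2 + card (I - Z) + card (J - Z)" by simp
  moreover have "5 \<le> card (C - Z)" using five [of C] C(1,2) by (simp add: mind_def)
  ultimately have "2 \<le> card (I - Z) \<or> 2 \<le> card (J - Z)" by linarith
  then show False using key [of I J] key [of J I] IJ by (auto simp: Un_commute Un_left_commute Int_commute)
qed

text \<open>Each removed cycle accounts for two units of degree per vertex outside \<open>Z\<close>.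
  It is shortest outside \<open>Z\<close>, and its neighbours \<open>Y\<close> in \<open>Z\<close>
  are removed with it: by the shortcut argument every remaining vertex outside \<open>Z\<close> has
  at most one edge into \<open>C \<union> Y\<close>, and the surviving part of \<open>Z\<close> has
  none into \<open>C\<close>.\<close>

lemma degree_sum_bound:
  assumes "finite U" "Z \<subseteq> U" "\<And>X. X \<subseteq> U \<Longrightarrow> dense R X \<Longrightarrow> 5 \<le> card (X - Z)" "\<not> packs R U (Suc s)"
  shows "eb R (U - Z) U \<le> 2 * Suc s * card (U - Z) + card Z"
  using assms
proof (induction s arbitrary: U Z)
  case (0 U Z)
  have nd: "\<not> dense R X" if "X \<subseteq> U" for X
  proof
    assume "dense R X"
    then have "packs R X (Suc 0)" by (rule packs_1)
    then show False using 0(4) packs_mono that by blast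
  qed
  let ?W = "U - Z"
  \<comment> \<open>The claim is half the sum of these two bounds: edges between \<open>?W\<close>
    and \<open>Z\<close> count twice in \<open>eb R U U\<close> but once in
    \<open>eb R ?W U\<close>, hence the coefficient 1 of \<open>card Z\<close>.\<close>
  have "eb R U U \<le> 2 * card U" "eb R ?W ?W \<le> 2 * card ?W"
    using 0(1) nd by (auto intro!: not_dense_eb)
  moreover have "eb R U U = eb R ?W ?W + eb R Z Z + 2 * eb R ?W Z"
    using ds_Un [of ?W Z] 0(1,2) finite_subset [OF 0(2,1)] by (simp add: Un_absorb2 Int_commute)
  moreover have "eb R ?W U = eb R ?W ?W + eb R ?W Z"
    using eb_Diff_right [of U Z R ?W] 0(1,2) by simp
  moreover have "card U = card ?W + card Z"
    using 0(1,2) by (simp add: card_Diff_subset card_mono finite_subset)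
  ultimately show ?case by simp
next
  case (Suc s U Z)
  show ?case
  proof (cases "\<exists>X\<subseteq>U. dense R X")
    case False
    then have "\<not> packs R U (Suc s)"
      unfolding packs_def by (metis card.empty ex_in_conv nat.distinct(1))
    then have "eb R (U - Z) U \<le> 2 * Suc s * card (U - Z) + card Z" using Suc by blast
    then show ?thesis by simp
  next
    case True
    then obtain C where C: "C \<subseteq> U" "mind C"
      "\<And>Y. Y \<subseteq> U \<Longrightarrow> dense R Y \<Longrightarrow> card (C - Z) \<le> card (Y - Z)"
      using min_dense by metis
    note two = no_two_links [OF C Suc.prems(3)]
    define Y where "Y = {z \<in> Z - C. 0 < dg R C z}"
    define W where "W = U - C - Y"
    have fin: "finite U" "finite C" "finite Y" "finite W" "finite Z"
      using Suc.prems C(1) finite_subset [of _ U] by (auto simp: Y_def W_def)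
    have Ysub: "Y \<subseteq> Z - C" by (auto simp: Y_def)
    have npk: "\<not> packs R W (Suc s)"
    proof
      assume "packs R W (Suc s)"
      then have "packs R (W \<union> C) (Suc (Suc s))"
        using C(2) by (intro packs_Suc_Un) (auto simp: W_def mind_def)
      then show False using Suc.prems(4) packs_mono [of R "W \<union> C" _ U] C(1) by (auto simp: W_def)
    qed
    have "eb R (W - (Z - C - Y)) W \<le> 2 * Suc s * card (W - (Z - C - Y)) + card (Z - C - Y)"
    proof (rule Suc.IH)
      show "Z - C - Y \<subseteq> W" using Suc.prems(2) by (auto simp: W_def)
      fix X assume X: "X \<subseteq> W" "dense R X"
      have "X - (Z - C - Y) = X - Z" using X(1) by (auto simp: W_def)
      then show "5 \<le> card (X - (Z - C - Y))" using Suc.prems(3) [of X] X by (auto simp: W_def)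
    qed (use fin npk in auto)
    moreover define P where "P = W - (Z - C - Y)"
    ultimately have IH: "eb R P W \<le> 2 * Suc s * card P + card (Z - C - Y)" by simp
    define C' where "C' = C - Z"
    have P: "P = U - C - Z" using Ysub by (auto simp: P_def W_def)
    have split: "U - Z = C' \<union> P" "C' \<inter> P = {}" using C(1) by (auto simp: C'_def P)
    have U: "U = C \<union> Y \<union> W" "C \<inter> Y = {}" "(C \<union> Y) \<inter> W = {}"
      using C(1) Ysub Suc.prems(2) by (auto simp: W_def)
    have finP: "finite P" "finite C'" using fin by (auto simp: P C'_def)
    have outer: "dg R (C \<union> Y) a \<le> 1" if "a \<in> P" for a
    proof (rule ccontr)
      assume "\<not> ?thesis"
      then obtain x y where xy: "x \<in> C \<union> Y" "y \<in> C \<union> Y" "x \<noteq> y" "R a x" "R a y"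
        using fin two_nbrs [of "C \<union> Y" R a] by blast
      have root: "\<exists>p\<in>C. x = p \<or> x \<in> Z \<and> R x p" if "x \<in> C \<union> Y" for x
        using that fin by (auto simp: Y_def dg_pos_iff)
      obtain p q where "p \<in> C" "q \<in> C" "x = p \<or> x \<in> Z \<and> R x p" "y = q \<or> y \<in> Z \<and> R y q"
        using root [OF xy(1)] root [OF xy(2)] by blast
      moreover have "a \<in> U - C" "x \<in> U" "y \<in> U" using xy that U(1) by (auto simp: P)
      ultimately show False using two [of a x y p q] xy(3-5) by blast
    qed
    have inner: "dg R C z \<le> 1" if "z \<in> Z - C" for z
    proof (rule ccontr)
      assume "\<not> ?thesis"
      then obtain x y where xy: "x \<in> C" "y \<in> C" "x \<noteq> y" "R z x" "R z y"
        by (rule two_nbrs [OF fin(2)])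
      moreover have "z \<in> U - C" using that Suc.prems(2) by auto
      ultimately show False using two [of z x y x y] C(1) by blast
    qed
    have "eb R (U - Z) U = eb R C' U + eb R P U"
      using split finP by (simp add: eb_Un_left)
    moreover have "eb R P U = eb R P (C \<union> Y) + eb R P W"
      using U fin by (metis eb_Un_right finite_UnI)
    moreover have "eb R P (C \<union> Y) \<le> card P" using eb_le_card [OF outer, of P] by simp
    moreover have "eb R C' U = eb R C' C + eb R C' Y + eb R C' W"
      using U fin by (metis eb_Un_right finite_UnI)
    moreover have "eb R C' C = 2 * card C'"
      unfolding eb_def using mind_dg [OF C(2)] by (simp add: C'_def)
    moreover have "eb R C' Y \<le> card Y"
    proof -
      have "eb R C' Y \<le> eb R C Y" using fin by (intro eb_mono) (auto simp: C'_def)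
      also have "\<dots> = eb R Y C" using fin by (intro dg_swap)
      also have "\<dots> \<le> 1 * card Y" by (intro eb_le_card inner) (use Ysub in auto)
      finally show ?thesis by simp
    qed
    moreover have "eb R C' W \<le> card P"
    proof -
      have "eb R C' W \<le> eb R C W" using fin by (intro eb_mono) (auto simp: C'_def)
      also have "\<dots> = eb R W C" using fin by (intro dg_swap)
      also have "\<dots> = eb R P C + eb R (Z - C - Y) C"
      proof -
        have "Z - C - Y \<subseteq> W" using Suc.prems(2) by (auto simp: W_def)
        then show ?thesis using eb_Diff_left [of W "Z - C - Y" R C] fin(4) by (simp add: P_def)
      qed
      also have "eb R (Z - C - Y) C \<le> 0 * card (Z - C - Y)"
        by (rule eb_le_card) (auto simp: Y_def)
      also have "eb R P C \<le> 1 * card P"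
        using outer fin by (intro eb_le_card) (meson dg_mono finite_UnI order_trans sup_ge1)
      finally show ?thesis by simp
    qed
    moreover have "card (U - Z) = card C' + card P" using split finP by (simp add: card_Un_disjoint)
    moreover have "card (Z - C - Y) + card Y \<le> card Z"
    proof -
      have "card (Z - C - Y \<union> Y) = card (Z - C - Y) + card Y"
        using fin by (intro card_Un_disjoint) auto
      moreover have "card (Z - C - Y \<union> Y) \<le> card Z" using fin Ysub by (intro card_mono) auto
      ultimately show ?thesis by simp
    qed
    ultimately show ?thesis using IH by (simp add: algebra_simps)
  qed
qed

text \<open>A shortest cycle with at least five vertices meets the neighbourhood of any vertex
  outside it at most once, so removing it lowers the minimum degree by at most 1.\<close>

lemma min_degree_packs:
  assumes "finite U" "U \<noteq> {}" "\<And>X. X \<subseteq> U \<Longrightarrow> dense R X \<Longrightarrow> 5 \<le> card X" "\<And>v. v \<in> U \<Longrightarrow> s + 2 \<le> dg R U v"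
  shows "packs R U (Suc s)"
  using assms
proof (induction s arbitrary: U)
  case (0 U)
  then have "dense R U" by (intro dense_nbr_cover) (auto simp: numeral_2_eq_2)
  then show ?case by (rule packs_1)
next
  case (Suc s U)
  have "dense R U" using Suc.prems by (intro dense_nbr_cover) force+
  then obtain C where C: "C \<subseteq> U" "mind C" "\<And>Y. Y \<subseteq> U \<Longrightarrow> dense R Y \<Longrightarrow> card (C - {}) \<le> card (Y - {})"
    using min_dense [of U U "{}"] by auto
  have finC: "finite C" using C(1) Suc.prems(1) finite_subset by blast
  have deg: "dg R U v = dg R C v + dg R (U - C) v" for v
    using dg_Diff [OF Suc.prems(1) C(1), of R v] by simp
  have "packs R (U - C) (Suc s)"
  proof (rule Suc.IH)
    obtain v where v: "v \<in> C" using C(2) dense_ne by (force simp: mind_def)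
    then have "0 < dg R (U - C) v"
      using deg [of v] mind_dg [OF C(2) v] Suc.prems(4) [of v] C(1) by auto
    then show "U - C \<noteq> {}" by (metis dg_empty less_irrefl)
    fix v assume v: "v \<in> U - C"
    have "dg R C v \<le> 1"
    proof (rule ccontr)
      assume "\<not> ?thesis"
      then obtain x y where "x \<in> C" "y \<in> C" "x \<noteq> y" "R v x" "R v y"
        by (rule two_nbrs [OF finC])
      then show False
        using no_two_links [OF C, of v x y x y] Suc.prems(3) v subsetD [OF C(1)] by simp
    qed
    then show "s + 2 \<le> dg R (U - C) v" using deg [of v] Suc.prems(4) [of v] v by auto
  qed (use Suc.prems in auto)
  then have "packs R (U - C \<union> C) (Suc (Suc s))"
    using C(2) by (intro packs_Suc_Un) (auto simp: mind_def)
  then show ?case using C(1) by (simp add: Un_absorb2)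
qed

end

section \<open>Extremal families of cycles\<close>

context irred
begin

definition L :: "'a set" where "L = {v \<in> V. deg v + 3 \<le> 2 * k}"

definition nl :: "'a set \<Rightarrow> nat" where "nl X = card (X - L)"

definition adm :: "'a set set \<Rightarrow> bool" where
  "adm F \<longleftrightarrow> finite F \<and> (\<forall>X\<in>F. X \<subseteq> V \<and> dense R X \<and> nl X \<le> 4) \<and> pairwise disjnt F"

lemma nl_mono: "finite Y \<Longrightarrow> X \<subseteq> Y \<Longrightarrow> nl X \<le> nl Y"
  unfolding nl_def by (rule card_mono) auto

lemma nl_le_card: "finite X \<Longrightarrow> nl X \<le> card X"
  unfolding nl_def by (rule card_mono) auto

lemma L_nbr: "v \<in> L \<Longrightarrow> p \<in> V \<Longrightarrow> R v p \<Longrightarrow> p \<notin> L \<and> 2 * k \<le> deg p + 2 \<and> deg p \<le> 2 * k"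
  using very_low [of v p] by (auto simp: L_def)

lemma adm_insert:
  assumes "adm F" "X \<subseteq> V - \<Union>F" "dense R X" "nl X \<le> 4"
  shows "adm (insert X F)" "card (insert X F) = Suc (card F)" "X \<notin> F"
proof -
  show nin: "X \<notin> F" using assms(2) dense_ne [OF assms(3)] by blast
  have "disjnt X Y" if "Y \<in> F" for Y using assms(2) that by (auto simp: disjnt_def)
  then show "adm (insert X F)"
    using assms by (auto simp: adm_def pairwise_insert disjnt_sym)
  show "card (insert X F) = Suc (card F)" using nin assms(1) by (simp add: adm_def)
qed

end

locale system = irred +
  fixes QQ :: "'a set set"
  assumes adm: "adm QQ"
    and max_card: "adm F \<Longrightarrow> card F \<le> card QQ"
    and min_size: "\<lbrakk>adm F; card F = card QQ\<rbrakk> \<Longrightarrow> sum card QQ \<le> sum card F"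
    and max_ds: "\<lbrakk>adm F; card F = card QQ; sum card F = sum card QQ\<rbrakk> \<Longrightarrow>
      eb R (V - \<Union>F) (V - \<Union>F) \<le> eb R (V - \<Union>QQ) (V - \<Union>QQ)"

lemma (in irred) system_exists: "\<exists>QQ. system R V k QQ"
proof -
  have "adm {}" by (simp add: adm_def)
  moreover have "\<forall>F. adm F \<longrightarrow> card F < Suc (card (Pow V))"
    by (auto simp: adm_def less_Suc_eq_le intro!: card_mono)
  ultimately obtain F1 where F1: "adm F1" "\<And>F. adm F \<Longrightarrow> card F \<le> card F1"
    using ex_has_greatest_nat [of adm "{}" card] by blast
  let ?P = "\<lambda>F. adm F \<and> card F = card F1"
  have "\<exists>F. ?P F \<and> (\<forall>G. ?P G \<longrightarrow> sum card F \<le> sum card G)"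
    by (rule ex_has_least_nat [where k = F1]) (use F1 in simp)
  then obtain F2 where F2: "?P F2" "\<And>G. ?P G \<Longrightarrow> sum card F2 \<le> sum card G" by blast
  let ?Q = "\<lambda>F. ?P F \<and> sum card F = sum card F2"
  let ?d = "\<lambda>F. eb R (V - \<Union>F) (V - \<Union>F)"
  have "\<exists>F. ?Q F \<and> (\<forall>G. ?Q G \<longrightarrow> ?d G \<le> ?d F)"
  proof (rule ex_has_greatest_nat [of ?Q F2 ?d "Suc (eb R V V)"])
    show "?Q F2" using F2 by simp
    show "\<forall>F. ?Q F \<longrightarrow> ?d F < Suc (eb R V V)" by (auto simp: less_Suc_eq_le intro!: eb_mono)
  qed
  then obtain F3 where F3: "?Q F3" "\<And>G. ?Q G \<Longrightarrow> ?d G \<le> ?d F3" by blast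
  have "system R V k F3"
  proof (unfold_locales)
    show "adm F3" using F3 by simp
    show "card F \<le> card F3" if "adm F" for F using F1(2) [OF that] F3(1) by simp
    show "sum card F3 \<le> sum card F" if "adm F" "card F = card F3" for F
      using F2(2) [of F] F3(1) that by simp
    show "?d F \<le> ?d F3" if "adm F" "card F = card F3" "sum card F = sum card F3" for F
      using F3(2) [of F] F3(1) that by simp
  qed
  then show ?thesis by blast
qed

context system
begin

section \<open>The remainder, and exchanges of one cycle\<close>

definition U :: "'a set" where "U = V - \<Union>QQ"
definition N :: "'a set" where "N = U - L"
definition Z :: "'a set" where "Z = U \<inter> L"
definition t :: nat where "t = card QQ"
text \<open>The number of cycles by which the family falls short of \<open>k - 1\<close>: as
  \<open>t + s + 1 = k\<close>, the remainder cannot contain \<open>s + 1\<close> disjoint dense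
  sets.\<close>

definition s :: nat where "s = k - 1 - t"

lemma QQ_facts: assumes "Q \<in> QQ"
  shows "Q \<subseteq> V" "dense R Q" "nl Q \<le> 4" "finite Q" "U \<inter> Q = {}" "Q \<noteq> {}"
proof -
  show "Q \<subseteq> V" "dense R Q" "nl Q \<le> 4" "U \<inter> Q = {}" using adm assms by (auto simp: adm_def U_def)
  then show "finite Q" "Q \<noteq> {}" using dense_finite dense_ne by blast+
qed

lemma finQQ [simp]: "finite QQ" and disj: "pairwise disjnt QQ"
  using adm by (auto simp: adm_def)

lemma QQ_disjoint: "Q \<in> QQ \<Longrightarrow> P \<in> QQ \<Longrightarrow> P \<noteq> Q \<Longrightarrow> P \<inter> Q = {}"
  using pairwiseD [OF disj] by (auto simp: disjnt_def)

lemma U_sub: "U \<subseteq> V" and finU [simp]: "finite U" and finN [simp]: "finite N" and finZ [simp]: "finite Z"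
  and N_sub: "N \<subseteq> U" and Z_sub: "Z \<subseteq> U" and NZ: "U = N \<union> Z" "N \<inter> Z = {}" "U - Z = N" "N \<inter> L = {}"
  by (auto simp: U_def N_def Z_def)

lemma packs_QQ: "packs R (\<Union>QQ) t"
  unfolding packs_def using adm by (intro exI [of _ QQ]) (auto simp: adm_def t_def)

lemma t_less: "t < k"
  using packs_le [OF packs_mono [OF packs_QQ], of V k] nopack QQ_facts(1) not_less by blast

lemma k_eq: "k = t + s + 1"
  using t_less by (simp add: s_def)

lemma no_packs_U: "\<not> packs R U (Suc s)"
proof
  assume "packs R U (Suc s)"
  then have "packs R (\<Union>QQ \<union> U) (t + Suc s)" by (intro packs_Un packs_QQ) (auto simp: U_def)
  moreover have "\<Union>QQ \<union> U \<subseteq> V" using QQ_facts(1) U_sub by blast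
  ultimately have "packs R V (t + Suc s)" by (rule packs_mono)
  moreover have "t + Suc s = k" using k_eq by linarith
  ultimately show False using nopack by simp
qed

lemma adm_remove: "adm (QQ - {Q})"
  using adm by (auto simp: adm_def intro: pairwise_subset)

lemma UQ_avoid: "Q \<in> QQ \<Longrightarrow> X \<subseteq> U \<union> Q \<Longrightarrow> X \<subseteq> V - \<Union>(QQ - {Q})"
  using QQ_facts(1) [of Q] QQ_disjoint [of Q] unfolding U_def by blast

lemma no_packs_UQ: assumes "Q \<in> QQ" shows "\<not> packs R (U \<union> Q) (Suc (Suc s))"
proof
  assume "packs R (U \<union> Q) (Suc (Suc s))"
  moreover have "packs R (\<Union>(QQ - {Q})) (t - 1)"
    unfolding packs_def using adm_remove [of Q] assms by (intro exI [of _ "QQ - {Q}"]) (auto simp: adm_def t_def)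
  moreover have "\<Union>(QQ - {Q}) \<inter> (U \<union> Q) = {}" using UQ_avoid [OF assms, of "U \<union> Q"] by blast
  ultimately have "packs R (\<Union>(QQ - {Q}) \<union> (U \<union> Q)) (t - 1 + Suc (Suc s))" by (intro packs_Un)
  moreover have "t \<noteq> 0" using assms by (auto simp: t_def)
  then have "t - 1 + Suc (Suc s) = k" using k_eq by linarith
  moreover have "\<Union>(QQ - {Q}) \<union> (U \<union> Q) \<subseteq> V" using QQ_facts(1) U_sub assms by blast
  ultimately show False using nopack packs_mono by metis
qed

text \<open>A dense set in \<open>U\<close> with fewer vertices outside \<open>L\<close> could be
  added to the family.\<close>

lemma U_dense_nl: assumes "X \<subseteq> U" "dense R X" shows "5 \<le> nl X"
proof (rule ccontr)
  assume "\<not> ?thesis"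
  then have "adm (insert X QQ)" "card (insert X QQ) = Suc (card QQ)"
    using adm_insert [OF adm, of X] assms by (auto simp: U_def)
  then show False using max_card [of "insert X QQ"] by simp
qed

text \<open>Replacing \<open>Q\<close> by \<open>X\<close> keeps the number of cycles, so the two
  remaining optimality conditions apply: total size, and at equal size the edges left in the
  remainder.\<close>

lemma exchange:
  assumes Q: "Q \<in> QQ" and X: "X \<subseteq> U \<union> Q" "dense R X" "nl X \<le> 4"
  shows "card Q \<le> card X"
    and "card X = card Q \<Longrightarrow> eb R ((U \<union> Q) - X) ((U \<union> Q) - X) \<le> eb R U U"
proof -
  let ?F = "insert X (QQ - {Q})"
  have F: "adm ?F" "card ?F = Suc (card (QQ - {Q}))" "X \<notin> QQ - {Q}"
    using adm_insert [OF adm_remove UQ_avoid [OF Q X(1)] X(2,3)] by auto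
  have c: "card ?F = card QQ" using F(2) card.remove [OF finQQ Q] by simp
  have sm: "sum card QQ = card Q + sum card (QQ - {Q})" "sum card ?F = card X + sum card (QQ - {Q})"
    using sum.remove [OF finQQ Q, of card] F(3) by simp_all
  show "card Q \<le> card X" using min_size [OF F(1) c] sm by simp
  assume "card X = card Q"
  then have "eb R (V - \<Union>?F) (V - \<Union>?F) \<le> eb R (V - \<Union>QQ) (V - \<Union>QQ)"
    using max_ds [OF F(1) c] sm by simp
  moreover have "V - \<Union>?F = (U \<union> Q) - X"
    using QQ_facts(1) [OF Q] QQ_disjoint [OF Q] unfolding U_def by blast
  ultimately show "eb R ((U \<union> Q) - X) ((U \<union> Q) - X) \<le> eb R U U" by (simp add: U_def)
qed

lemma mind_Q: assumes "Q \<in> QQ" shows "mind Q"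
  unfolding mind_def
proof (intro conjI allI impI notI)
  fix X assume X: "X \<subset> Q" "dense R X"
  have "nl X \<le> nl Q" using X QQ_facts(4) [OF assms] by (intro nl_mono) auto
  then have "nl X \<le> 4" using QQ_facts(3) [OF assms] by simp
  moreover have "X \<subseteq> U \<union> Q" using X(1) by blast
  ultimately have "card Q \<le> card X" using exchange(1) [OF assms] X(2) by blast
  then show False using psubset_card_mono [OF QQ_facts(4) [OF assms] X(1)] by simp
qed (rule QQ_facts(2) [OF assms])

lemma card_Q: "Q \<in> QQ \<Longrightarrow> 3 \<le> card Q"
  by (intro dense_card QQ_facts(2))

lemma Q4_nonadjacent:
  assumes "Q \<in> QQ" "4 \<le> card Q" "a \<in> U" "c \<in> Q" "d \<in> Q" "R a c" "R a d"
  shows "\<not> R c d"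
proof
  assume cd: "R c d"
  let ?X = "{a, c, d}"
  have "dense R ?X" "card ?X = 3" using triangle_dense [of a c d] assms cd by auto
  moreover have "nl ?X \<le> card ?X" by (rule nl_le_card) auto
  ultimately show False using exchange(1) [OF assms(1), of ?X] assms by auto
qed

text \<open>Three neighbours of \<open>a\<close> would be pairwise nonadjacent, so each would have
  only the fourth vertex as a neighbour in the quadrilateral.\<close>

lemma Q4_dg: assumes Q: "Q \<in> QQ" "card Q = 4" and a: "a \<in> U" shows "dg R Q a \<le> 2"
proof (rule ccontr)
  have fin: "finite Q" using QQ_facts Q by blast
  assume "\<not> ?thesis"
  then obtain T where T: "T \<subseteq> {u \<in> Q. R a u}" "card T = 3"
    unfolding dg_def by (metis obtain_subset_with_card_n not_less_eq_eq eval_nat_numeral(3))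
  then obtain c where c: "c \<in> T" by fastforce
  then have "{u \<in> Q. R c u} \<subseteq> Q - T"
    using Q4_nonadjacent [OF Q(1) _ a, of c] Q(2) T(1) by auto
  then have "dg R Q c \<le> card (Q - T)" unfolding dg_def using fin by (intro card_mono) auto
  also have "\<dots> = 1" using T Q(2) fin by (subst card_Diff_subset) (auto intro: finite_subset)
  finally show False using mind_dg [OF mind_Q [OF Q(1)], of c] c T(1) by auto
qed

text \<open>With two neighbours \<open>c\<close> and \<open>d\<close>, the vertex \<open>a\<close>
  can replace the interior \<open>J\<close> of an arc with at least two vertices. \<open>J\<close>
  spans an edge and \<open>L\<close> is independent, so at least one vertex outside \<open>L\<close>
  is given up for \<open>a\<close>: the new cycle is shorter and still admissible.\<close>

lemma Q5_dg: assumes Q: "Q \<in> QQ" "5 \<le> card Q" and a: "a \<in> U" shows "dg R Q a \<le> 1"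
proof (rule ccontr)
  have fin: "finite Q" using QQ_facts Q by blast
  assume "\<not> ?thesis"
  then obtain c d where cd: "c \<in> Q" "d \<in> Q" "c \<noteq> d" "R a c" "R a d"
    by (rule two_nbrs [OF fin])
  have aQ: "a \<notin> Q" using QQ_facts(5) [OF Q(1)] a by blast
  have key: False if arc: "Q = {c, d} \<union> I \<union> J" "{c, d} \<inter> J = {}" "I \<inter> J = {}" "conn R ({c, d} \<union> I)"
      "2 \<le> card J" "\<exists>x\<in>J. \<exists>y\<in>J. R x y" for I J
  proof -
    let ?X = "insert a ({c, d} \<union> I)"
    have "2 \<le> dg R ({c, d} \<union> I) a" using cd fin arc(1) by (subst dg_ge_2_iff) auto
    then have de: "dense R ?X" using arc aQ by (intro conn_dense_insert) auto
    have finI: "finite ({c, d} \<union> I)" "finite J" using fin arc(1) by auto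
    have dj: "({c, d} \<union> I) \<inter> J = {}" using arc by auto
    then have cQ: "card Q = card ({c, d} \<union> I) + card J"
      using card_Un_disjoint [OF finI dj] arc(1) by simp
    have "Q - L = ({c, d} \<union> I - L) \<union> (J - L)" using arc(1) by blast
    moreover have "card (({c, d} \<union> I - L) \<union> (J - L)) = card ({c, d} \<union> I - L) + card (J - L)"
      using finI dj by (intro card_Un_disjoint) blast+
    ultimately have nQ: "nl Q = nl ({c, d} \<union> I) + nl J" by (simp add: nl_def)
    obtain x y where xy: "x \<in> J" "y \<in> J" "R x y" using arc(6) by blast
    then have "x \<notin> L \<or> y \<notin> L" using L_nbr [of x y] QQ_facts(1) [OF Q(1)] arc(1) by auto
    then have "J - L \<noteq> {}" using xy by blast
    then have "1 \<le> nl J" using finI by (simp add: nl_def Suc_le_eq card_gt_0_iff)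
    moreover have "nl ?X \<le> Suc (nl ({c, d} \<union> I))"
      using finI(1) unfolding nl_def by (cases "a \<in> L") (auto simp: insert_Diff_if card_insert_if)
    ultimately have "nl ?X \<le> 4" using nQ QQ_facts(3) [OF Q(1)] by simp
    moreover have "card ?X < card Q" using cQ arc(5) finI(1) by (simp add: card_insert_if)
    moreover have "?X \<subseteq> U \<union> Q" using a arc(1) by auto
    ultimately show False using exchange(1) [OF Q(1) _ de] by auto
  qed
  obtain I J where IJ: "Q = {c, d} \<union> I \<union> J" "{c, d} \<inter> I = {}" "{c, d} \<inter> J = {}" "I \<inter> J = {}"
    "conn R ({c, d} \<union> I)" "conn R ({c, d} \<union> J)"
    "2 \<le> card I \<longrightarrow> (\<exists>x\<in>I. \<exists>y\<in>I. R x y)" "2 \<le> card J \<longrightarrow> (\<exists>x\<in>J. \<exists>y\<in>J. R x y)"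
    using mind_arcs [OF mind_Q [OF Q(1)] cd(1,2,3)] by metis
  have "card Q \<le> card {c, d} + card I + card J"
    using IJ(1) by (metis add_le_mono1 card_Un_le order_trans)
  moreover have "card {c, d} = 2" using cd(3) by simp
  ultimately have "2 \<le> card I \<or> 2 \<le> card J" using Q(2) by linarith
  then show False
  proof
    assume "2 \<le> card I"
    then show False using key [of J I] IJ by (simp add: Un_ac Int_commute)
  next
    assume "2 \<le> card J"
    then show False using key [of I J] IJ by simp
  qed
qed

lemma few_common_nbrs:
  assumes "a \<in> U" "b \<in> U" "a \<noteq> b" shows "card {u \<in> U. R a u \<and> R b u} \<le> 1"
proof (rule ccontr)
  assume "\<not> ?thesis"
  then obtain T where "T \<subseteq> {u \<in> U. R a u \<and> R b u}" "card T = 2"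
    by (metis obtain_subset_with_card_n not_less_eq_eq numeral_2_eq_2 One_nat_def)
  then obtain c d where cd: "c \<in> U" "d \<in> U" "c \<noteq> d" "R a c" "R a d" "R b c" "R b d"
    by (auto simp: card_2_iff)
  have "dense R {a, c, b, d}" using quadrilateral_dense [of a c d b] cd assms by simp
  then have "5 \<le> nl {a, c, b, d}" using U_dense_nl assms cd by auto
  also have "\<dots> \<le> card {a, c, b, d}" by (rule nl_le_card) auto
  also have "\<dots> \<le> 4" by (simp add: card_insert_if)
  finally show False by simp
qed

lemma no_triangle_U: assumes "a \<in> U" "b \<in> U" "c \<in> U" "R a b" "R a c" "R b c" shows False
proof -
  have "5 \<le> nl {a, b, c}" using U_dense_nl [of "{a, b, c}"] triangle_dense [of a b c] assms by simp
  also have "\<dots> \<le> card {a, b, c}" by (rule nl_le_card) auto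
  finally show False using triangle_dense [of a b c] assms by simp
qed

text \<open>The triangle through a low edge cannot lie in \<open>U\<close>, so its third vertex is
  on the family. This is how low degrees give access to exchanges.\<close>

lemma low_edge_apex:
  assumes "a \<in> U" "b \<in> U" "R a b" "deg a + 2 \<le> 2 * k"
  obtains Q w where "Q \<in> QQ" "w \<in> Q" "R w a" "R w b"
proof -
  have "a \<in> V" "b \<in> V" using assms U_sub by auto
  then obtain w where w: "w \<in> V" "R w a" "R w b" using low_triangle [of a b] assms(3,4) by blast
  then have "w \<notin> U" using no_triangle_U [of a b w] assms sym by blast
  then have "w \<in> \<Union>QQ" using w(1) by (simp add: U_def)
  then show ?thesis using w that by blast
qed

text \<open>Inclusion and exclusion up to pairs: any two neighbourhoods in \<open>U\<close> share at
  most one vertex. Both sides are doubled to avoid a binomial coefficient.\<close>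

lemma codegree_sum:
  assumes "finite P" "P \<subseteq> U" "Y \<subseteq> U"
  shows "2 * (\<Sum>a\<in>P. dg R Y a) + card P \<le> 2 * card Y + card P * card P"
proof -
  have finY: "finite Y" using assms(3) finU by (rule finite_subset)
  have "2 * (\<Sum>a\<in>P. dg R Y a) + card P \<le> 2 * card (\<Union>a\<in>P. {u \<in> Y. R a u}) + card P * card P"
    using assms(1,2)
  proof (induction P rule: finite_induct)
    case (insert a P)
    let ?N = "\<lambda>a. {u \<in> Y. R a u}"
    have "card (?N a \<inter> (\<Union>b\<in>P. ?N b)) \<le> card (\<Union>b\<in>P. ?N a \<inter> ?N b)"
      using insert(1) finY by (intro card_mono) auto
    also have "\<dots> \<le> (\<Sum>b\<in>P. card (?N a \<inter> ?N b))" by (rule card_UN_le [OF insert(1)])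
    also have "\<dots> \<le> (\<Sum>b\<in>P. 1)"
    proof (rule sum_mono)
      fix b assume "b \<in> P"
      have "card (?N a \<inter> ?N b) \<le> card {u \<in> U. R a u \<and> R b u}"
        using assms(3) by (intro card_mono) auto
      also have "\<dots> \<le> 1" using few_common_nbrs [of a b] insert \<open>b \<in> P\<close> by auto
      finally show "card (?N a \<inter> ?N b) \<le> 1" .
    qed
    finally have c: "card (?N a \<inter> (\<Union>b\<in>P. ?N b)) \<le> card P" by simp
    have "card (?N a) + card (\<Union>b\<in>P. ?N b) = card (?N a \<union> (\<Union>b\<in>P. ?N b)) + card (?N a \<inter> (\<Union>b\<in>P. ?N b))"
      using insert(1) finY by (intro card_Un_Int) auto
    then show ?case using c insert by (simp add: dg_def)
  qed simp
  also have "card (\<Union>a\<in>P. {u \<in> Y. R a u}) \<le> card Y" using finY by (intro card_mono) auto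
  finally show ?thesis by simp
qed

end

section \<open>Edges between the extremal family and the rest\<close>

lemma sum_tight:
  fixes f :: "'b \<Rightarrow> nat"
  assumes "finite A" "\<And>x. x \<in> A \<Longrightarrow> f x \<le> c" "c * card A \<le> sum f A" "x \<in> A"
  shows "f x = c"
proof (rule ccontr)
  assume "f x \<noteq> c"
  then have "f x < c" using assms(2,4) by (simp add: le_neq_implies_less)
  then have "sum f A < (\<Sum>x\<in>A. c)" using assms by (intro sum_strict_mono_ex1) auto
  then show False using assms(3) by (simp add: mult.commute)
qed

context system
begin

section \<open>Weights of the remainder, and bounds for its edges to the family\<close>

definition u :: nat where "u = card N"
definition z :: nat where "z = card Z"
definition q3 :: nat where "q3 = card {Q \<in> QQ. card Q = 3}"
definition OmU :: int where "OmU = (\<Sum>v\<in>U. om k (deg v))"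
definition DU :: int where "DU = (\<Sum>v\<in>U. ff k (deg v))"

lemma deg_split: "deg v = dg R U v + (\<Sum>Q\<in>QQ. dg R Q v)"
proof -
  have "V = U \<union> \<Union>QQ" using QQ_facts(1) by (auto simp: U_def)
  moreover have "U \<inter> \<Union>QQ = {}" by (auto simp: U_def)
  moreover have "finite (\<Union>QQ)" using QQ_facts(4) by auto
  ultimately have "deg v = dg R U v + dg R (\<Union>QQ) v" using dg_Un finU by metis
  also have "dg R (\<Union>QQ) v = (\<Sum>Q\<in>QQ. dg R Q v)" by (intro dg_disjoint_Union disj finQQ QQ_facts(4))
  finally show ?thesis .
qed

lemma sum_split: "(\<Sum>v\<in>V. \<phi> v) = (\<Sum>v\<in>U. \<phi> v) + (\<Sum>Q\<in>QQ. \<Sum>v\<in>Q. \<phi> v)" for \<phi> :: "'a \<Rightarrow> int"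
proof -
  have "V = U \<union> \<Union>QQ" "finite (\<Union>QQ)" "U \<inter> \<Union>QQ = {}" using QQ_facts(1,4) by (auto simp: U_def)
  then have "(\<Sum>v\<in>V. \<phi> v) = (\<Sum>v\<in>U. \<phi> v) + sum \<phi> (\<Union>QQ)" using sum.union_disjoint finU by metis
  also have "sum \<phi> (\<Union>QQ) = (\<Sum>Q\<in>QQ. \<Sum>v\<in>Q. \<phi> v)"
    using QQ_disjoint QQ_facts(4) by (subst sum.Union_disjoint) auto
  finally show ?thesis .
qed

lemma N_deg: "v \<in> N \<Longrightarrow> 2 * k \<le> deg v + 2"
  using U_sub by (auto simp: N_def L_def)

lemma NV: "v \<in> N \<Longrightarrow> v \<in> V" and NU: "v \<in> N \<Longrightarrow> v \<in> U"
  using U_sub N_sub by auto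

text \<open>Vertices of \<open>Q\<close> in \<open>L\<close> contribute at most 0, and at most three
  or four others are left.\<close>

lemma Q_sum_le:
  fixes c :: int
  assumes Q: "Q \<in> QQ" and val: "0 \<le> c" "\<And>d. \<phi> d \<le> c" "\<And>v. v \<in> L \<Longrightarrow> \<phi> (deg v) \<le> 0"
  shows "(\<Sum>v\<in>Q. \<phi> (deg v)) \<le> c * (if card Q = 3 then 3 else 4)"
proof -
  have "(\<Sum>v\<in>Q. \<phi> (deg v)) = (\<Sum>v\<in>Q - L. \<phi> (deg v)) + (\<Sum>v\<in>Q \<inter> L. \<phi> (deg v))"
    using QQ_facts(4) [OF Q] sum.Int_Diff [of Q "\<lambda>v. \<phi> (deg v)" L] by simp
  also have "(\<Sum>v\<in>Q - L. \<phi> (deg v)) \<le> (\<Sum>v\<in>Q - L. c)" by (rule sum_mono) (rule val)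
  also have "(\<Sum>v\<in>Q \<inter> L. \<phi> (deg v)) \<le> 0" by (rule sum_nonpos) (simp add: val)
  finally have "(\<Sum>v\<in>Q. \<phi> (deg v)) \<le> c * int (nl Q)" by (simp add: nl_def mult.commute)
  also have "\<dots> \<le> c * (if card Q = 3 then 3 else 4)"
    using QQ_facts(3) [OF Q] nl_le_card [OF QQ_facts(4) [OF Q]] val(1)
    by (intro mult_left_mono) auto
  finally show ?thesis .
qed

lemma sum_QQ_q3: "(\<Sum>Q\<in>QQ. c * (if card Q = 3 then 3 else 4)) = c * (4 * int t - int q3)" for c :: int
proof -
  have "(\<Sum>Q\<in>QQ. (if card Q = 3 then 3 else 4 :: int)) = (\<Sum>Q\<in>QQ. 4 - (if card Q = 3 then 1 else 0))"
    by (rule sum.cong) auto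
  also have "\<dots> = 4 * int t - int q3"
    by (simp add: sum_subtractf t_def q3_def sum.If_cases Int_def)
  finally show ?thesis by (simp add: sum_distrib_left [symmetric])
qed

lemma OmU_ge: "25 * int k + 4 * int q3 \<le> 2 * OmU + 16 * int t"
proof -
  have "(\<Sum>Q\<in>QQ. \<Sum>v\<in>Q. om k (deg v)) \<le> (\<Sum>Q\<in>QQ. 2 * (if card Q = 3 then 3 else 4))"
    by (intro sum_mono Q_sum_le) (auto simp: om_def L_def)
  then show ?thesis using rich sum_split [of "\<lambda>v. om k (deg v)"] sum_QQ_q3 [of 2]
    by (simp add: rich_def OmU_def)
qed

lemma DU_ge: "2 * int k + int q3 \<le> DU + 4 * int t"
proof -
  have "(\<Sum>Q\<in>QQ. \<Sum>v\<in>Q. ff k (deg v)) \<le> (\<Sum>Q\<in>QQ. 1 * (if card Q = 3 then 3 else 4))"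
    by (intro sum_mono Q_sum_le) (auto simp: ff_def L_def)
  then show ?thesis using rich sum_split [of "\<lambda>v. ff k (deg v)"] sum_QQ_q3 [of 1]
    by (simp add: rich_def DU_def)
qed

lemma sum_U: "(\<Sum>v\<in>U. \<phi> v) = (\<Sum>v\<in>N. \<phi> v) + (\<Sum>v\<in>Z. \<phi> v)" for \<phi> :: "'a \<Rightarrow> int"
  using NZ by (simp add: sum.union_disjoint)

lemma Z_vals: "v \<in> Z \<Longrightarrow> om k (deg v) = - 1" "v \<in> Z \<Longrightarrow> ff k (deg v) = - 1"
  by (auto simp: Z_def L_def om_def ff_def)

lemma OmU_N: "OmU = (\<Sum>v\<in>N. om k (deg v)) - int z"
  by (simp add: OmU_def sum_U Z_vals z_def)

lemma DU_N: "DU = (\<Sum>v\<in>N. ff k (deg v)) - int z"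
  by (simp add: DU_def sum_U Z_vals z_def)

lemma om_ff: "v \<in> N \<Longrightarrow> om k (deg v) = ff k (deg v) + 1"
  using N_deg [of v] by (auto simp: om_def ff_def)

lemma OmU_eq: "OmU = int u + DU"
  by (simp add: OmU_N DU_N om_ff sum.distrib u_def)

lemma DU_le: "DU \<le> int u - int z"
  using sum_bounded_above [of N "\<lambda>v. ff k (deg v)" 1] by (simp add: DU_N u_def ff_def)

lemma OmU_le: "OmU \<le> 2 * int u"
  using OmU_eq DU_le by simp

text \<open>From \<open>25k - 16t \<le> 2 OmU \<le> 4u\<close> with
  \<open>t = k - 1 - s\<close>.\<close>

lemma u_ge: "9 * k + 16 * s + 16 \<le> 4 * u"
  using OmU_ge OmU_le k_eq by linarith

lemma z_le: "z + 2 * k + q3 \<le> u + 4 * t"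
  using DU_ge DU_le by linarith

lemma q3_le: "q3 \<le> t"
  unfolding q3_def t_def by (rule card_mono) auto

lemma cardU: "card U = u + z"
  using NZ by (simp add: u_def z_def card_Un_disjoint)

text \<open>Degrees on \<open>N\<close> are at least \<open>2k - 2\<close> plus \<open>om\<close>;
  \<open>degree_sum_bound\<close> limits what they spend inside \<open>U\<close>, and the rest must
  go to the family. The term \<open>z\<close> in that bound cancels against the weights -1 on
  \<open>Z\<close>.\<close>

lemma lower_bound: "2 * int t * int u + OmU - 2 * int u \<le> (\<Sum>Q\<in>QQ. int (eb R N Q))"
proof -
  have "5 \<le> card (X - Z)" if "X \<subseteq> U" "dense R X" for X
  proof -
    have "X - Z = X - L" using that(1) by (auto simp: Z_def)
    then show ?thesis using U_dense_nl [OF that] by (simp add: nl_def)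
  qed
  then have "eb R (U - Z) U \<le> 2 * Suc s * card (U - Z) + card Z"
    using no_packs_U Z_sub by (intro degree_sum_bound) auto
  then have "eb R N U \<le> 2 * Suc s * u + z" by (simp add: NZ(3) u_def z_def)
  then have "int (eb R N U) \<le> int (2 * Suc s * u + z)" by (rule of_nat_mono)
  then have b: "int (eb R N U) \<le> 2 * (int s + 1) * int u + int z" by (simp add: algebra_simps)
  have "(\<Sum>v\<in>N. 2 * int k - 2 + om k (deg v)) \<le> (\<Sum>v\<in>N. int (deg v))"
    by (rule sum_mono) (use N_deg in \<open>force simp: om_def\<close>)
  also have "(\<Sum>v\<in>N. int (deg v)) = int (eb R N U) + (\<Sum>Q\<in>QQ. int (eb R N Q))"
    by (simp add: deg_split eb_def sum.distrib) (rule sum.swap)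
  finally have "(2 * int k - 2) * int u + (OmU + int z) \<le> int (eb R N U) + (\<Sum>Q\<in>QQ. int (eb R N Q))"
    by (simp add: sum.distrib OmU_N u_def mult.commute)
  moreover have "2 * int k - 2 = 2 * int t + 2 * int s" using k_eq by linarith
  then have "(2 * int k - 2) * int u = 2 * int t * int u + 2 * int s * int u"
    by (simp add: distrib_right)
  ultimately show ?thesis using b by (simp add: algebra_simps)
qed

text \<open>Exchanging \<open>x\<close> for \<open>a\<close> in \<open>Q\<close> keeps the size of the family, so the remainder gains no edge.\<close>

lemma swap:
  assumes Q: "Q \<in> QQ" "card Q \<le> 4" "x \<in> Q" and a: "a \<in> U" "2 \<le> dg R (Q - {x}) a"
  shows "dg R U x \<le> dg R U a + (if R a x then 1 else 0)"
proof -
  let ?X = "insert a (Q - {x})"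
  have fin: "finite Q" using QQ_facts Q by blast
  have aQ: "a \<notin> Q" using QQ_facts(5) [OF Q(1)] a by blast
  have de: "dense R ?X" using mind_remove_conn [OF mind_Q [OF Q(1)] Q(3)] aQ a by (intro conn_dense_insert) auto
  have c: "card ?X = card Q" using aQ Q(3) fin by (simp add: card_Suc_Diff1 del: card_Diff_insert)
  then have "nl ?X \<le> 4" using nl_le_card [of ?X] fin Q(2) by simp
  then have "eb R ((U \<union> Q) - ?X) ((U \<union> Q) - ?X) \<le> eb R U U"
    using exchange(2) [OF Q(1) _ de] c a by auto
  moreover have "(U \<union> Q) - ?X = insert x (U - {a})" using QQ_facts(5) [OF Q(1)] Q(3) a aQ by blast
  moreover have "x \<notin> U - {a}" using QQ_facts(5) [OF Q(1)] Q(3) by blast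
  ultimately have "dg R (U - {a}) x \<le> dg R U a"
    using ds_insert [of "U - {a}" x] ds_remove [of U a] a by simp
  moreover have "dg R U x = dg R (U - {a}) x + (if R a x then 1 else 0)"
    using dg_insert [of "U - {a}" a R x] a by (simp add: insert_absorb sym_iff)
  ultimately show ?thesis by simp
qed

text \<open>Exchange \<open>Q\<close> for the triangle on \<open>v\<close>, \<open>p\<close>,
  \<open>x\<close>. Minimal total size makes \<open>Q\<close> a triangle as well; maximality of the
  edges in the remainder then bounds the edges of the two released vertices by those lost at
  \<open>v\<close> and \<open>p\<close>.\<close>

lemma triangle_exchange:
  assumes Q: "Q \<in> QQ" "x \<in> Q" and v: "v \<in> U" "p \<in> N" "R v p" "R v x" "R p x"
  shows "card Q = 3" and "eb R N Q \<le> dg R N x + dg R U v + dg R U p + (if v \<in> N then 2 else 0)"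
proof -
  let ?X = "{v, p, x}"
  have fin: "finite Q" and UQ: "U \<inter> Q = {}" using QQ_facts Q by blast+
  have p: "p \<in> U" "p \<noteq> v" using v N_sub irr by auto
  have X: "dense R ?X" "card ?X = 3" using triangle_dense [of v p x] v by auto
  then have nl: "nl ?X \<le> 4" using nl_le_card [of ?X] by simp
  have sub: "?X \<subseteq> U \<union> Q" using v p Q by auto
  show c3: "card Q = 3" using exchange(1) [OF Q(1) sub X(1) nl] X(2) card_Q [OF Q(1)] by simp
  let ?W = "U - {v} - {p}"
  let ?P = "Q - {x}"
  have "eb R ((U \<union> Q) - ?X) ((U \<union> Q) - ?X) \<le> eb R U U"
    using exchange(2) [OF Q(1) sub X(1) nl] X(2) c3 by simp
  moreover have "(U \<union> Q) - ?X = ?W \<union> ?P" using UQ v p Q by blast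
  moreover have "eb R (?W \<union> ?P) (?W \<union> ?P) = eb R ?W ?W + eb R ?P ?P + 2 * eb R ?W ?P"
    using fin UQ by (intro ds_Un) auto
  moreover have "eb R ?P ?P = 2"
  proof -
    have "eb R Q Q = 6" unfolding eb_def using mind_dg [OF mind_Q [OF Q(1)]] c3 by simp
    then show ?thesis using ds_remove [OF fin Q(2)] mind_dg [OF mind_Q [OF Q(1)] Q(2)] by simp
  qed
  moreover have "eb R U U = eb R ?W ?W + 2 * dg R (U - {v}) p + 2 * dg R U v"
    using ds_remove [of U v] ds_remove [of "U - {v}" p] v p by simp
  moreover have "dg R U p = dg R (U - {v}) p + 1"
    using dg_insert [of "U - {v}" v R p] v sym by (simp add: insert_absorb)
  \<comment> \<open>One unit comes from the edge between the released vertices, the other from the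
    edge \<open>vp\<close>, which both degrees count but which is lost once.\<close>
  ultimately have main: "eb R ?W ?P + 2 \<le> dg R U v + dg R U p" by simp
  have le2: "dg R ?P w \<le> 2" for w
    using dg_le_card [of ?P R w] fin c3 Q(2) by simp
  have "eb R N ?P \<le> eb R ?W ?P + 2 + (if v \<in> N then 2 else 0)"
  proof (cases "v \<in> N")
    case True
    have "eb R N ?P \<le> eb R (insert p (insert v ?W)) ?P"
      using fin by (intro eb_mono) (use N_sub in auto)
    also have "\<dots> = dg R ?P p + (dg R ?P v + eb R ?W ?P)"
      using p(2) by (subst eb_insert_left, simp, simp)+ simp
    finally show ?thesis using le2 [of p] le2 [of v] True by simp
  next
    case False
    have "eb R N ?P \<le> eb R (insert p ?W) ?P"
      using fin by (intro eb_mono) (use N_sub False in auto)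
    also have "\<dots> = dg R ?P p + eb R ?W ?P" by (rule eb_insert_left) auto
    finally show ?thesis using le2 [of p] False by simp
  qed
  moreover have "eb R N Q = eb R N ?P + dg R N x"
    using eb_Diff_right [of Q "{x}" R N] fin Q(2) by (simp add: eb_singleton_right)
  ultimately show "eb R N Q \<le> dg R N x + dg R U v + dg R U p + (if v \<in> N then 2 else 0)"
    using main by simp
qed

text \<open>Too many edges yield many vertices \<open>a\<close> joined to both \<open>x\<close> and
  \<open>y\<close>. Each of them can replace \<open>w\<close>, so it has almost as many neighbours
  in \<open>U\<close> as \<open>w\<close>; but any two of them share at most one, and there is no
  room for such large, almost disjoint neighbourhoods.\<close>

lemma upper_bound_3:
  assumes Q: "Q \<in> QQ" "card Q = 3" shows "eb R N Q \<le> 2 * u + 2"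
proof (rule ccontr)
  assume neg: "\<not> ?thesis"
  have fin: "finite Q" and UQ: "U \<inter> Q = {}" using QQ_facts Q by blast+
  obtain w where w: "w \<in> Q" "\<And>x. x \<in> Q \<Longrightarrow> dg R N x \<le> dg R N w"
  proof -
    have "finite (dg R N ` Q)" "dg R N ` Q \<noteq> {}" using fin Q(2) by auto
    then have "Max (dg R N ` Q) \<in> dg R N ` Q" by (rule Max_in)
    then obtain w where "w \<in> Q" "dg R N w = Max (dg R N ` Q)" by auto
    then show ?thesis using that [of w] fin by simp
  qed
  have "card (Q - {w}) = 2" using Q w fin by simp
  then obtain x y where xy: "Q - {w} = {x, y}" "x \<noteq> y" by (auto simp: card_2_iff)
  then have Qe: "Q = {x, y, w}" "x \<noteq> w" "y \<noteq> w" using w(1) by auto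
  have e: "eb R N Q = dg R N x + dg R N y + dg R N w"
  proof -
    have "eb R N Q = eb R Q N" using fin by (intro dg_swap) auto
    then show ?thesis using Qe xy(2) by (simp add: eb_def)
  qed
  define d where "d = dg R N w"
  have d3: "2 * u + 3 \<le> 3 * d" using neg e w(2) [of x] w(2) [of y] Qe by (simp add: d_def)
  define P where "P = {a \<in> N. R x a \<and> R y a}"
  have finP: "finite P" by (simp add: P_def)
  have Pge: "u + 3 \<le> card P + d"
  proof -
    have "dg R N x + dg R N y = card ({a \<in> N. R x a} \<union> {a \<in> N. R y a}) + card ({a \<in> N. R x a} \<inter> {a \<in> N. R y a})"
      unfolding dg_def by (rule card_Un_Int) auto
    moreover have "card ({a \<in> N. R x a} \<union> {a \<in> N. R y a}) \<le> u"
      unfolding u_def by (rule card_mono) auto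
    moreover have "{a \<in> N. R x a} \<inter> {a \<in> N. R y a} = P" by (auto simp: P_def)
    ultimately show ?thesis using neg e by (simp add: d_def)
  qed
  have big: "d \<le> dg R U a + 1" if "a \<in> P" for a
  proof -
    have "2 \<le> dg R (Q - {w}) a"
      using that xy sym by (subst dg_ge_2_iff) (auto simp: P_def)
    then have "dg R U w \<le> dg R U a + 1"
      using swap [OF Q(1) _ w(1), of a] Q(2) that N_sub by (auto simp: P_def split: if_splits)
    then show ?thesis unfolding d_def using dg_mono [OF finU N_sub, of R w] by simp
  qed
  have d_le: "d \<le> u" unfolding d_def u_def by (rule dg_le_card) simp
  \<comment> \<open>Without neighbours in \<open>L\<close>, both vertices have their large degree
    inside \<open>N\<close>, and already two such neighbourhoods exceed \<open>u\<close>.\<close>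
  have no_pair: "\<exists>v\<in>L. v \<in> U \<and> R a v \<or> R b v \<and> v \<in> U" if ab: "a \<in> P" "b \<in> P" "a \<noteq> b" for a b
  proof (rule ccontr)
    assume no: "\<not> ?thesis"
    have "dg R U c = dg R N c" if "c \<in> {a, b}" for c
      unfolding dg_def by (rule arg_cong [where f = card]) (use no that in \<open>auto simp: N_def\<close>)
    then have "d \<le> dg R N a + 1" "d \<le> dg R N b + 1" using big [OF ab(1)] big [OF ab(2)] by auto
    moreover have "2 * (\<Sum>c\<in>{a, b}. dg R N c) + card {a, b} \<le> 2 * card N + card {a, b} * card {a, b}"
      using ab N_sub by (intro codegree_sum) (auto simp: P_def)
    ultimately have "2 * d \<le> u + 3" using ab(3) by (simp add: u_def)
    then show False using d3 u_ge k2 by linarith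
  qed
  have "3 \<le> card P" using Pge d_le by simp
  then obtain T where T: "T \<subseteq> P" "card T = 3" by (metis obtain_subset_with_card_n)
  then obtain a b c where abc: "T = {a, b, c}" "a \<noteq> b" "a \<noteq> c" "b \<noteq> c" by (auto simp: card_3_iff)
  obtain a v where av: "a \<in> P" "v \<in> L" "v \<in> U" "R a v"
    using no_pair [of a b] T abc by blast
  have aN: "a \<in> N" using av by (simp add: P_def)
  \<comment> \<open>A neighbour in \<open>L\<close> caps the degree of \<open>a\<close>, and thereby
    \<open>d\<close>, at about \<open>2k\<close>; as \<open>card P \<ge> u + 3 - d\<close>, the set
    \<open>P\<close> must have at least six vertices.\<close>
  have "deg a \<le> 2 * k" using L_nbr [OF av(2), of a] av(4) NV [OF aN] sym by blast
  moreover have "dg R U a + 2 \<le> deg a"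
  proof -
    have "2 \<le> dg R Q a" using av(1) Qe xy(2) sym by (subst dg_ge_2_iff) (auto simp: P_def)
    moreover have "dg R Q a \<le> (\<Sum>Q\<in>QQ. dg R Q a)" by (rule member_le_sum) (use Q in auto)
    ultimately show ?thesis using deg_split [of a] by simp
  qed
  ultimately have "d + 1 \<le> 2 * k" using big [OF av(1)] by simp
  then have "6 \<le> card P" using Pge u_ge k2 by linarith
  then obtain S where S: "S \<subseteq> P" "card S = 6" by (metis obtain_subset_with_card_n)
  \<comment> \<open>Counting in \<open>U\<close> instead of \<open>N\<close> takes the neighbours in
    \<open>Z\<close> into account. Six neighbourhoods outweigh the at most
    \<open>u + 4t - 2k\<close> extra vertices that \<open>Z\<close> contributes.\<close>
  have "2 * (\<Sum>c\<in>S. dg R U c) + card S \<le> 2 * card U + card S * card S"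
    using S N_sub finite_subset [OF S(1) finP] by (intro codegree_sum) (auto simp: P_def)
  moreover have "card S * (d - 1) \<le> (\<Sum>c\<in>S. dg R U c)"
    using sum_bounded_below [of S "d - 1" "dg R U"] big S(1) by force
  ultimately have "12 * d \<le> 2 * card U + 42" using S(2) by simp
  then show False using d3 z_le cardU u_ge k_eq k2 by linarith
qed

lemma upper_bound: assumes Q: "Q \<in> QQ" shows "eb R N Q \<le> 2 * u + (if card Q = 3 then 2 else 0)"
proof -
  consider "card Q = 3" | "card Q = 4" | "5 \<le> card Q" using card_Q [OF Q] by linarith
  then show ?thesis
  proof cases
    case 1 then show ?thesis using upper_bound_3 [OF Q] by simp
  next
    case 2 then show ?thesis using eb_le_card [of N Q 2] Q4_dg [OF Q] N_sub by (auto simp: u_def)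
  next
    case 3
    then have "eb R N Q \<le> 1 * u" unfolding u_def by (intro eb_le_card Q5_dg [OF Q]) (use N_sub in auto)
    then show ?thesis by simp
  qed
qed

lemma sum_others:
  assumes Q: "Q \<in> QQ"
  shows "(\<Sum>P\<in>QQ. int (eb R N P)) \<le> int (eb R N Q) + 2 * (int t - 1) * int u + 2 * int q3 - (if card Q = 3 then 2 else 0)"
proof -
  let ?f = "\<lambda>P. 2 * int u + (if card P = 3 then 2 else 0)"
  have "(\<Sum>P\<in>QQ - {Q}. int (eb R N P)) \<le> (\<Sum>P\<in>QQ - {Q}. ?f P)"
  proof (rule sum_mono)
    fix P assume "P \<in> QQ - {Q}"
    then show "int (eb R N P) \<le> ?f P" using upper_bound [of P] by (auto split: if_splits)
  qed
  moreover have "(\<Sum>P\<in>QQ. ?f P) = ?f Q + (\<Sum>P\<in>QQ - {Q}. ?f P)" by (rule sum.remove [OF finQQ Q])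
  moreover have "(\<Sum>P\<in>QQ. int (eb R N P)) = int (eb R N Q) + (\<Sum>P\<in>QQ - {Q}. int (eb R N P))"
    by (rule sum.remove [OF finQQ Q])
  moreover have "(\<Sum>P\<in>QQ. ?f P) = 2 * int t * int u + 2 * int q3"
    by (simp add: sum.distrib t_def q3_def sum.If_cases Int_def)
  ultimately show ?thesis by (simp add: algebra_simps)
qed

text \<open>Even if all other cycles attain their upper bound, \<open>lower_bound\<close> leaves
  this much for \<open>Q\<close>. In \<open>eb_ge\<close> the terms with \<open>q3\<close> cancel
  against those of \<open>OmU_ge\<close>.\<close>

lemma eb_ge_Om: "Q \<in> QQ \<Longrightarrow> OmU - 2 * int q3 + (if card Q = 3 then 2 else 0) \<le> int (eb R N Q)"
  using sum_others [of Q] lower_bound by (simp add: algebra_simps)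

lemma eb_ge: "Q \<in> QQ \<Longrightarrow> 9 * k + 16 * s + 16 \<le> 2 * eb R N Q"
  using eb_ge_Om [of Q] OmU_ge k_eq by (auto split: if_splits)

lemma u_le: "Q \<in> QQ \<Longrightarrow> card Q = 3 \<Longrightarrow> u + 2 * k + 2 \<le> eb R N Q + 5 * t"
  using eb_ge_Om [of Q] OmU_eq DU_ge q3_le by simp

text \<open>An edge at \<open>v\<close> lies in a triangle whose apex is on the family, has degree
  at most \<open>2k\<close>, and belongs to a triangle \<open>Q\<close>. By \<open>eb_ge\<close>,
  \<open>v\<close> and all its neighbours in \<open>U\<close> then have many neighbours in
  \<open>U\<close>. Without quadrilaterals in \<open>U\<close> this reaches quadratically many
  vertices, whereas \<open>u_le\<close> and \<open>z_le\<close> allow linearly many.\<close>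

lemma Z_isolated: assumes "v \<in> Z" "p \<in> U" shows "\<not> R v p"
proof
  assume vp: "R v p"
  have v: "v \<in> L" "v \<in> U" "v \<in> V" "v \<notin> N" "deg v + 3 \<le> 2 * k"
    using assms(1) U_sub by (auto simp: Z_def N_def L_def)
  have nbr: "5 * k + 20 \<le> 2 * (dg R U v + dg R U q)" "dg R U v + 4 \<le> 2 * k" "dg R U q + 1 \<le> 2 * k"
    "\<exists>Q. Q \<in> QQ \<and> card Q = 3 \<and> eb R N Q + 7 \<le> 6 * k" if q: "q \<in> U" "R v q" for q
  proof -
    have qN: "q \<in> N" "deg q \<le> 2 * k" using L_nbr [OF v(1), of q] q U_sub by (auto simp: N_def)
    have "deg v + 2 \<le> 2 * k" using v by simp
    then obtain Q x where Q: "Q \<in> QQ" "x \<in> Q" and x: "R x v" "R x q"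
      by (rule low_edge_apex [OF v(2) q])
    have xV: "x \<in> V" using Q QQ_facts(1) by blast
    have c3: "card Q = 3" and e: "eb R N Q \<le> dg R N x + dg R U v + dg R U q"
      using triangle_exchange [OF Q v(2) qN(1) q(2)] x v(4) sym by auto
    have ge: "dg R U w + dg R Q w \<le> deg w" for w
    proof -
      have "dg R Q w \<le> (\<Sum>Q\<in>QQ. dg R Q w)" by (rule member_le_sum) (use Q in auto)
      then show ?thesis using deg_split [of w] by simp
    qed
    have pos: "1 \<le> dg R Q w" if "R x w" for w
      using dg_pos_iff [of Q R w] Q QQ_facts(4) that sym by (auto simp: Suc_le_eq)
    have "deg x \<le> 2 * k" using L_nbr [OF v(1) xV] x sym by blast
    then have "dg R N x + 2 \<le> 2 * k"
      using ge [of x] mind_dg [OF mind_Q [OF Q(1)] Q(2)] dg_mono [OF finU N_sub, of R x] by simp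
    moreover show dv: "dg R U v + 4 \<le> 2 * k" using ge [of v] pos [of v] x v by simp
    moreover show dq: "dg R U q + 1 \<le> 2 * k" using ge [of q] pos [of q] x qN by simp
    ultimately have "eb R N Q + 7 \<le> 6 * k" using e by simp
    then show "\<exists>Q. Q \<in> QQ \<and> card Q = 3 \<and> eb R N Q + 7 \<le> 6 * k" using Q c3 by blast
    show "5 * k + 20 \<le> 2 * (dg R U v + dg R U q)"
      using eb_ge [OF Q(1)] e \<open>dg R N x + 2 \<le> 2 * k\<close> by simp
  qed
  note p = nbr [OF assms(2) vp]
  define B where "B = {q \<in> U. R v q}"
  have finB: "finite B" by (simp add: B_def)
  have cB: "k + 22 \<le> 2 * card B" using p(1,3) by (simp add: B_def dg_def)
  have row: "k + 26 \<le> 2 * card {w \<in> U - {v}. R q w}" if "q \<in> B" for q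
  proof -
    have "k + 28 \<le> 2 * dg R U q" using nbr [of q] that by (simp add: B_def)
    moreover have "dg R U q = dg R (U - {v}) q + 1"
      using dg_insert [of "U - {v}" v R q] v that sym by (simp add: insert_absorb B_def)
    ultimately show ?thesis by (simp add: dg_def)
  qed
  have "card (\<Union>q\<in>B. {w \<in> U - {v}. R q w}) = (\<Sum>q\<in>B. card {w \<in> U - {v}. R q w})"
  proof (rule card_UN_disjoint [OF finB])
    show "\<forall>q\<in>B. finite {w \<in> U - {v}. R q w}" by simp
    show "\<forall>q\<in>B. \<forall>r\<in>B. q \<noteq> r \<longrightarrow> {w \<in> U - {v}. R q w} \<inter> {w \<in> U - {v}. R r w} = {}"
    proof (intro ballI impI, rule ccontr)
      fix q r assume qr: "q \<in> B" "r \<in> B" "q \<noteq> r"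
        "{w \<in> U - {v}. R q w} \<inter> {w \<in> U - {v}. R r w} \<noteq> {}"
      then obtain w where w: "w \<in> U" "w \<noteq> v" "R q w" "R r w" by blast
      have "card {v, w} \<le> card {x \<in> U. R q x \<and> R r x}"
        using qr w v sym by (intro card_mono) (auto simp: B_def)
      then show False using few_common_nbrs [of q r] qr w(2) by (auto simp: B_def)
    qed
  qed
  moreover have "card (\<Union>q\<in>B. {w \<in> U - {v}. R q w}) \<le> card U" by (rule card_mono) auto
  ultimately have "2 * (\<Sum>q\<in>B. card {w \<in> U - {v}. R q w}) \<le> 2 * card U" by simp
  moreover have "(\<Sum>q\<in>B. k + 26) \<le> (\<Sum>q\<in>B. 2 * card {w \<in> U - {v}. R q w})"
    by (rule sum_mono) (rule row)
  ultimately have "card B * (k + 26) \<le> 2 * card U" by (simp add: sum_distrib_left)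
  moreover have "(k + 22) * (k + 26) \<le> 2 * card B * (k + 26)" using cB by (rule mult_right_mono) simp
  ultimately have "(k + 22) * (k + 26) \<le> 4 * card U" by linarith
  moreover obtain Q where "Q \<in> QQ" "card Q = 3" "eb R N Q + 7 \<le> 6 * k" using p(4) by blast
  then have "card U + 32 \<le> 20 * k" using u_le [of Q] z_le cardU k_eq by linarith
  ultimately have "(k + 22) * (k + 26) + 128 \<le> 80 * k" by linarith
  then have "int ((k + 22) * (k + 26) + 128) \<le> int (80 * k)" by (rule of_nat_mono)
  \<comment> \<open>The inequality before reads \<open>k^2 - 32k + 700 \<le> 0\<close>; completing
    the square at 16 refutes it.\<close>
  moreover have "0 \<le> (int k - 16) * (int k - 16)" by simp
  ultimately show False by (simp add: algebra_simps)
qed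

section \<open>Vertices of small degree in the remainder, and the number of missing cycles\<close>

lemma dg_UN: "a \<in> U \<Longrightarrow> dg R U a = dg R N a"
proof -
  assume "a \<in> U"
  then have "dg R Z a = 0" using Z_isolated sym by (auto simp: dg_def)
  then show ?thesis using dg_Un [of N Z R a] NZ by simp
qed

text \<open>If \<open>a\<close> sees a whole triangle, it can replace each of its vertices, so none
  of them has more than \<open>dg R U a + 1\<close> neighbours in \<open>N\<close>. Up to the
  threshold \<open>3k + 2\<close>, three times this number stays below \<open>eb_ge\<close>.\<close>

lemma dg_Q_le_2:
  assumes Q: "Q \<in> QQ" and a: "a \<in> N" "2 * dg R U a \<le> 3 * k + 2" shows "dg R Q a \<le> 2"
proof (rule ccontr)
  assume neg: "\<not> ?thesis"
  have aU: "a \<in> U" and fin: "finite Q" using a N_sub QQ_facts Q by auto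
  have c3: "card Q = 3"
  proof (rule ccontr)
    assume "card Q \<noteq> 3"
    then have "card Q = 4 \<or> 5 \<le> card Q" using card_Q [OF Q] by linarith
    then show False using Q4_dg [OF Q _ aU] Q5_dg [OF Q _ aU] neg by auto
  qed
  have "dg R Q a = card Q" using neg c3 dg_le_card [OF fin, of R a] by simp
  then have "{q \<in> Q. R a q} = Q" using fin by (intro card_subset_eq) (auto simp: dg_def)
  then have adj: "R a q" if "q \<in> Q" for q using that by blast
  have "dg R N x \<le> dg R U a + 1" if x: "x \<in> Q" for x
  proof -
    have "dg R (Q - {x}) a = card (Q - {x})" unfolding dg_def by (rule arg_cong [where f = card]) (use adj in auto)
    then have "2 \<le> dg R (Q - {x}) a" using x c3 fin by simp
    then show ?thesis using swap [OF Q _ x aU] c3 adj [OF x] dg_mono [OF finU N_sub, of R x] by simp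
  qed
  then have "eb R Q N \<le> (dg R U a + 1) * card Q" by (rule eb_le_card)
  then show False using eb_ge [OF Q] dg_swap [of N Q] fin c3 a(2) by simp
qed

definition q5 :: nat where "q5 = card {Q \<in> QQ. 5 \<le> card Q}"

lemma QQ_dg_bound:
  assumes a: "a \<in> N" "2 * dg R U a \<le> 3 * k + 2" shows "(\<Sum>Q\<in>QQ. dg R Q a) + q5 \<le> 2 * t"
proof -
  have "(\<Sum>Q\<in>QQ. dg R Q a + (if 5 \<le> card Q then 1 else 0)) \<le> (\<Sum>Q\<in>QQ. 2)"
    by (rule sum_mono) (use dg_Q_le_2 [OF _ a] Q5_dg N_sub a in force)
  then show ?thesis by (simp add: sum.distrib t_def q5_def sum.If_cases Int_def)
qed

lemma N_no_packs: "\<not> packs R N (Suc s)"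
  using no_packs_U packs_mono N_sub by blast

lemma N_dense: "X \<subseteq> N \<Longrightarrow> dense R X \<Longrightarrow> 5 \<le> card X"
  using U_dense_nl [of X] nl_le_card [of X] N_sub dense_finite [of R X] by force

text \<open>\<open>min_degree_packs\<close> provides a vertex with at most \<open>s + 1\<close>
  neighbours in \<open>N\<close>. Its degree is at least \<open>2k - 2 = 2t + 2s\<close> and at most
  \<open>s + 1 + 2t - q5\<close>.\<close>

lemma s_q5: "s + q5 \<le> 1"
proof -
  have "N \<noteq> {}" using u_ge by (auto simp: u_def)
  then obtain a where a: "a \<in> N" "dg R N a \<le> s + 1"
    using min_degree_packs [of N s] N_no_packs N_dense by force
  then have d: "dg R U a \<le> s + 1" using dg_UN N_sub by auto
  then have "(\<Sum>Q\<in>QQ. dg R Q a) + q5 \<le> 2 * t" using k_eq by (intro QQ_dg_bound a) linarith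
  then show ?thesis using deg_split [of a] d N_deg [OF a(1)] k_eq by linarith
qed

section \<open>Long cycles are excluded\<close>

text \<open>The average degree in \<open>F\<close> is below 2, so the excess of \<open>b\<close>
  over 2 must be paid for by leaves.\<close>

lemma leaf_count:
  assumes "finite F" "\<not> dense R F" "b \<in> F" "\<And>a. a \<in> F \<Longrightarrow> 1 \<le> dg R F a" "2 \<le> dg R F b"
  shows "dg R F b \<le> card {a \<in> F. dg R F a \<le> 1} + 1"
proof -
  let ?A = "{a \<in> F. dg R F a \<le> 1}"
  have "eb R F F < 2 * card F" using assms by (auto simp: dense_def)
  moreover have "eb R F F = dg R F b + (\<Sum>a\<in>F - {b}. dg R F a)"
    unfolding eb_def by (rule sum.remove) (use assms in auto)
  moreover have "(\<Sum>a\<in>F - {b}. 2) \<le> (\<Sum>a\<in>F - {b}. dg R F a + (if dg R F a \<le> 1 then 1 else 0))"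
  proof (rule sum_mono)
    fix a assume "a \<in> F - {b}"
    then have "1 \<le> dg R F a" using assms(4) by simp
    then show "2 \<le> dg R F a + (if dg R F a \<le> 1 then 1 else 0)" by simp
  qed
  moreover have "(\<Sum>a\<in>F - {b}. if dg R F a \<le> 1 then 1 else 0) = card ?A"
  proof -
    have "(F - {b}) \<inter> {a. dg R F a \<le> 1} = ?A" using assms(5) by auto
    then show ?thesis using assms(1) by (simp add: sum.If_cases)
  qed
  moreover have "card F = Suc (card (F - {b}))" using assms(1,3) by (rule card.remove)
  ultimately show ?thesis by (simp add: sum.distrib)
qed

text \<open>Serves two exclusions: \<open>C\<close> is a cycle inside \<open>N\<close> if
  \<open>s = 1\<close>, and a long member of the family afterwards. A leaf of \<open>F\<close> has
  degree exactly \<open>2k - 2\<close>, so its edge has an apex \<open>w\<close> on a triangle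
  \<open>Q\<close>. The exchange bound makes the other end \<open>b\<close> so large that
  \<open>F\<close> has more leaves than \<open>Q\<close> can serve with two edges each.\<close>

lemma forest_with_cycle:
  assumes F: "F \<subseteq> N" "F \<noteq> {}" "\<And>X. X \<subseteq> F \<Longrightarrow> \<not> dense R X"
    and QF: "QF \<subseteq> QQ" "card QF + 2 = k" "\<And>Q. Q \<in> QQ \<Longrightarrow> card Q = 3 \<Longrightarrow> Q \<in> QF"
    and C: "finite C" "C \<subseteq> V" "C \<inter> F = {}" "\<And>a. a \<in> F \<Longrightarrow> dg R C a \<le> 1"
    and deg: "\<And>a. a \<in> F \<Longrightarrow> deg a = dg R F a + dg R C a + (\<Sum>Q\<in>QF. dg R Q a)"
    and dU: "\<And>a. a \<in> F \<Longrightarrow> dg R U a \<le> dg R F a + 1"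
    and tri: "\<And>a b c. \<lbrakk>a \<in> F; b \<in> F; c \<in> C; R a b; R a c\<rbrakk> \<Longrightarrow> \<not> R c b"
  shows False
proof -
  have finF: "finite F" using F(1) finN finite_subset by blast
  have finQF: "finite QF" using QF(1) finQQ finite_subset by blast
  have leaf: "deg a + 2 = 2 * k \<and> dg R F a = 1 \<and> dg R C a = 1 \<and> (\<forall>Q\<in>QF. dg R Q a = 2)"
    if a: "a \<in> F" "dg R F a \<le> 1" for a
  proof -
    have aN: "a \<in> N" using a F(1) by blast
    have "2 * dg R U a \<le> 3 * k + 2" using dU [OF a(1)] a(2) k2 by linarith
    then have le2: "dg R Q a \<le> 2" if "Q \<in> QF" for Q using dg_Q_le_2 [OF _ aN] that QF(1) by blast
    have "(\<Sum>Q\<in>QF. dg R Q a) \<le> 2 * card QF" using sum_bounded_above [of QF "\<lambda>Q. dg R Q a" 2] le2 by simp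
    moreover have "2 * k \<le> deg a + 2" using N_deg [OF aN] .
    ultimately have eq: "(\<Sum>Q\<in>QF. dg R Q a) = 2 * card QF" and
      rest: "deg a + 2 = 2 * k" "dg R F a = 1" "dg R C a = 1"
      using deg [OF a(1)] a(2) C(4) [OF a(1)] QF(2) by linarith+
    have "dg R Q a = 2" if "Q \<in> QF" for Q
      using sum_tight [of QF "\<lambda>Q. dg R Q a" 2 Q] finQF le2 that eq by simp
    then show ?thesis using rest by simp
  qed
  obtain a where a: "a \<in> F" "dg R F a \<le> 1"
    using dense_nbr_cover [OF finF F(2)] F(3) [of F] by force
  obtain b where b: "b \<in> F" "R a b" using leaf [OF a] dg_pos_iff [OF finF, of R a] by force
  obtain c where c: "c \<in> C" "R a c" using leaf [OF a] dg_pos_iff [OF C(1), of R a] by force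
  have N: "a \<in> N" "b \<in> N" "a \<in> V" "b \<in> V" "a \<in> U" "b \<in> U" using a b F(1) NV NU by blast+
  \<comment> \<open>The second neighbour \<open>c\<close>, not adjacent to \<open>b\<close>, is what
    yields an apex of degree at most \<open>2k\<close>; \<open>low_triangle\<close> alone gives no
    such bound.\<close>
  have "\<not> R c b" using tri [OF a(1) b(1) c(1) b(2) c(2)] .
  moreover have "c \<noteq> b" using c(1) b(1) C(3) by blast
  ultimately obtain w where w: "w \<in> V" "R w a" "R w b" "deg w \<le> 2 * k"
    using small_nbr [of a b c] N c b C(2) leaf [OF a] by auto
  have "w \<notin> U" using no_triangle_U [of a b w] N b w sym by blast
  then obtain Q where Q: "Q \<in> QQ" "w \<in> Q" using w(1) by (auto simp: U_def)
  have c3: "card Q = 3" and e: "eb R N Q \<le> dg R N w + dg R U a + dg R U b + 2"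
    using triangle_exchange [OF Q N(5) N(2) b(2)] w sym N(1) by auto
  have QQF: "Q \<in> QF" and fin: "finite Q" using QF(3) [OF Q(1) c3] QQ_facts(4) [OF Q(1)] by auto
  have "dg R Q w \<le> (\<Sum>Q\<in>QQ. dg R Q w)" by (rule member_le_sum) (use Q in auto)
  then have dw: "dg R N w + 2 \<le> 2 * k"
    using deg_split [of w] w(4) mind_dg [OF mind_Q [OF Q(1)] Q(2)] dg_mono [OF finU N_sub, of R w] by simp
  have db: "5 * k + 10 \<le> 2 * dg R F b"
    using e dw eb_ge [OF Q(1)] dU [OF a(1)] dU [OF b(1)] leaf [OF a] by linarith
  have lc: "dg R F b \<le> card {a \<in> F. dg R F a \<le> 1} + 1"
    using leaf db k2 by (intro leaf_count finF F(3) b) fastforce+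
  obtain x where x: "x \<in> Q" "\<not> R a x"
  proof -
    have "{q \<in> Q. R a q} \<noteq> Q" using leaf [OF a] QQF c3 by (auto simp: dg_def)
    then show ?thesis using that by blast
  qed
  have "w \<noteq> x" using x w sym by blast
  have "2 \<le> dg R (Q - {x}) a"
  proof -
    have "dg R (Q - {x}) a = dg R Q a" unfolding dg_def by (rule arg_cong [where f = card]) (use x in auto)
    then show ?thesis using leaf [OF a] QQF by simp
  qed
  then have "dg R U x \<le> dg R U a" using swap [OF Q(1) _ x(1) N(5)] c3 x(2) by simp
  then have dx: "dg R F x \<le> 2"
    using dU [OF a(1)] a(2) dg_mono [of U F R x] F(1) N_sub by (simp add: subset_trans)
  \<comment> \<open>Two neighbours on a triangle must include \<open>w\<close> or \<open>x\<close>,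
    which have at most \<open>2k - 2\<close> and 2 of the leaves as neighbours; \<open>db\<close>
    and \<open>lc\<close> demand more.\<close>
  have "{a \<in> F. dg R F a \<le> 1} \<subseteq> {v \<in> N. R w v} \<union> {v \<in> F. R x v}"
  proof
    fix v assume "v \<in> {a \<in> F. dg R F a \<le> 1}"
    then have v: "v \<in> F" "dg R F v \<le> 1" by auto
    have "R v w \<or> R v x"
    proof (rule ccontr)
      assume "\<not> ?thesis"
      then have "{q \<in> Q. R v q} \<subseteq> Q - {w, x}" by blast
      then have "dg R Q v \<le> card (Q - {w, x})" unfolding dg_def using fin by (intro card_mono) auto
      also have "\<dots> = 1" using c3 fin Q(2) x(1) \<open>w \<noteq> x\<close> by (simp add: card_Diff_subset)
      finally show False using leaf [OF v] QQF by simp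
    qed
    then show "v \<in> {v \<in> N. R w v} \<union> {v \<in> F. R x v}" using v F(1) sym by blast
  qed
  then have "card {a \<in> F. dg R F a \<le> 1} \<le> card ({v \<in> N. R w v} \<union> {v \<in> F. R x v})"
    using finF by (intro card_mono) auto
  also have "\<dots> \<le> dg R N w + dg R F x" unfolding dg_def by (rule card_Un_le)
  finally show False using lc db dx dw k2 by linarith
qed

lemma s_zero: "s = 0"
proof (rule ccontr)
  assume "s \<noteq> 0"
  then have s1: "s = 1" "q5 = 0" using s_q5 by auto
  have fat: "card Q < 5" if "Q \<in> QQ" for Q
  proof -
    have "{Q \<in> QQ. 5 \<le> card Q} = {}" using s1(2) by (simp add: q5_def)
    then show ?thesis using that not_le by blast
  qed
  have npk: "\<not> packs R N (Suc (Suc 0))" using N_no_packs s1 by simp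
  have "\<exists>X\<subseteq>N. dense R X"
  proof (rule ccontr)
    assume "\<not> ?thesis"
    moreover have "N \<noteq> {}" using u_ge by (auto simp: u_def)
    ultimately obtain a where a: "a \<in> N" "dg R N a \<le> 1" using dense_nbr_cover [of N] by force
    then have d: "dg R U a \<le> 1" using dg_UN N_sub by auto
    then have "(\<Sum>Q\<in>QQ. dg R Q a) + q5 \<le> 2 * t" using k2 by (intro QQ_dg_bound a) linarith
    then show False using deg_split [of a] d N_deg [OF a(1)] k_eq s1 by linarith
  qed
  then obtain C where C: "C \<subseteq> N" "mind C" "\<And>Y. Y \<subseteq> N \<Longrightarrow> dense R Y \<Longrightarrow> card (C - {}) \<le> card (Y - {})"
    using min_dense [of _ N "{}"] by metis
  have finC: "finite C" using C(1) finN finite_subset by blast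
  define F where "F = N - C"
  have dgN: "dg R N a = dg R F a + dg R C a" for a
    using dg_Diff [OF finN C(1), of R a] by (simp add: F_def)
  have ksum: "k = t + 2" using k_eq s1 by simp
  have one: "dg R C a \<le> 1" if "a \<in> F" for a
  proof (rule ccontr)
    assume "\<not> ?thesis"
    then obtain x y where "x \<in> C" "y \<in> C" "x \<noteq> y" "R a x" "R a y"
      by (rule two_nbrs [OF finC])
    then show False
      using no_two_links [OF C, of a x y x y] N_dense that subsetD [OF C(1)] by (simp add: F_def)
  qed
  show False
  proof (cases "F = {}")
    \<comment> \<open>The remainder outside \<open>L\<close> is one chordless cycle with all degrees
      equal to \<open>2k - 2\<close>, so it has no weight at all.\<close>
    case True
    then have NC: "N = C" using C(1) by (auto simp: F_def)
    have "om k (deg a) = 0" if a: "a \<in> N" for a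
    proof -
      have d: "dg R U a = 2" using dg_UN [OF NU [OF a]] NC mind_dg [OF C(2)] a by simp
      then have "(\<Sum>Q\<in>QQ. dg R Q a) + q5 \<le> 2 * t" using k2 by (intro QQ_dg_bound a) linarith
      then have "deg a + 2 = 2 * k" using deg_split [of a] d N_deg [OF a] ksum by linarith
      then show ?thesis by (auto simp: om_def)
    qed
    then have "OmU \<le> 0" by (simp add: OmU_N)
    then show False using OmU_ge ksum by linarith
  next
    case False
    show False
    proof (rule forest_with_cycle [of F QQ C])
      show "F \<subseteq> N" "F \<noteq> {}" using False by (auto simp: F_def)
      show "\<not> dense R X" if "X \<subseteq> F" for X
      proof
        assume X: "dense R X"
        have "dense R C" "X \<inter> C = {}" using C(2) that by (auto simp: F_def mind_def)
        then have "packs R (X \<union> C) (Suc (Suc 0))" by (rule packs_Suc_Un [OF packs_1 [OF X]])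
        moreover have "X \<union> C \<subseteq> N" using that C(1) by (auto simp: F_def)
        ultimately show False using npk packs_mono by metis
      qed
      show "card QQ + 2 = k" using ksum by (simp add: t_def)
      show "finite C" "C \<subseteq> V" "C \<inter> F = {}" using finC C(1) NV by (auto simp: F_def)
      show "deg a = dg R F a + dg R C a + (\<Sum>Q\<in>QQ. dg R Q a)" if "a \<in> F" for a
        using deg_split [of a] dg_UN [of a] NU [of a] dgN [of a] that by (simp add: F_def)
      show "dg R U a \<le> dg R F a + 1" if "a \<in> F" for a
        using dg_UN [of a] NU [of a] dgN [of a] one [OF that] that by (simp add: F_def)
      show "\<not> R c b" if "a \<in> F" "b \<in> F" "c \<in> C" "R a b" "R a c" for a b c
        using no_triangle_U [of a b c] that C(1) NU sym by (auto simp: F_def)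
    qed (use one in auto)
  qed
qed

lemma k_t: "k = t + 1"
  using k_eq s_zero by simp

lemma N_forest: "X \<subseteq> N \<Longrightarrow> \<not> dense R X"
proof
  assume "X \<subseteq> N" "dense R X"
  then show False using N_no_packs packs_mono [OF packs_1] s_zero by metis
qed

lemma N_ne: "N \<noteq> {}"
  using u_ge by (auto simp: u_def)

lemma card_Q_le: assumes "Q \<in> QQ" shows "card Q \<le> 4"
proof (rule ccontr)
  assume neg: "\<not> ?thesis"
  have fin: "finite Q" using QQ_facts assms by blast
  show False
  proof (rule forest_with_cycle [of N "QQ - {Q}" Q])
    show "\<not> dense R X" if "X \<subseteq> N" for X using N_forest that .
    show "Q \<inter> N = {}" using QQ_facts(5) [OF assms] N_sub by blast
    show "card (QQ - {Q}) + 2 = k" using card.remove [OF finQQ assms] k_t by (simp add: t_def)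
    show "P \<in> QQ - {Q}" if "P \<in> QQ" "card P = 3" for P using that neg by auto
    show "dg R Q a \<le> 1" if "a \<in> N" for a using Q5_dg [OF assms _ NU [OF that]] neg by simp
    show "deg a = dg R N a + dg R Q a + (\<Sum>P\<in>QQ - {Q}. dg R P a)" if "a \<in> N" for a
      using deg_split [of a] dg_UN [OF NU [OF that]] sum.remove [OF finQQ assms, of "\<lambda>P. dg R P a"] by simp
    show "dg R U a \<le> dg R N a + 1" if "a \<in> N" for a using dg_UN [OF NU [OF that]] by simp
    show "\<not> R c b" if h: "a \<in> N" "b \<in> N" "c \<in> Q" "R a b" "R a c" for a b c
    proof
      assume "R c b"
      then have "card Q = 3" using triangle_exchange(1) [OF assms h(3) NU [OF h(1)] h(2,4,5)] sym by blast
      then show False using neg by simp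
    qed
  qed (use N_ne fin QQ_facts(1) assms in auto)
qed

end

section \<open>Components and centres of forests\<close>

context rel
begin

definition iscomp :: "'a set \<Rightarrow> 'a set \<Rightarrow> bool" where
  "iscomp X K \<longleftrightarrow> K \<subseteq> X \<and> conn R K \<and> (\<forall>v\<in>K. \<forall>w\<in>X. R v w \<longrightarrow> w \<in> K)"

definition comps :: "'a set \<Rightarrow> 'a set set" where
  "comps X = {K. iscomp X K}"

lemma iscompD:
  assumes "iscomp X K"
  shows "K \<subseteq> X" "conn R K" "finite K" "K \<noteq> {}" "\<And>v w. v \<in> K \<Longrightarrow> w \<in> X \<Longrightarrow> R v w \<Longrightarrow> w \<in> K"
  using assms conn_finite conn_ne by (auto simp: iscomp_def)

lemma comp_exists:
  assumes "finite X" "v \<in> X" obtains K where "iscomp X K" "v \<in> K"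
proof -
  let ?P = "\<lambda>K. K \<subseteq> X \<and> conn R K \<and> v \<in> K"
  have "\<exists>K. ?P K \<and> (\<forall>A. ?P A \<longrightarrow> card A \<le> card K)"
  proof (rule ex_has_greatest_nat)
    show "?P {v}" using assms by simp
    show "\<forall>A. ?P A \<longrightarrow> card A < Suc (card X)" using assms(1) by (auto simp: less_Suc_eq_le card_mono)
  qed
  then obtain K where K: "?P K" and mx: "\<And>A. ?P A \<Longrightarrow> card A \<le> card K" by blast
  have "w \<in> K" if "a \<in> K" "w \<in> X" "R a w" for a w
  proof (rule ccontr)
    assume "w \<notin> K"
    have "conn R (insert w K)" using K that sym by (intro conn_insert [of K a w]) auto
    then have "card (insert w K) \<le> card K" using mx [of "insert w K"] K that by blast
    then show False using \<open>w \<notin> K\<close> K conn_finite by fastforce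
  qed
  then show ?thesis using that [of K] K by (auto simp: iscomp_def)
qed

lemma comp_absorb:
  assumes "conn R A" "A \<subseteq> X" "iscomp X K" "A \<inter> K \<noteq> {}" shows "A \<subseteq> K"
proof (rule ccontr)
  assume "\<not> ?thesis"
  then have "A \<inter> K \<subset> A" by blast
  then obtain x y where "x \<in> A \<inter> K" "y \<in> A - A \<inter> K" "R x y" using connD [OF assms(1) _ assms(4)] by blast
  then show False using iscompD(5) [OF assms(3), of x y] assms(2) by blast
qed

lemma comp_eq: "iscomp X K \<Longrightarrow> iscomp X K' \<Longrightarrow> K \<inter> K' \<noteq> {} \<Longrightarrow> K = K'"
  using comp_absorb [of K X K'] comp_absorb [of K' X K] iscompD(1,2) by blast

lemma finite_comps [simp]: "finite X \<Longrightarrow> finite (comps X)"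
  by (rule finite_subset [of _ "Pow X"]) (auto simp: comps_def iscomp_def)

lemma Union_comps: assumes "finite X" shows "\<Union>(comps X) = X"
proof
  show "\<Union>(comps X) \<subseteq> X" by (auto simp: comps_def iscomp_def)
  show "X \<subseteq> \<Union>(comps X)"
  proof
    fix v assume "v \<in> X"
    then obtain K where "iscomp X K" "v \<in> K" using comp_exists assms by blast
    then show "v \<in> \<Union>(comps X)" by (auto simp: comps_def)
  qed
qed

lemma sum_comps: "finite X \<Longrightarrow> (\<Sum>v\<in>X. f v) = (\<Sum>K\<in>comps X. \<Sum>v\<in>K. f v)"
  for f :: "'a \<Rightarrow> 'b :: comm_monoid_add"
proof -
  assume fin: "finite X"
  have "(\<Sum>v\<in>\<Union>(comps X). f v) = (\<Sum>K\<in>comps X. \<Sum>v\<in>K. f v)"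
  proof (subst sum.Union_disjoint)
    show "\<forall>K\<in>comps X. finite K" using iscompD(3) by (simp add: comps_def)
    show "\<forall>K\<in>comps X. \<forall>K'\<in>comps X. K \<noteq> K' \<longrightarrow> K \<inter> K' = {}"
      unfolding comps_def mem_Collect_eq using comp_eq by blast
  qed simp
  then show ?thesis using Union_comps [OF fin] by simp
qed

lemma dg_comp: assumes "iscomp X K" "v \<in> K" shows "dg R X v = dg R K v"
  unfolding dg_def using iscompD [OF assms(1)] assms(2) by (intro arg_cong [where f = card]) blast

lemma dg_sum: "finite X \<Longrightarrow> dg R X w = (\<Sum>v\<in>X. if R w v then 1 else 0)"
  by (simp add: sum.If_cases dg_def Int_def)

lemma sum_comps_dg: assumes "finite X" shows "(\<Sum>K\<in>comps X. dg R K w) = dg R X w"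
proof -
  have "(\<Sum>K\<in>comps X. dg R K w) = (\<Sum>K\<in>comps X. \<Sum>v\<in>K. if R w v then 1 else 0)"
    by (intro sum.cong refl dg_sum) (auto simp: comps_def dest: iscompD(3))
  then show ?thesis unfolding dg_sum [OF assms] sum_comps [OF assms, of "\<lambda>v. if R w v then 1 else 0"] .
qed

lemma sum_comps_eb: "finite X \<Longrightarrow> (\<Sum>K\<in>comps X. eb R K Y) = eb R X Y"
  unfolding eb_def by (rule sum_comps [symmetric])

lemma eb_even: "finite X \<Longrightarrow> even (eb R X X)"
  by (induction X rule: finite_induct) (simp_all add: ds_insert)

text \<open>The bounds leave \<open>2 card K - 2\<close> and \<open>2 card K - 1\<close>; parity
  decides.\<close>

lemma tree_eb: assumes "conn R K" "\<not> dense R K" shows "eb R K K + 2 = 2 * card K"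
proof -
  have "eb R K K < 2 * card K" using assms conn_finite conn_ne by (auto simp: dense_def)
  moreover have "2 * card K \<le> eb R K K + 2" by (rule conn_ds [OF assms(1)])
  moreover obtain m where "eb R K K = 2 * m" using eb_even [OF conn_finite [OF assms(1)]] by (elim evenE)
  ultimately show ?thesis by simp
qed

lemma forest_eb:
  assumes "finite X" "\<And>Y. Y \<subseteq> X \<Longrightarrow> \<not> dense R Y"
  shows "eb R X X + 2 * card (comps X) = 2 * card X"
proof -
  have "eb R X X = (\<Sum>K\<in>comps X. \<Sum>v\<in>K. dg R X v)"
    unfolding eb_def by (rule sum_comps [OF assms(1)])
  also have "\<dots> = (\<Sum>K\<in>comps X. eb R K K)"
    unfolding eb_def by (intro sum.cong) (auto simp: comps_def dg_comp)
  finally have "eb R X X + 2 * card (comps X) = (\<Sum>K\<in>comps X. eb R K K + 2)"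
    by (simp only: sum.distrib) simp
  also have "\<dots> = (\<Sum>K\<in>comps X. 2 * card K)"
    by (intro sum.cong refl tree_eb assms(2)) (auto simp: comps_def dest: iscompD)
  also have "\<dots> = 2 * card X"
    using sum_comps [OF assms(1), of "\<lambda>_. 1 :: nat"] by (simp add: sum_distrib_left)
  finally show ?thesis .
qed

text \<open>Comparing the edge counts of the two forests avoids tracking which component
  splits.\<close>

lemma comps_remove:
  assumes "finite X" "\<And>Y. Y \<subseteq> X \<Longrightarrow> \<not> dense R Y" "b \<in> X"
  shows "card (comps (X - {b})) + 1 = card (comps X) + dg R X b"
proof -
  have "eb R X X + 2 * card (comps X) = 2 * card X" using assms by (intro forest_eb)
  moreover have "eb R (X - {b}) (X - {b}) + 2 * card (comps (X - {b})) = 2 * card (X - {b})"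
    using assms by (intro forest_eb) auto
  moreover have "eb R X X = eb R (X - {b}) (X - {b}) + 2 * dg R X b" by (rule ds_remove) fact+
  moreover have "card X = Suc (card (X - {b}))" using assms(1,3) by (rule card.remove)
  ultimately show ?thesis by linarith
qed

lemma forest_dg: "conn R K \<Longrightarrow> \<not> dense R (insert b K) \<Longrightarrow> b \<notin> K \<Longrightarrow> dg R K b \<le> 1"
  using conn_dense_insert [of K b] by force

text \<open>The centre is found by walking into a heavy branch: \<open>S\<close> is a smallest heavy component over
  all deletions of a vertex of \<open>T\<close>, and crossing the edge into \<open>S\<close> would give a smaller one.\<close>

lemma forest_centre:
  fixes g h :: "'a \<Rightarrow> nat"
  assumes fin: "finite X" and forest: "\<And>Y. Y \<subseteq> X \<Longrightarrow> \<not> dense R Y"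
    and cross: "\<And>A B. \<lbrakk>A \<subseteq> X; B \<subseteq> X; conn R A; conn R B; A \<inter> B = {}; 2 \<le> sum g A; 2 \<le> sum h B\<rbrakk> \<Longrightarrow> False"
    and g: "card (comps X) + 1 < sum g X" and h: "card (comps X) + 1 < sum h X"
  shows "\<exists>b\<in>X. \<forall>K. iscomp (X - {b}) K \<longrightarrow> sum g K \<le> 1 \<and> sum h K \<le> 1"
proof (rule ccontr)
  assume neg: "\<not> ?thesis"
  have heavy: "\<exists>K. iscomp X K \<and> 2 \<le> sum f K" if "card (comps X) + 1 < sum f X" for f :: "'a \<Rightarrow> nat"
  proof (rule ccontr)
    assume "\<not> ?thesis"
    then have "sum f X \<le> (\<Sum>K\<in>comps X. 1)"
      unfolding sum_comps [OF fin] by (intro sum_mono) (force simp: comps_def)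
    then show False using that by simp
  qed
  have crossc: False if AB: "iscomp X A" "iscomp X B" and "A \<noteq> B" "2 \<le> sum g A" "2 \<le> sum h B" for A B
  proof -
    have "A \<inter> B = {}" using comp_eq [OF AB] that(3) by blast
    then show False using cross iscompD(1,2) [OF AB(1)] iscompD(1,2) [OF AB(2)] that(4,5) by simp
  qed
  obtain T where T: "iscomp X T" "2 \<le> sum g T" "2 \<le> sum h T"
    using heavy [OF g] heavy [OF h] crossc by metis
  have light: "sum g K \<le> 1 \<and> sum h K \<le> 1" if "iscomp X K" "K \<noteq> T" for K
    using crossc [of K T] crossc [of T K] T that by force
  have three: "3 \<le> sum f T" if "card (comps X) + 1 < sum f X"
    "\<And>K. iscomp X K \<Longrightarrow> K \<noteq> T \<Longrightarrow> sum f K \<le> 1" for f :: "'a \<Rightarrow> nat"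
  proof -
    have TC: "T \<in> comps X" using T(1) by (simp add: comps_def)
    have "sum f X = sum f T + (\<Sum>K\<in>comps X - {T}. sum f K)"
      unfolding sum_comps [OF fin, of f] by (rule sum.remove) (use fin TC in auto)
    also have "(\<Sum>K\<in>comps X - {T}. sum f K) \<le> (\<Sum>K\<in>comps X - {T}. 1)"
      by (rule sum_mono) (use that(2) in \<open>simp add: comps_def\<close>)
    finally have "sum f X \<le> sum f T + card (comps X - {T})" by simp
    moreover have "card (comps X) = Suc (card (comps X - {T}))"
      by (rule card.remove) (use fin TC in auto)
    ultimately show ?thesis using that(1) by simp
  qed
  \<comment> \<open>The other components take at most one unit each, and the hypotheses exceed the
    number of components by at least 2.\<close>
  have g3: "3 \<le> sum g T" and h3: "3 \<le> sum h T" using three [OF g] three [OF h] light by blast+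
  define bad where "bad b K \<longleftrightarrow> iscomp (X - {b}) K \<and> (2 \<le> sum g K \<or> 2 \<le> sum h K)" for b K
  have ex_bad: "\<exists>K. bad b K" if "b \<in> X" for b
    using neg that not_less_eq_eq unfolding bad_def by (metis One_nat_def numeral_2_eq_2)
  have TX: "T \<subseteq> X" using iscompD(1) [OF T(1)] .
  have bad_sub: "K \<subseteq> T" if "b \<in> T" "bad b K" for b K
  proof -
    have K: "iscomp (X - {b}) K" using that(2) by (simp add: bad_def)
    note K' = iscompD [OF K]
    show ?thesis
    proof (cases "K \<inter> T = {}")
      case True
      have "\<not> R v b" if "v \<in> K" for v
        using iscompD(5) [OF T(1) \<open>b \<in> T\<close>, of v] sym that True K'(1) by blast
      then have "iscomp X K" unfolding iscomp_def using K' by blast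
      moreover have "K \<noteq> T" using True K'(4) by blast
      ultimately show ?thesis using light that(2) unfolding bad_def by fastforce
    next
      case False
      then show ?thesis using comp_absorb [OF K'(2) _ T(1)] K'(1) by blast
    qed
  qed
  let ?P = "\<lambda>p. fst p \<in> T \<and> bad (fst p) (snd p)"
  obtain b0 where "b0 \<in> T" using iscompD(4) [OF T(1)] by blast
  then obtain S0 where "?P (b0, S0)" using ex_bad TX by force
  then have "\<exists>p. ?P p \<and> (\<forall>q. ?P q \<longrightarrow> card (snd p) \<le> card (snd q))"
    by (rule ex_has_least_nat)
  then obtain b S where b: "b \<in> T" "bad b S" and
    least: "\<And>b' S'. b' \<in> T \<Longrightarrow> bad b' S' \<Longrightarrow> card S \<le> card S'" by force
  have S: "iscomp (X - {b}) S" using b(2) by (simp add: bad_def)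
  note S' = iscompD [OF S]
  have ST: "S \<subseteq> T" using bad_sub b by blast
  have "S \<subset> T" using ST S'(1) b(1) by blast
  then obtain b' y where "b' \<in> S" "y \<in> T - S" "R b' y"
    using connD [OF iscompD(2) [OF T(1)] _ S'(4)] by blast
  moreover from this have "y = b" using S'(5) [of b' y] TX by blast
  ultimately have b': "b' \<in> S" "R b' b" by auto
  have dgS: "dg R S b \<le> 1"
  proof (rule forest_dg [OF S'(2)])
    show "\<not> dense R (insert b S)" using forest [of "insert b S"] b(1) S'(1) TX by blast
  qed (use S'(1) in blast)
  have only: "w = b'" if "w \<in> S" "R b w" for w
  proof (rule ccontr)
    assume "w \<noteq> b'"
    then have "2 \<le> dg R S b" using that b' sym S'(3) by (auto simp: dg_ge_2_iff)
    then show False using dgS by simp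
  qed
  have bb': "b \<noteq> b'" using b'(2) irr by blast
  obtain C where C: "iscomp (X - {b'}) C" "b \<in> C"
    using comp_exists [of "X - {b'}" b] fin bb' b(1) TX by blast
  note C' = iscompD [OF C(1)]
  have disj: "S \<inter> C = {}"
  proof (rule ccontr)
    assume ne: "S \<inter> C \<noteq> {}"
    have "S \<inter> C \<subset> C" using C(2) S'(1) by blast
    then obtain w v where wv: "w \<in> S" "w \<in> C" "v \<in> C" "v \<notin> S" "R w v"
      using connD [OF C'(2) _ ne] by blast
    then have "v = b" using S'(5) [of w v] C'(1) by blast
    then have "w = b'" using only [of w] wv sym by blast
    then show False using wv(2) C'(1) by blast
  qed
  have closed: "w \<in> S \<union> C" if "v \<in> S \<union> C" "w \<in> X" "R v w" for v w
    using that S'(5) [of v w] C'(5) [of v w] C(2) b'(1) by blast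
  have "T \<subseteq> S \<union> C"
  proof (rule ccontr)
    assume "\<not> ?thesis"
    then have "T \<inter> (S \<union> C) \<subset> T" by blast
    moreover have "T \<inter> (S \<union> C) \<noteq> {}" using b(1) C(2) by blast
    ultimately obtain v w where vw: "v \<in> T \<inter> (S \<union> C)" "w \<in> T - T \<inter> (S \<union> C)" "R v w"
      using connD [OF iscompD(2) [OF T(1)], of "T \<inter> (S \<union> C)"] by meson
    then have "w \<in> S \<union> C" using closed [of v w] TX by blast
    then show False using vw(2) by blast
  qed
  moreover have "C \<subseteq> T" using comp_absorb [OF C'(2) _ T(1)] C'(1) C(2) b(1) by blast
  \<comment> \<open>Only the edge from \<open>b'\<close> to \<open>b\<close> joins \<open>S\<close>
    to the rest of \<open>T\<close>, so after deleting \<open>b'\<close> that whole rest lies in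
    \<open>C\<close>.\<close>
  ultimately have T_eq: "T = S \<union> C" using ST by blast
  have split: "sum f T = sum f S + sum f C" for f :: "'a \<Rightarrow> nat"
    unfolding T_eq by (rule sum.union_disjoint) (use S' C' disj in auto)
  have SX: "S \<subseteq> X" and CX: "C \<subseteq> X" using S'(1) C'(1) by auto
  have gh: "2 \<le> sum g S \<Longrightarrow> sum h C \<le> 1" "2 \<le> sum h S \<Longrightarrow> sum g C \<le> 1"
    using cross [OF SX CX S'(2) C'(2) disj] cross [OF CX SX C'(2) S'(2)] disj by force+
  \<comment> \<open>If \<open>S\<close> is heavy for one weight, \<open>cross\<close> makes
    \<open>C\<close> light for the other; as \<open>T\<close> carries at least 3 of it,
    \<open>S\<close> is heavy for that one too, and \<open>cross\<close> applies again.\<close>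
  have light_C: "sum g C \<le> 1" "sum h C \<le> 1"
    using b(2) gh split [of g] split [of h] g3 h3 unfolding bad_def by linarith+
  obtain S2 where S2: "bad b' S2" using ex_bad b'(1) SX by blast
  have b'T: "b' \<in> T" using b'(1) ST by blast
  have S2': "iscomp (X - {b'}) S2" using S2 by (simp add: bad_def)
  have "S2 \<noteq> C" using S2 light_C unfolding bad_def by auto
  then have "S2 \<inter> C = {}" using comp_eq [OF S2' C(1)] by blast
  then have "S2 \<subset> S" using bad_sub [OF b'T S2] iscompD(1) [OF S2'] T_eq b'(1) by blast
  then have "card S2 < card S" using S'(3) psubset_card_mono by blast
  then show False using least [OF b'T S2] by simp
qed

end

section \<open>Forest remainder\<close>

context system
begin

definition kap :: nat where "kap = card (comps N)"
definition OmN :: int where "OmN = (\<Sum>v\<in>N. om k (deg v))"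
definition W0 :: "'a set" where "W0 = {a \<in> N. dg R N a \<le> 1}"

text \<open>The bound is split between \<open>y\<close> and \<open>Q - {y}\<close> because these two
  parts can close disjoint cycles with different components. The split form is used again in
  \<open>good_singleton\<close>.\<close>

definition central :: "'a set \<Rightarrow> 'a \<Rightarrow> bool" where
  "central Q b \<longleftrightarrow> b \<in> N \<and>
     (\<exists>y\<in>Q. \<forall>K. iscomp (N - {b}) K \<longrightarrow> dg R K y \<le> 1 \<and> eb R K (Q - {y}) \<le> 1)"

lemma N_eb: "eb R N N + 2 * kap = 2 * u"
  unfolding kap_def u_def by (rule forest_eb [OF finN N_forest])

lemma OmN_U: "OmN = OmU + int z"
  by (simp add: OmN_def OmU_N)

lemma OmN_ge: "9 * int k + 16 \<le> 2 * OmN"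
  using OmU_ge OmN_U k_t by linarith

lemma deg_N: "a \<in> N \<Longrightarrow> deg a = dg R N a + (\<Sum>Q\<in>QQ. dg R Q a)"
  using deg_split [of a] dg_UN [OF NU] by simp

lemma t_pos: "1 \<le> t"
  using k_t k2 by simp

lemma om_deg: "a \<in> N \<Longrightarrow> 2 * int t + om k (deg a) \<le> int (deg a)"
  using N_deg [of a] k_t by (auto simp: om_def)

lemma sum_deg: "A \<subseteq> N \<Longrightarrow> 2 * int t * int (card A) + (\<Sum>a\<in>A. om k (deg a)) \<le> (\<Sum>a\<in>A. int (deg a))"
  using sum_mono [of A "\<lambda>a. 2 * int t + om k (deg a)" "\<lambda>a. int (deg a)"] om_deg
  by (auto simp: sum.distrib mult.commute mult.left_commute)

text \<open>The exact edge count of the forest \<open>N\<close> replaces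
  \<open>degree_sum_bound\<close>, which brings in the number of components.\<close>

lemma exact_bound: "2 * (int t - 1) * int u + OmN + 2 * int kap \<le> (\<Sum>Q\<in>QQ. int (eb R N Q))"
proof -
  have "(\<Sum>v\<in>N. int (deg v)) = int (eb R N N) + (\<Sum>Q\<in>QQ. int (eb R N Q))"
    by (simp add: deg_N eb_def sum.distrib) (rule sum.swap)
  moreover have "2 * int t * int u + OmN \<le> (\<Sum>v\<in>N. int (deg v))"
    using sum_deg [of N] by (simp add: OmN_def u_def)
  moreover have "int (eb R N N) + 2 * int kap = 2 * int u" using N_eb by linarith
  ultimately show ?thesis by (simp add: algebra_simps)
qed

lemma eb_N_swap: "finite X \<Longrightarrow> eb R N X = (\<Sum>x\<in>X. dg R N x)"
  using dg_swap [of N X] by (simp add: eb_def)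

lemma eb_remove: "Q \<in> QQ \<Longrightarrow> y \<in> Q \<Longrightarrow> finite K \<Longrightarrow> eb R K Q = eb R K (Q - {y}) + dg R K y"
  using eb_Diff_right [of Q "{y}" R K] QQ_facts(4) [of Q] by (simp add: eb_singleton_right)

lemma no_two_dense:
  assumes "Q \<in> QQ" "A \<subseteq> U \<union> Q" "B \<subseteq> U \<union> Q" "dense R A" "dense R B" "A \<inter> B = {}" shows False
proof -
  have "packs R (A \<union> B) (Suc (Suc 0))" by (rule packs_Suc_Un [OF packs_1]) fact+
  moreover have "A \<union> B \<subseteq> U \<union> Q" using assms by blast
  ultimately show False using no_packs_UQ [OF assms(1)] packs_mono s_zero by metis
qed

text \<open>The weights are the edges to \<open>y\<close> and those to the rest of \<open>Q\<close>.
  Disjoint connected sets heavy for one each would give two disjoint cycles in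
  \<open>U \<union> Q\<close>, one closed by \<open>y\<close> and one by the path
  \<open>Q - {y}\<close>.\<close>

lemma centre_cases:
  assumes Q: "Q \<in> QQ" "y \<in> Q"
  shows "dg R N y \<le> kap + 1 \<or> eb R N (Q - {y}) \<le> kap + 1 \<or> (\<exists>b. central Q b)"
proof -
  let ?g = "\<lambda>a. if R a y then 1 else 0 :: nat"
  let ?h = "dg R (Q - {y})"
  have g: "sum ?g A = dg R A y" if "finite A" for A
  proof -
    have "sum ?g A = card (A \<inter> {a. R a y})" using that by (simp add: sum.If_cases)
    also have "A \<inter> {a. R a y} = {a \<in> A. R y a}" using sym by auto
    finally show ?thesis by (simp add: dg_def)
  qed
  have h: "sum ?h A = eb R A (Q - {y})" for A by (simp add: eb_def)
  have UQ: "U \<inter> Q = {}" using QQ_facts(5) [OF Q(1)] .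
  have cross: False if A: "A \<subseteq> N" "B \<subseteq> N" "conn R A" "conn R B" "A \<inter> B = {}" "2 \<le> sum ?g A" "2 \<le> sum ?h B" for A B
  proof -
    have AU: "A \<subseteq> U" "B \<subseteq> U" using A N_sub by auto
    have "y \<notin> A" using AU UQ Q(2) by blast
    then have dA: "dense R (insert y A)"
      using A(3,6) g [OF conn_finite [OF A(3)]] by (intro conn_dense_insert) auto
    have dB: "dense R (B \<union> (Q - {y}))"
    proof (rule conn_dense_Un [OF A(4) mind_remove_conn [OF mind_Q [OF Q(1)] Q(2)]])
      show "B \<inter> (Q - {y}) = {}" using AU UQ by blast
      show "2 \<le> eb R B (Q - {y})" using A(7) by (simp add: h)
    qed
    show False
    proof (rule no_two_dense [OF Q(1) _ _ dA dB])
      show "insert y A \<inter> (B \<union> (Q - {y})) = {}" using A(5) AU UQ Q(2) by blast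
    qed (use AU Q(2) in auto)
  qed
  consider "sum ?g N \<le> kap + 1" | "sum ?h N \<le> kap + 1"
    | "\<exists>b\<in>N. \<forall>K. iscomp (N - {b}) K \<longrightarrow> sum ?g K \<le> 1 \<and> sum ?h K \<le> 1"
  proof -
    have "\<exists>b\<in>N. \<forall>K. iscomp (N - {b}) K \<longrightarrow> sum ?g K \<le> 1 \<and> sum ?h K \<le> 1"
      if big: "card (comps N) + 1 < sum ?g N" "card (comps N) + 1 < sum ?h N"
    proof (rule forest_centre [OF finN _ _ big])
      show "\<not> dense R Y" if "Y \<subseteq> N" for Y using N_forest that .
      show False if "A \<subseteq> N" "B \<subseteq> N" "conn R A" "conn R B" "A \<inter> B = {}" "2 \<le> sum ?g A" "2 \<le> sum ?h B" for A B
        using cross that .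
    qed
    then show ?thesis using that unfolding kap_def by (meson not_less)
  qed
  then show ?thesis
  proof cases
    case 1 then show ?thesis using g [OF finN] by simp
  next
    case 2 then show ?thesis using h by simp
  next
    case 3
    then obtain b where b: "b \<in> N" "\<And>K. iscomp (N - {b}) K \<Longrightarrow> sum ?g K \<le> 1 \<and> sum ?h K \<le> 1" by blast
    have "central Q b"
      unfolding central_def
    proof (intro conjI bexI allI impI)
      fix K assume K: "iscomp (N - {b}) K"
      show "dg R K y \<le> 1" using b(2) [OF K] g [OF iscompD(3) [OF K]] by simp
      show "eb R K (Q - {y}) \<le> 1" using b(2) [OF K] h by simp
    qed (use b(1) Q(2) in auto)
    then show ?thesis by blast
  qed
qed

lemma central_le_2: "Q \<in> QQ \<Longrightarrow> central Q b \<Longrightarrow> iscomp (N - {b}) K \<Longrightarrow> eb R K Q \<le> 2"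
  unfolding central_def using eb_remove [of Q _ K] iscompD(3) by (metis add_mono one_add_one)

section \<open>Vertices with at most one neighbour in the forest, and their edges to a cycle\<close>

lemma W0_le_2: "a \<in> W0 \<Longrightarrow> Q \<in> QQ \<Longrightarrow> dg R Q a \<le> 2"
  using dg_Q_le_2 [of Q a] dg_UN [OF NU [of a]] k2 by (simp add: W0_def)

lemma W0_N: "a \<in> W0 \<Longrightarrow> a \<in> N" and W0_U: "a \<in> W0 \<Longrightarrow> a \<in> U"
  using N_sub by (auto simp: W0_def)

lemma W0_ne: "W0 \<noteq> {}"
  using dense_nbr_cover [OF finN N_ne] N_forest [of N] by (force simp: W0_def)

text \<open>Exchange \<open>x\<close> for \<open>a\<close>, which keeps both its neighbours on
  \<open>Q\<close>: then \<open>x\<close> has no more neighbours in \<open>U\<close> than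
  \<open>a\<close>.\<close>

lemma pair_le:
  assumes "a \<in> W0" "Q \<in> QQ" "dg R Q a = 2" "x \<in> Q" "\<not> R a x" shows "dg R U x \<le> 1"
proof -
  have "dg R (Q - {x}) a = dg R Q a" unfolding dg_def by (rule arg_cong [where f = card]) (use assms in auto)
  then have "dg R U x \<le> dg R U a"
    using swap [OF assms(2) card_Q_le [OF assms(2)] assms(4) W0_U [OF assms(1)]] assms by simp
  then show ?thesis using dg_UN [OF W0_U [OF assms(1)]] assms(1) by (simp add: W0_def)
qed

text \<open>The degree is at least \<open>2k - 2 = 2t\<close>, with at most 2 from each cycle and 1
  from \<open>N\<close>. One missing edge at \<open>Q\<close> uses up all the slack.\<close>

lemma W0_nonfull:
  assumes a: "a \<in> W0" and Q: "Q \<in> QQ" "dg R Q a \<noteq> 2"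
  shows "dg R N a = 1" "deg a + 2 = 2 * k" "\<And>P. P \<in> QQ \<Longrightarrow> P \<noteq> Q \<Longrightarrow> dg R P a = 2"
proof -
  have le: "dg R P a \<le> 2" if "P \<in> QQ" for P using W0_le_2 [OF a that] .
  have tQ: "t = Suc (card (QQ - {Q}))" unfolding t_def by (rule card.remove [OF finQQ Q(1)])
  have sm: "(\<Sum>P\<in>QQ. dg R P a) = dg R Q a + (\<Sum>P\<in>QQ - {Q}. dg R P a)" by (rule sum.remove [OF finQQ Q(1)])
  have rest: "(\<Sum>P\<in>QQ - {Q}. dg R P a) \<le> 2 * card (QQ - {Q})"
    using sum_bounded_above [of "QQ - {Q}" "\<lambda>P. dg R P a" 2] le by simp
  have lt: "dg R Q a \<le> 1" using le [OF Q(1)] Q(2) by simp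
  have d: "deg a = dg R N a + (\<Sum>P\<in>QQ. dg R P a)" "2 * k \<le> deg a + 2" "dg R N a \<le> 1"
    using deg_N N_deg W0_N [OF a] a by (auto simp: W0_def)
  then have eq: "(\<Sum>P\<in>QQ - {Q}. dg R P a) = 2 * card (QQ - {Q})" and 1: "dg R N a = 1" "deg a + 2 = 2 * k"
    using rest lt sm tQ k_t by linarith+
  show "dg R N a = 1" "deg a + 2 = 2 * k" by fact+
  fix P assume P: "P \<in> QQ" "P \<noteq> Q"
  have "P \<in> QQ - {Q}" using P by simp
  then show "dg R P a = 2" using sum_tight [of "QQ - {Q}" "\<lambda>P. dg R P a" 2 P] le eq by simp
qed

text \<open>By \<open>pair_le\<close>, only the two neighbours of \<open>a\<close> on
  \<open>Q\<close> can have more than one neighbour in \<open>N\<close>. The first alternative says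
  that nearly all edges from \<open>N\<close> to \<open>Q\<close> end at a single vertex.\<close>

lemma pair_cases:
  assumes a: "a \<in> W0" and Q: "Q \<in> QQ" "dg R Q a = 2"
  shows "(\<exists>y\<in>Q. eb R N (Q - {y}) + 1 \<le> kap + card Q) \<or> (\<exists>b. central Q b)"
proof -
  have fin: "finite Q" using QQ_facts Q by blast
  obtain y w where yw: "{q \<in> Q. R a q} = {y, w}" "y \<noteq> w" using Q(2) by (auto simp: dg_def card_2_iff)
  then have in_Q: "y \<in> Q" "w \<in> Q" by blast+
  have c: "card Q = Suc (Suc (card (Q - {w} - {y})))"
    using card.remove [OF fin in_Q(2)] card.remove [of "Q - {w}" y] fin in_Q yw(2) by simp
  have "eb R N (Q - {w}) = dg R N y + (\<Sum>x\<in>Q - {w} - {y}. dg R N x)"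
    unfolding eb_N_swap [OF finite_Diff [OF fin]] by (rule sum.remove) (use fin in_Q yw(2) in auto)
  also have "(\<Sum>x\<in>Q - {w} - {y}. dg R N x) \<le> (\<Sum>x\<in>Q - {w} - {y}. 1)"
  proof (rule sum_mono)
    fix x assume "x \<in> Q - {w} - {y}"
    then have "dg R U x \<le> 1" using pair_le [OF a Q, of x] yw(1) by blast
    then show "dg R N x \<le> 1" using dg_mono [OF finU N_sub, of R x] by simp
  qed
  finally have e: "eb R N (Q - {w}) + 2 \<le> dg R N y + card Q" using c by simp
  have "3 \<le> card Q" using card_Q [OF Q(1)] .
  consider "dg R N y \<le> kap + 1" | "eb R N (Q - {y}) \<le> kap + 1" | "\<exists>b. central Q b"
    using centre_cases [OF Q(1) in_Q(1)] by blast
  then show ?thesis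
  proof cases
    case 1
    then have "eb R N (Q - {w}) + 1 \<le> kap + card Q" using e by simp
    then show ?thesis using in_Q(2) by blast
  next
    case 2
    then have "eb R N (Q - {y}) + 1 \<le> kap + card Q" using \<open>3 \<le> card Q\<close> by simp
    then show ?thesis using in_Q(1) by blast
  qed blast
qed

text \<open>The usual two leaves of a tree, by summing degrees; the hypothesis excludes components
  with a single vertex.\<close>

lemma comp_leaves:
  assumes "\<And>a. a \<in> W0 \<Longrightarrow> dg R N a = 1" "iscomp N K" shows "2 \<le> card (K \<inter> W0)"
proof -
  note K = iscompD [OF assms(2)]
  have "(\<Sum>v\<in>K. 2) \<le> (\<Sum>v\<in>K. dg R K v + (if v \<in> W0 then 1 else 0))"
  proof (rule sum_mono)
    fix v assume v: "v \<in> K"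
    then have "dg R N v = dg R K v" "v \<in> N" using dg_comp [OF assms(2)] K(1) by auto
    then show "2 \<le> dg R K v + (if v \<in> W0 then 1 else 0)"
      using assms(1) [of v] by (auto simp: W0_def)
  qed
  also have "\<dots> = eb R K K + card (K \<inter> W0)" using K(3) by (simp add: sum.distrib eb_def sum.If_cases)
  finally show ?thesis using tree_eb [OF K(2) N_forest [OF K(1)]] by simp
qed

lemma sum_remove_bound:
  assumes "S \<subseteq> QQ"
  shows "(\<Sum>P\<in>QQ. int (eb R N P)) \<le> (\<Sum>P\<in>S. int (eb R N P)) + (int t - int (card S)) * (2 * int u + 2)"
proof -
  have "(\<Sum>P\<in>QQ - S. int (eb R N P)) \<le> (\<Sum>P\<in>QQ - S. 2 * int u + 2)"
  proof (rule sum_mono)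
    fix P assume "P \<in> QQ - S"
    then show "int (eb R N P) \<le> 2 * int u + 2" using upper_bound [of P] by (auto split: if_splits)
  qed
  moreover have "int (card (QQ - S)) = int t - int (card S)"
    using assms card_mono [OF finQQ assms] finite_subset [OF assms finQQ]
    by (simp add: card_Diff_subset t_def)
  ultimately show ?thesis
    using sum.subset_diff [OF assms finQQ, of "\<lambda>P. int (eb R N P)"] by simp
qed

text \<open>If both alternatives fail, every vertex of \<open>Q\<close> has at most
  \<open>kap + 1\<close> neighbours in \<open>N\<close>, and \<open>exact_bound\<close> forces many
  components, hence many leaves. These overload another cycle, which every leaf sees twice; or, if
  \<open>Q\<close> is alone, the single vertex of \<open>Q\<close> that must serve all
  components.\<close>

lemma nopair_cases:
  assumes Q: "Q \<in> QQ" and np: "\<And>a. a \<in> W0 \<Longrightarrow> dg R Q a \<noteq> 2"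
  shows "(\<exists>y\<in>Q. eb R N (Q - {y}) \<le> kap + 1) \<or> (\<exists>b. central Q b)"
proof (rule ccontr)
  assume neg: "\<not> ?thesis"
  have fin: "finite Q" using QQ_facts Q by blast
  have small: "dg R N y \<le> kap + 1" if "y \<in> Q" for y
    using centre_cases [OF Q that] neg that by blast
  note nf = W0_nonfull [OF _ Q np]
  have W1: "dg R N a = 1" if "a \<in> W0" for a using nf(1) [OF that that] .
  have "eb R N Q \<le> (\<Sum>y\<in>Q. kap + 1)" unfolding eb_N_swap [OF fin] by (rule sum_mono) (rule small)
  also have "\<dots> = card Q * (kap + 1)" by simp
  also have "\<dots> \<le> 4 * (kap + 1)" using card_Q_le [OF Q] by (rule mult_right_mono) simp
  finally have "eb R N Q \<le> 4 * kap + 4" by simp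
  then have "OmN + 2 * int kap \<le> 4 * int kap + 4 + 2 * (int t - 1)"
    using sum_remove_bound [of "{Q}"] Q exact_bound by (simp add: algebra_simps)
  moreover have "int k = int t + 1" "2 \<le> int k" using k_t k2 by simp_all
  ultimately have "4 \<le> int kap" using OmN_ge by presburger
  then have kap: "4 \<le> kap" by simp
  have comps_W: "2 * kap \<le> card W0"
  proof -
    have finW: "finite W0" by (simp add: W0_def)
    have "(\<Sum>K\<in>comps N. 2) \<le> (\<Sum>K\<in>comps N. card (K \<inter> W0))"
      by (rule sum_mono) (use comp_leaves [OF W1] in \<open>simp add: comps_def\<close>)
    also have "\<dots> = (\<Sum>K\<in>comps N. \<Sum>v\<in>K. if v \<in> W0 then 1 else 0)"
      by (intro sum.cong refl) (auto simp: sum.If_cases comps_def dest: iscompD(3))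
    also have "\<dots> = (\<Sum>v\<in>N. if v \<in> W0 then 1 else 0)" by (rule sum_comps [OF finN, symmetric])
    also have "\<dots> = card (N \<inter> W0)" by (simp add: sum.If_cases)
    also have "N \<inter> W0 = W0" by (auto simp: W0_def)
    finally show ?thesis by (simp add: kap_def)
  qed
  show False
  proof (cases "QQ = {Q}")
    case False
    then obtain P where P: "P \<in> QQ" "P \<noteq> Q" using Q by blast
    have two: "dg R P a = 2" if "a \<in> W0" for a using nf(3) [OF that that P] .
    obtain a where a: "a \<in> W0" using W0_ne by blast
    have finP: "finite P" using QQ_facts P by blast
    show False using pair_cases [OF a P(1) two [OF a]]
    proof
      assume "\<exists>y\<in>P. eb R N (P - {y}) + 1 \<le> kap + card P"
      then obtain y where y: "y \<in> P" "eb R N (P - {y}) + 1 \<le> kap + card P" by blast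
      have "1 \<le> dg R (P - {y}) a" if "a \<in> W0" for a
      proof -
        have "dg R P a \<le> dg R (P - {y}) a + 1"
          using dg_insert [of "P - {y}" y R a] finP y(1) by (simp add: insert_absorb split: if_splits)
        then show ?thesis using two [OF that] by simp
      qed
      then have "(\<Sum>a\<in>W0. 1) \<le> (\<Sum>a\<in>W0. dg R (P - {y}) a)" by (rule sum_mono)
      also have "\<dots> \<le> eb R N (P - {y})"
        unfolding eb_def by (rule sum_mono2) (auto simp: W0_def)
      finally have "card W0 + 1 \<le> kap + 4" using y(2) card_Q_le [OF P(1)] by simp
      then show False using comps_W kap by simp
    next
      assume "\<exists>b. central P b"
      then obtain b where b: "central P b" by blast
      have "\<exists>K. iscomp N K \<and> b \<notin> K"
      proof (rule ccontr)
        assume no: "\<not> ?thesis"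
        have "comps N \<subseteq> {K}" if "iscomp N K" for K
          using no comp_eq [OF that] that unfolding comps_def by blast
        then have "card (comps N) \<le> card {K}" if "iscomp N K" for K using that by (intro card_mono) auto
        moreover have "comps N \<noteq> {}" using kap by (auto simp: kap_def)
        ultimately show False using kap by (auto simp: kap_def comps_def)
      qed
      then obtain K where K: "iscomp N K" "b \<notin> K" by blast
      \<comment> \<open>A component that avoids \<open>b\<close> survives its deletion, but its two
        leaves send four edges to \<open>P\<close>.\<close>
      have "iscomp (N - {b}) K" using K by (auto simp: iscomp_def)
      then have "eb R K P \<le> 2" using central_le_2 [OF P(1) b] by blast
      moreover have "(\<Sum>v\<in>K \<inter> W0. 2) \<le> (\<Sum>v\<in>K \<inter> W0. dg R P v)"
        by (rule sum_mono) (use two in simp)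
      moreover have "(\<Sum>v\<in>K \<inter> W0. dg R P v) \<le> eb R K P"
        unfolding eb_def by (rule sum_mono2) (use iscompD(3) [OF K(1)] in auto)
      ultimately show False using comp_leaves [OF W1 K(1)] by simp
    qed
  next
    case True
    have apex: "\<exists>w\<in>Q. 2 \<le> dg R K w" if K: "iscomp N K" for K
    proof -
      note K' = iscompD [OF K]
      have "K \<inter> W0 \<noteq> {}" using comp_leaves [OF W1 K] by auto
      then obtain a where a: "a \<in> K" "a \<in> W0" by blast
      then have aV: "a \<in> U" "deg a + 2 \<le> 2 * k" using W0_U nf(2) [OF a(2) a(2)] by auto
      obtain b where b: "b \<in> N" "R a b" using W1 [OF a(2)] dg_pos_iff [OF finN, of R a] by force
      have bK: "b \<in> K" using K'(5) [OF a(1) b] .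
      obtain P w where Pw: "P \<in> QQ" "w \<in> P" and w: "R w a" "R w b"
        using low_edge_apex [OF aV(1) NU [OF b(1)] b(2) aV(2)] .
      then have "w \<in> Q" using True by simp
      moreover have "a \<noteq> b" using b(2) irr by blast
      then have "2 \<le> dg R K w" using w a(1) bK dg_ge_2_iff [OF K'(3), of R w] by blast
      ultimately show ?thesis by blast
    qed
    \<comment> \<open>Different vertices of \<open>Q\<close>, each with two neighbours in another
      component, would close two disjoint cycles in \<open>U \<union> Q\<close>.\<close>
    have same: "w = w'" if h: "iscomp N K" "iscomp N K'" "K \<noteq> K'" "w \<in> Q" "w' \<in> Q" "2 \<le> dg R K w" "2 \<le> dg R K' w'"
      for w w' K K'
    proof (rule ccontr)
      assume ne: "w \<noteq> w'"
      have KU: "K \<subseteq> U" "K' \<subseteq> U" using iscompD(1) [OF h(1)] iscompD(1) [OF h(2)] N_sub by auto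
      have UQ: "U \<inter> Q = {}" using QQ_facts(5) [OF Q] .
      have d: "dense R (insert w K)" "dense R (insert w' K')"
        using h KU UQ iscompD(2) by (auto intro!: conn_dense_insert)
      have dj: "K \<inter> K' = {}" using comp_eq [OF h(1,2)] h(3) by blast
      show False
      proof (rule no_two_dense [OF Q _ _ d])
        show "insert w K \<inter> insert w' K' = {}" using dj ne h(4,5) KU UQ by blast
      qed (use KU h(4,5) in auto)
    qed
    obtain K0 where K0: "iscomp N K0" using comp_exists [OF finN] N_ne by blast
    obtain w where w: "w \<in> Q" "2 \<le> dg R K0 w" using apex [OF K0] by blast
    have all: "2 \<le> dg R K w" if K: "iscomp N K" for K
    proof (cases "K = K0")
      case False
      obtain w' where "w' \<in> Q" "2 \<le> dg R K w'" using apex [OF K] by blast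
      then show ?thesis using same [OF K K0 False _ w(1) _ w(2)] by blast
    qed (use w in simp)
    have "(\<Sum>K\<in>comps N. 2) \<le> (\<Sum>K\<in>comps N. dg R K w)"
      by (rule sum_mono) (use all in \<open>simp add: comps_def\<close>)
    also have "\<dots> = dg R N w" by (rule sum_comps_dg [OF finN])
    finally show False using small [OF w(1)] kap by (simp add: kap_def)
  qed
qed

section \<open>One centre for all cycles\<close>

lemma kap_pos: "1 \<le> kap"
proof -
  obtain K where "iscomp N K" using comp_exists [OF finN] N_ne by blast
  then have "comps N \<noteq> {}" by (auto simp: comps_def)
  then show ?thesis by (simp add: kap_def Suc_le_eq card_gt_0_iff)
qed

lemma sum_remove_bound2:
  "\<lbrakk>Q \<in> QQ; P \<in> QQ; P \<noteq> Q\<rbrakk> \<Longrightarrow>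
    (\<Sum>P\<in>QQ. int (eb R N P)) \<le> int (eb R N Q) + int (eb R N P) + (int t - 2) * (2 * int u + 2)"
  using sum_remove_bound [of "{Q, P}"] by simp

lemma kdec: "int k = int t + 1" "2 \<le> int k"
  using k_t k2 by simp_all

text \<open>Measured against \<open>2u\<close> edges per cycle, \<open>exact_bound\<close> leaves
  the whole family a deficit of \<open>2u\<close> up to small terms. Each of these cycles is short
  by nearly \<open>u\<close>; together they exhaust the deficit, the terms in \<open>kap\<close>
  cancel, and \<open>OmN\<close> is at most \<open>2t + 2\<close>.\<close>

lemma no_two_spread:
  assumes "Q \<in> QQ" "P \<in> QQ" "P \<noteq> Q" "y \<in> Q" "x \<in> P"
    "eb R N (Q - {y}) + 1 \<le> kap + card Q" "eb R N (P - {x}) + 1 \<le> kap + card P"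
  shows False
proof -
  have le: "eb R N X \<le> u + kap + 3" if "X \<in> QQ" "v \<in> X" "eb R N (X - {v}) + 1 \<le> kap + card X" for X v
    using eb_remove [OF that(1,2) finN] dg_le_card [OF finN, of R v] card_Q_le [OF that(1)] that(3)
    by (simp add: u_def)
  have "int (eb R N Q) + int (eb R N P) \<le> 2 * (int u + int kap + 3)"
    using le [OF assms(1,4,6)] le [OF assms(2,5,7)] by simp
  then have "2 * (int t - 1) * int u + OmN + 2 * int kap \<le>
      2 * (int u + int kap + 3) + (int t - 2) * (2 * int u + 2)"
    using exact_bound sum_remove_bound2 [OF assms(1-3)] by linarith
  then have "OmN \<le> 2 * int t + 2" by (simp add: algebra_simps)
  then show False using OmN_ge kdec by linarith
qed

lemma comps_b: "b \<in> N \<Longrightarrow> card (comps (N - {b})) + 1 = kap + dg R N b"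
  unfolding kap_def by (rule comps_remove [OF finN N_forest])

text \<open>A cycle with centre \<open>a\<close> receives at most two edges from each component of
  \<open>N - {a}\<close>, so its edge count is governed by the degree of \<open>a\<close> in
  \<open>N\<close>. Two vertices of a forest cannot both have degree close to
  \<open>u\<close>.\<close>

lemma central_unique:
  assumes "Q \<in> QQ" "P \<in> QQ" "P \<noteq> Q" "central Q b" "central P c"
  shows "b = c"
proof (rule ccontr)
  assume ne: "b \<noteq> c"
  have bc: "b \<in> N" "c \<in> N" using assms by (auto simp: central_def)
  have le: "eb R N X \<le> 2 * kap + 2 * dg R N a + 2" if X: "X \<in> QQ" "central X a" for X a
  proof -
    have a: "a \<in> N" using X by (simp add: central_def)
    have fin: "finite X" using QQ_facts X by blast
    have "eb R N X = dg R X a + eb R (N - {a}) X"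
      unfolding eb_def by (rule sum.remove [OF finN a])
    also have "eb R (N - {a}) X = (\<Sum>K\<in>comps (N - {a}). eb R K X)"
      by (rule sum_comps_eb [symmetric]) simp
    also have "\<dots> \<le> (\<Sum>K\<in>comps (N - {a}). 2)"
      by (rule sum_mono) (use central_le_2 [OF X] in \<open>simp add: comps_def\<close>)
    also have "dg R X a \<le> 4" using dg_le_card [OF fin, of R a] card_Q_le [OF X(1)] by simp
    finally show ?thesis using comps_b [OF a] by simp
  qed
  have "dg R N b + dg R N c + kap \<le> u + 1"
  proof -
    have "eb R N N = eb R (N - {b}) (N - {b}) + 2 * dg R N b" by (rule ds_remove [OF finN bc(1)])
    moreover have "eb R (N - {b}) (N - {b}) = eb R (N - {b} - {c}) (N - {b} - {c}) + 2 * dg R (N - {b}) c"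
      by (rule ds_remove) (use bc ne in auto)
    moreover have "dg R N c \<le> dg R (N - {b}) c + 1"
      using dg_insert [of "N - {b}" b R c] bc(1) by (simp add: insert_absorb split: if_splits)
    ultimately show ?thesis using N_eb by linarith
  qed
  then have "int (eb R N Q) + int (eb R N P) \<le> 2 * int u + 2 * int kap + 6"
    using le [OF assms(1,4)] le [OF assms(2,5)] by linarith
  then have "2 * (int t - 1) * int u + OmN + 2 * int kap \<le>
      2 * int u + 2 * int kap + 6 + (int t - 2) * (2 * int u + 2)"
    using exact_bound sum_remove_bound2 [OF assms(1-3)] by linarith
  then have "OmN \<le> 2 * int t + 2" by (simp add: algebra_simps)
  then show False using OmN_ge kdec by linarith
qed

text \<open>A degree sum over the tree \<open>K\<close>, each degree being at least
  \<open>2t + om\<close>; edges leaving \<open>K\<close> go to \<open>b\<close> or to the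
  family.\<close>

lemma comp_om:
  assumes b: "b \<in> N" and K: "iscomp (N - {b}) K"
  shows "2 * int t * int (card K) + (\<Sum>a\<in>K. om k (deg a)) \<le>
    2 * int (card K) - 2 + int (dg R K b) + (\<Sum>Q\<in>QQ. int (eb R K Q))"
proof -
  note K' = iscompD [OF K]
  have KN: "K \<subseteq> N" using K'(1) by blast
  have "(\<Sum>a\<in>K. int (deg a)) = int (eb R K N) + (\<Sum>Q\<in>QQ. int (eb R K Q))"
  proof -
    have "(\<Sum>a\<in>K. int (deg a)) = (\<Sum>a\<in>K. int (dg R N a) + (\<Sum>Q\<in>QQ. int (dg R Q a)))"
      by (rule sum.cong) (use KN deg_N in auto)
    also have "\<dots> = int (eb R K N) + (\<Sum>Q\<in>QQ. int (eb R K Q))"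
      by (simp add: eb_def sum.distrib) (rule sum.swap)
    finally show ?thesis .
  qed
  moreover have "eb R K N = eb R K K + dg R K b"
  proof -
    have "eb R K N = eb R K (N - {b}) + eb R K {b}" using eb_Diff_right [OF finN, of "{b}" R K] b by simp
    also have "eb R K (N - {b}) = eb R K K"
      unfolding eb_def by (rule sum.cong) (use dg_comp [OF K] in auto)
    also have "eb R K {b} = dg R K b" by (rule eb_singleton_right [OF K'(3)])
    finally show ?thesis .
  qed
  moreover have "eb R K K + 2 = 2 * card K" by (rule tree_eb [OF K'(2) N_forest [OF KN]])
  ultimately show ?thesis using sum_deg [OF KN] by linarith
qed

lemma OmN_comps: "b \<in> N \<Longrightarrow> OmN = om k (deg b) + (\<Sum>K\<in>comps (N - {b}). \<Sum>a\<in>K. om k (deg a))"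
  unfolding OmN_def using sum.remove [OF finN, of b "\<lambda>a. om k (deg a)"]
    sum_comps [of "N - {b}" "\<lambda>a. om k (deg a)"] by simp

text \<open>A component sends at most \<open>card K\<close> edges to \<open>y\<close> and two to
  each other cycle. In the sum over all components, \<open>dg R N b\<close> and \<open>kap\<close>
  cancel against the number of components, which leaves \<open>OmN \<le> 6\<close>.\<close>

lemma no_one_spread:
  assumes Q: "Q \<in> QQ" "y \<in> Q" "eb R N (Q - {y}) + 1 \<le> kap + card Q" and t: "2 \<le> t"
    and b: "b \<in> N" and C: "\<And>P. P \<in> QQ \<Longrightarrow> P \<noteq> Q \<Longrightarrow> central P b"
  shows False
proof -
  let ?C = "comps (N - {b})"
  have le: "(\<Sum>a\<in>K. om k (deg a)) \<le> int (dg R K b) + int (eb R K (Q - {y})) - 1" if "K \<in> ?C" for K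
  proof -
    have K: "iscomp (N - {b}) K" using that by (simp add: comps_def)
    have fin: "finite K" and pos: "1 \<le> card K"
      using iscompD(3,4) [OF K] by (auto simp: Suc_le_eq card_gt_0_iff)
    have tQ: "t = Suc (card (QQ - {Q}))" unfolding t_def by (rule card.remove [OF finQQ Q(1)])
    have "(\<Sum>P\<in>QQ - {Q}. int (eb R K P)) \<le> (\<Sum>P\<in>QQ - {Q}. 2)"
      by (rule sum_mono) (use central_le_2 [OF _ C K] in auto)
    then have "(\<Sum>P\<in>QQ. int (eb R K P)) \<le> int (eb R K Q) + 2 * int t - 2"
      using sum.remove [OF finQQ Q(1), of "\<lambda>P. int (eb R K P)"] tQ by simp
    moreover have "eb R K Q \<le> eb R K (Q - {y}) + card K"
      using eb_remove [OF Q(1,2) fin] dg_le_card [OF fin, of R y] by simp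
    moreover have "0 \<le> (2 * int t - 3) * (int (card K) - 1)"
      using t pos by (intro mult_nonneg_nonneg) auto
    then have "3 * int (card K) + 2 * int t - 3 \<le> 2 * int t * int (card K)" by (simp add: algebra_simps)
    ultimately show ?thesis using comp_om [OF b K] by linarith
  qed
  have "(\<Sum>K\<in>?C. \<Sum>a\<in>K. om k (deg a)) \<le> (\<Sum>K\<in>?C. int (dg R K b) + int (eb R K (Q - {y})) - 1)"
    by (rule sum_mono) (rule le)
  also have "\<dots> = int (dg R (N - {b}) b) + int (eb R (N - {b}) (Q - {y})) - int (card ?C)"
    using sum_comps_dg [of "N - {b}" b] sum_comps_eb [of "N - {b}" "Q - {y}"]
    by (simp add: sum.distrib sum_subtractf flip: of_nat_sum)
  finally have s: "(\<Sum>K\<in>?C. \<Sum>a\<in>K. om k (deg a)) \<le>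
      int (dg R (N - {b}) b) + int (eb R (N - {b}) (Q - {y})) - int (card ?C)" .
  have "dg R (N - {b}) b \<le> dg R N b" by (rule dg_mono) auto
  moreover have "eb R (N - {b}) (Q - {y}) \<le> eb R N (Q - {y})"
    by (rule eb_mono) (use QQ_facts(4) [OF Q(1)] in auto)
  moreover have "om k (deg b) \<le> 2" by (simp add: om_def)
  moreover have "card Q \<le> 4" by (rule card_Q_le [OF Q(1)])
  ultimately have "OmN \<le> 6" using OmN_comps [OF b] s comps_b [OF b] Q(3) by linarith
  then show False using OmN_ge kdec by linarith
qed

lemma single_bound:
  assumes "QQ = {Q}" shows "int u + DU + 2 * int kap \<le> int (eb R N Q)" "k = 2" "4 - (\<Sum>v\<in>Q. ff k (deg v)) \<le> DU"
proof -
  have "card QQ = 1" using assms by simp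
  then have t1: "t = 1" by (simp add: t_def)
  show k: "k = 2" using t1 k_t by simp
  show "int u + DU + 2 * int kap \<le> int (eb R N Q)"
    using exact_bound OmN_U OmU_eq t1 assms by simp
  show "4 - (\<Sum>v\<in>Q. ff k (deg v)) \<le> DU"
  proof -
    have q: "(\<Sum>P\<in>QQ. g P) = g Q" for g :: "'a set \<Rightarrow> int" using assms by simp
    have "(\<Sum>v\<in>V. ff k (deg v)) = DU + (\<Sum>v\<in>Q. ff k (deg v))"
      unfolding DU_def q [of "\<lambda>Q. \<Sum>v\<in>Q. ff k (deg v)", symmetric] by (rule sum_split)
    moreover have "2 * int k \<le> (\<Sum>v\<in>V. ff k (deg v))" using rich by (simp add: rich_def)
    moreover have "int k = 2" using k by simp
    ultimately show ?thesis by linarith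
  qed
qed

text \<open>Here \<open>k = 2\<close> and the count is tight: the missing units come from a better
  bound for \<open>DU\<close>, obtained from \<open>ff\<close> on the vertices of \<open>Q\<close>
  or from \<open>Q\<close> being a triangle.\<close>

lemma single_central:
  assumes QQ: "QQ = {Q}" shows "\<exists>b. central Q b"
proof (rule ccontr)
  assume neg: "\<not> ?thesis"
  have Q: "Q \<in> QQ" using QQ by simp
  have fin: "finite Q" using QQ_facts Q by blast
  note sb = single_bound [OF QQ]
  have u: "2 \<le> u" using u_ge by simp
  show False
  proof (cases "\<exists>a\<in>W0. dg R Q a = 2")
    case True
    then obtain a where a: "a \<in> W0" "dg R Q a = 2" by blast
    then obtain y where y: "y \<in> Q" "eb R N (Q - {y}) + 1 \<le> kap + card Q"
      using pair_cases [OF a(1) Q a(2)] neg by blast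
    have "ff k (deg x) \<le> (if R a x then 1 else 0)" if x: "x \<in> Q" for x
    proof (cases "R a x")
      case False
      have "deg x = dg R U x + dg R Q x" using deg_split [of x] QQ by simp
      then have "deg x \<le> 3"
        using pair_le [OF a(1) Q a(2) x False] mind_dg [OF mind_Q [OF Q] x] by simp
      then show ?thesis using sb(2) False by (simp add: ff_def)
    qed (simp add: ff_def)
    then have "(\<Sum>v\<in>Q. ff k (deg v)) \<le> (\<Sum>v\<in>Q. if R a v then 1 else 0)" by (rule sum_mono)
    also have "\<dots> = int (dg R Q a)" using fin by (simp add: sum.If_cases dg_def Int_def)
    finally have DU: "2 \<le> DU" using sb(3) a(2) by simp
    have e: "eb R N Q = eb R N (Q - {y}) + dg R N y" by (rule eb_remove [OF Q y(1) finN])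
    have dy: "dg R N y \<le> u" unfolding u_def by (rule dg_le_card) simp
    \<comment> \<open>All estimates are forced to be equalities: \<open>N\<close> is a tree,
      \<open>Q\<close> a quadrilateral, and \<open>y\<close> is joined to all of \<open>N\<close>.
      Then any edge of \<open>N\<close> forms a triangle with \<open>y\<close>, which is
      incompatible with the length of \<open>Q\<close>.\<close>
    have "int kap \<le> 1 \<and> dg R N y = u \<and> card Q = 4"
      using sb(1) DU e dy y(2) card_Q_le [OF Q] kap_pos by linarith
    then have k1: "kap = 1" "dg R N y = u" "card Q = 4" using kap_pos by auto
    have "{v \<in> N. R y v} = N" using k1(2) by (intro card_subset_eq) (auto simp: dg_def u_def)
    then have adj: "R v y" if "v \<in> N" for v using that sym by blast
    have "0 < eb R N N" using N_eb k1(1) u by simp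
    then obtain v where v: "v \<in> N" "0 < dg R N v" unfolding eb_def by (metis sum.neutral less_irrefl gr0I)
    then obtain w where w: "w \<in> N" "R v w" using dg_pos_iff [OF finN, of R v] by blast
    have "card Q = 3"
      using triangle_exchange(1) [OF Q y(1) NU [OF v(1)] w(1,2) adj [OF v(1)] adj [OF w(1)]] .
    then show False using k1 by simp
  next
    case False
    then have np: "dg R Q a \<noteq> 2" if "a \<in> W0" for a using that by blast
    then obtain y where y: "y \<in> Q" "eb R N (Q - {y}) \<le> kap + 1"
      using nopair_cases [OF Q] neg by blast
    obtain a where a: "a \<in> W0" using W0_ne by blast
    note nf = W0_nonfull [OF a Q np [OF a]]
    obtain b where b: "b \<in> N" "R a b" using nf(1) dg_pos_iff [OF finN, of R a] by force
    have "deg a + 2 \<le> 2 * k" using nf(2) by simp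
    then obtain P w where Pw: "P \<in> QQ" "w \<in> P" and w: "R w a" "R w b"
      by (rule low_edge_apex [OF W0_U [OF a] NU [OF b(1)] b(2)])
    then have "w \<in> Q" using QQ by simp
    \<comment> \<open>The leaf has degree \<open>2k - 2\<close>, so its edge has an apex on
      \<open>Q\<close>. That \<open>Q\<close> is then a triangle improves \<open>DU\<close> by the
      one unit needed.\<close>
    then have "card Q = 3" using triangle_exchange(1) [OF Q _ W0_U [OF a] b] w sym by blast
    then have "{P \<in> QQ. card P = 3} = {Q}" using QQ by auto
    then have "card {P \<in> QQ. card P = 3} = 1" by simp
    then have "q3 = 1" by (simp add: q3_def)
    moreover have "t = 1" using k_t sb(2) by simp
    ultimately have "1 \<le> DU" using DU_ge sb(2) by simp
    moreover have "eb R N Q = eb R N (Q - {y}) + dg R N y" by (rule eb_remove [OF Q y(1) finN])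
    moreover have "dg R N y \<le> u" unfolding u_def by (rule dg_le_card) simp
    ultimately show False using sb(1) y(2) kap_pos by linarith
  qed
qed

text \<open>For \<open>t \<ge> 2\<close>, at most one cycle can have nearly all its edges at one
  vertex; the others then share a centre, and \<open>no_one_spread\<close> refutes the
  exception.\<close>

lemma all_central: obtains b where "\<And>Q. Q \<in> QQ \<Longrightarrow> central Q b"
proof (cases "t = 1")
  case True
  then obtain Q where Q: "QQ = {Q}" unfolding t_def by (metis card_1_singletonE)
  then show ?thesis using single_central [OF Q] that by blast
next
  case False
  then have t2: "2 \<le> t" using t_pos by simp
  let ?W = "\<lambda>Q. \<exists>y\<in>Q. eb R N (Q - {y}) + 1 \<le> kap + card Q"
  have WC: "?W Q \<or> (\<exists>b. central Q b)" if Q: "Q \<in> QQ" for Q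
  proof (cases "\<exists>a\<in>W0. dg R Q a = 2")
    case True
    then show ?thesis using pair_cases Q by blast
  next
    case False
    then consider "\<exists>y\<in>Q. eb R N (Q - {y}) \<le> kap + 1" | "\<exists>b. central Q b" using nopair_cases [OF Q] by blast
    then show ?thesis
    proof cases
      case 1
      then obtain y where "y \<in> Q" "eb R N (Q - {y}) + 1 \<le> kap + card Q" using card_Q [OF Q] by fastforce
      then show ?thesis by blast
    qed blast
  qed
  have other: "\<exists>P\<in>QQ. P \<noteq> Q" for Q
  proof (rule ccontr)
    assume "\<not> ?thesis"
    then have "QQ \<subseteq> {Q}" by blast
    then have "card QQ \<le> card {Q}" by (intro card_mono) auto
    then show False using t2 by (simp add: t_def)
  qed
  show ?thesis
  proof (cases "\<exists>Q\<in>QQ. ?W Q")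
    case True
    then obtain Q y where Q: "Q \<in> QQ" "y \<in> Q" "eb R N (Q - {y}) + 1 \<le> kap + card Q" by blast
    have C: "\<exists>b. central P b" if P: "P \<in> QQ" "P \<noteq> Q" for P
      using WC [OF P(1)] no_two_spread [OF Q(1) P Q(2) _ Q(3)] by blast
    obtain P where P: "P \<in> QQ" "P \<noteq> Q" using other by blast
    then obtain b where b: "central P b" using C by blast
    have "central X b" if X: "X \<in> QQ" "X \<noteq> Q" for X
    proof (cases "X = P")
      case False
      then show ?thesis using C [OF X] central_unique [OF P(1) X(1) False b] by blast
    qed (use b in simp)
    then have False using no_one_spread [OF Q t2, of b] b by (simp add: central_def)
    then show ?thesis ..
  next
    case False
    then have C: "\<exists>b. central P b" if "P \<in> QQ" for P using WC that by blast
    obtain P where P: "P \<in> QQ" using other by blast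
    then obtain b where b: "central P b" using C by blast
    have "central X b" if X: "X \<in> QQ" for X
    proof (cases "X = P")
      case False
      then show ?thesis using C [OF X] central_unique [OF P X False b] by blast
    qed (use b in simp)
    then show ?thesis using that by blast
  qed
qed

end

section \<open>The final configuration\<close>

lemma (in rel) complete_bipartite_packs:
  assumes "finite A" "finite B" "A \<inter> B = {}" "\<And>a p. a \<in> A \<Longrightarrow> p \<in> B \<Longrightarrow> R a p" "card A = 2 * m" "2 * m \<le> card B"
  shows "packs R (A \<union> B) m"
  using assms
proof (induction m arbitrary: A B)
  case (Suc m A B)
  obtain C where "C \<subseteq> A" "card C = 2" using Suc.prems(5) obtain_subset_with_card_n [of 2 A] by auto
  then obtain a c where ac: "a \<in> A" "c \<in> A" "a \<noteq> c" by (auto simp: card_2_iff)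
  obtain D where "D \<subseteq> B" "card D = 2" using Suc.prems(6) obtain_subset_with_card_n [of 2 B] by auto
  then obtain p q where pq: "p \<in> B" "q \<in> B" "p \<noteq> q" by (auto simp: card_2_iff)
  let ?X = "{a, p, c, q}"
  have "dense R ?X" using quadrilateral_dense [of a p q c] Suc.prems(4) ac pq by simp
  moreover have "packs R ((A - {a, c}) \<union> (B - {p, q})) m"
  proof (rule Suc.IH)
    show "card (A - {a, c}) = 2 * m" using Suc.prems(1,5) ac by (simp add: card_Diff_subset)
    show "2 * m \<le> card (B - {p, q})" using Suc.prems(2,6) pq by (simp add: card_Diff_subset)
  qed (use Suc.prems in auto)
  moreover have "((A - {a, c}) \<union> (B - {p, q})) \<inter> ?X = {}" using ac pq Suc.prems(3) by auto
  ultimately have "packs R ((A - {a, c}) \<union> (B - {p, q}) \<union> ?X) (Suc m)" using packs_Suc_Un by blast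
  moreover have "(A - {a, c}) \<union> (B - {p, q}) \<union> ?X = A \<union> B" using ac pq by auto
  ultimately show ?case by simp
qed simp

context system
begin

text \<open>The upper bounds in \<open>comp_om\<close> exceed what weight 0 requires by a single
  unit. Positive weight forces equality everywhere, in particular
  \<open>(2t - 2)(card K - 1) = 0\<close>.\<close>

lemma good_component:
  assumes C: "\<forall>Q\<in>QQ. central Q b" and b: "b \<in> N" and K: "iscomp (N - {b}) K"
    and om: "1 \<le> (\<Sum>a\<in>K. om k (deg a))"
  shows "dg R K b = 1" "\<And>Q. Q \<in> QQ \<Longrightarrow> eb R K Q = 2" "t = 1 \<or> card K = 1"
proof -
  note K' = iscompD [OF K]
  have le2: "eb R K Q \<le> 2" if "Q \<in> QQ" for Q using central_le_2 [OF that bspec [OF C that] K] .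
  have le: "(\<Sum>Q\<in>QQ. int (eb R K Q)) \<le> 2 * int t"
    using sum_bounded_above [of QQ "\<lambda>Q. int (eb R K Q)" 2] le2 by (simp add: t_def)
  have d1: "dg R K b \<le> 1"
  proof (rule forest_dg [OF K'(2)])
    show "\<not> dense R (insert b K)" using N_forest [of "insert b K"] b K'(1) by blast
  qed (use K'(1) in blast)
  have pos: "1 \<le> card K" using K'(3,4) by (simp add: Suc_le_eq card_gt_0_iff)
  have main: "2 * int t * int (card K) + 1 \<le> 2 * int (card K) - 2 + int (dg R K b) + (\<Sum>Q\<in>QQ. int (eb R K Q))"
    using comp_om [OF b K] om by linarith
  have "0 \<le> (2 * int t - 2) * (int (card K) - 1)" using t_pos pos by (intro mult_nonneg_nonneg) auto
  then have nn: "2 * int (card K) + 2 * int t - 2 \<le> 2 * int t * int (card K)" by (simp add: algebra_simps)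
  then have eq: "int (dg R K b) = 1" "(\<Sum>Q\<in>QQ. int (eb R K Q)) = 2 * int t"
    using main le d1 by linarith+
  then show "dg R K b = 1" by simp
  show "t = 1 \<or> card K = 1"
  proof -
    have "2 * int t * int (card K) \<le> 2 * int (card K) + 2 * int t - 2" using main eq by linarith
    then have "(2 * int t - 2) * (int (card K) - 1) = 0" using nn by (simp add: algebra_simps)
    then show ?thesis by auto
  qed
  fix Q assume Q: "Q \<in> QQ"
  have "(\<Sum>Q\<in>QQ. eb R K Q) = 2 * t" using eq(2) by (simp flip: of_nat_sum)
  then show "eb R K Q = 2" using sum_tight [of QQ "eb R K" 2 Q] le2 Q by (simp add: t_def)
qed

text \<open>For \<open>t = 1\<close>, take a leaf \<open>l\<close> of \<open>K\<close> not joined to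
  \<open>b\<close>. If it has both edges from \<open>K\<close> to \<open>Q\<close>, another leaf
  \<open>m\<close> has none, though its low edge to \<open>b\<close> needs an apex on
  \<open>Q\<close>. If it has fewer, \<open>l\<close> is low, and the apex of its edge has two
  neighbours in \<open>K\<close>, against the split form of \<open>central\<close>.\<close>

lemma good_singleton:
  assumes C: "\<forall>Q\<in>QQ. central Q b" and b: "b \<in> N" and K: "iscomp (N - {b}) K"
    and om: "1 \<le> (\<Sum>a\<in>K. om k (deg a))"
  shows "card K = 1"
proof (rule ccontr)
  assume neg: "card K \<noteq> 1"
  note good = good_component [OF C b K om]
  note K' = iscompD [OF K]
  have KN: "K \<subseteq> N" using K'(1) by blast
  have t1: "t = 1" using good(3) neg by simp
  obtain Q where QQ: "QQ = {Q}" using t1 unfolding t_def by (metis card_1_singletonE)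
  have Q: "Q \<in> QQ" using QQ by simp
  have fin: "finite Q" using QQ_facts Q by blast
  have card2: "2 \<le> card K" using neg K'(3,4) by (metis One_nat_def Suc_leI card_gt_0_iff le_neq_implies_less numeral_2_eq_2)
  have ge1: "1 \<le> dg R K v" if v: "v \<in> K" for v
  proof -
    have "{v} \<subset> K"
    proof
      show "{v} \<noteq> K" using neg by auto
    qed (use v in simp)
    then obtain w where "w \<in> K" "R v w" using connD [OF K'(2), of "{v}"] by blast
    then show ?thesis using dg_pos_iff [OF K'(3), of R v] by (auto simp: Suc_le_eq)
  qed
  let ?A = "{v \<in> K. dg R K v = 1}"
  have "(\<Sum>v\<in>K. 2) \<le> (\<Sum>v\<in>K. dg R K v + (if dg R K v = 1 then 1 else 0))"
  proof (rule sum_mono)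
    fix v assume "v \<in> K"
    then show "2 \<le> dg R K v + (if dg R K v = 1 then 1 else 0)" using ge1 [of v] by auto
  qed
  then have "2 * card K \<le> eb R K K + card ?A"
    using K'(3) by (simp add: sum.distrib eb_def sum.If_cases Int_def)
  then have "2 \<le> card ?A" using tree_eb [OF K'(2) N_forest [OF KN]] by simp
  then obtain B where "B \<subseteq> ?A" "card B = 2" by (metis obtain_subset_with_card_n)
  then obtain l0 l1 where l01: "l0 \<in> ?A" "l1 \<in> ?A" "l0 \<noteq> l1" by (auto simp: card_2_iff)
  have notboth: "\<not> R b l0 \<or> \<not> R b l1"
  proof (rule ccontr)
    assume "\<not> ?thesis"
    then have "2 \<le> dg R K b" using l01 by (subst dg_ge_2_iff [OF K'(3)]) auto
    then show False using good(1) by simp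
  qed
  obtain l m where l: "l \<in> K" "dg R K l = 1" "\<not> R b l" and m: "m \<in> K" "dg R K m = 1" "m \<noteq> l"
    using l01 notboth by blast
  have dgN: "dg R N v = dg R K v + (if R b v then 1 else 0)" if v: "v \<in> K" for v
  proof -
    have "dg R N v = dg R (N - {b}) v + (if R v b then 1 else 0)"
      using dg_insert [of "N - {b}" b R v] b by (simp add: insert_absorb)
    then show ?thesis using dg_comp [OF K v] sym_iff [of v b] by simp
  qed
  have degv: "deg v = dg R N v + dg R Q v" if "v \<in> N" for v using deg_N [OF that] QQ by simp
  have k2': "k = 2" using t1 k_t by simp
  have lW: "l \<in> W0" using l KN dgN [OF l(1)] by (auto simp: W0_def)
  show False
  proof (cases "dg R Q l = 2")
    case True
    have "dg R Q l + dg R Q m \<le> eb R K Q"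
      using sum_mono2 [of K "{l, m}" "dg R Q"] l m K'(3) by (auto simp: eb_def)
    then have m0: "dg R Q m = 0" using True good(2) [OF Q] by simp
    have mN: "m \<in> N" using m KN by blast
    have "2 \<le> deg m" using min_deg NV [OF mN] by blast
    then have bm: "R b m" "deg m + 2 \<le> 2 * k"
      using degv [OF mN] dgN [OF m(1)] m m0 k2' by (auto split: if_splits)
    obtain P w where Pw: "P \<in> QQ" "w \<in> P" and w: "R w m" "R w b"
      using low_edge_apex [OF NU [OF mN] NU [OF b] sym [OF bm(1)] bm(2)] .
    then have "w \<in> Q" using QQ by simp
    then have "0 < dg R Q m" using w(1) sym fin by (auto simp: dg_pos_iff)
    then show False using m0 by simp
  next
    case False
    note nf = W0_nonfull [OF lW Q False]
    obtain n where n: "n \<in> K" "R l n" using l(2) dg_pos_iff [OF K'(3), of R l] by auto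
    have ln: "l \<in> N" "n \<in> N" using l n KN by auto
    have "deg l + 2 \<le> 2 * k" using nf(2) by simp
    then obtain P w where Pw: "P \<in> QQ" "w \<in> P" and w: "R w l" "R w n"
      by (rule low_edge_apex [OF NU [OF ln(1)] NU [OF ln(2)] n(2)])
    then have wQ: "w \<in> Q" using QQ by simp
    have "l \<noteq> n" using n(2) irr by blast
    then have two: "2 \<le> dg R K w" using w l(1) n(1) dg_ge_2_iff [OF K'(3), of R w] by blast
    obtain y where y: "y \<in> Q" "dg R K y \<le> 1" "eb R K (Q - {y}) \<le> 1"
      using bspec [OF C Q] K unfolding central_def by blast
    have "w \<noteq> y" using two y(2) by auto
    then have "dg R K w \<le> eb R (Q - {y}) K"
      unfolding eb_def using wQ fin by (intro member_le_sum) auto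
    also have "\<dots> = eb R K (Q - {y})" using fin K'(3) by (intro dg_swap) auto
    finally show False using two y(3) by simp
  qed
qed

text \<open>Components of positive weight are single vertices of weight 1 and the others add
  nothing, so there are at least \<open>OmN - 2\<close> of them, where 2 bounds the weight of
  \<open>b\<close>.\<close>

lemma pendant_set:
  obtains b P where "b \<in> N" "P \<subseteq> N" "9 * k + 12 \<le> 2 * card P"
    "\<And>p. p \<in> P \<Longrightarrow> R p b \<and> dg R N p = 1 \<and> (\<forall>Q\<in>QQ. dg R Q p = 2)"
proof -
  obtain b where "\<And>Q. Q \<in> QQ \<Longrightarrow> central Q b" using all_central by blast
  then have C: "\<forall>Q\<in>QQ. central Q b" by simp
  have "QQ \<noteq> {}" using t_pos by (auto simp: t_def)
  then have b: "b \<in> N" using C by (auto simp: central_def)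
  let ?C = "comps (N - {b})"
  let ?o = "\<lambda>K. \<Sum>a\<in>K. om k (deg a)"
  define G where "G = {K \<in> ?C. 1 \<le> ?o K}"
  have finC: "finite ?C" by simp
  have single: "\<exists>p. K = {p}" if "K \<in> G" for K
    using good_singleton [OF C b, of K] that card_1_singletonE unfolding G_def comps_def by blast
  have le: "?o K \<le> (if K \<in> G then 1 else 0)" if K: "K \<in> ?C" for K
  proof (cases "K \<in> G")
    case True
    obtain p where p: "K = {p}" using single [OF True] by blast
    have K1: "iscomp (N - {b}) K" "1 \<le> ?o K" using True by (auto simp: G_def comps_def)
    have "dg R K b = 1" using good_component(1) [OF C b K1] .
    moreover have "(\<Sum>Q\<in>QQ. int (eb R K Q)) = 2 * int t"
      using good_component(2) [OF C b K1] by (simp add: t_def)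
    ultimately show ?thesis using comp_om [OF b K1(1)] p True by simp
  next
    case False then show ?thesis using K by (simp add: G_def)
  qed
  have "(\<Sum>K\<in>?C. ?o K) \<le> (\<Sum>K\<in>?C. if K \<in> G then 1 else 0)" by (rule sum_mono) (rule le)
  also have "\<dots> = int (card G)"
  proof -
    have "?C \<inter> {K. K \<in> G} = G" by (auto simp: G_def)
    then show ?thesis using finC by (simp add: sum.If_cases)
  qed
  finally have "OmN \<le> 2 + int (card G)" using OmN_comps [OF b] by (auto simp: om_def)
  then have G: "9 * k + 12 \<le> 2 * card G" using OmN_ge by linarith
  define P where "P = {p. {p} \<in> G}"
  have PN: "P \<subseteq> N - {b}" by (auto simp: P_def G_def comps_def iscomp_def)
  have "finite P" using finite_subset [OF PN] by simp
  moreover have "G \<subseteq> (\<lambda>p. {p}) ` P" using single by (auto simp: P_def)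
  ultimately have "card G \<le> card P" by (meson surj_card_le)
  then have "9 * k + 12 \<le> 2 * card P" using G by simp
  moreover have "R p b \<and> dg R N p = 1 \<and> (\<forall>Q\<in>QQ. dg R Q p = 2)" if "p \<in> P" for p
  proof -
    have K: "iscomp (N - {b}) {p}" "1 \<le> ?o {p}" using that by (auto simp: P_def G_def comps_def)
    have "dg R {p} b = 1" using good_component(1) [OF C b K] .
    then have pb: "R p b" using sym by (simp add: dg_singleton split: if_splits)
    have "dg R (N - {b}) p = dg R {p} p" using dg_comp [OF K(1)] by simp
    then have "dg R (N - {b}) p = 0" by (simp add: dg_singleton irr)
    then have "dg R N p = 1"
      using dg_insert [of "N - {b}" b R p] b pb by (simp add: insert_absorb)
    moreover have "dg R Q p = 2" if "Q \<in> QQ" for Q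
      using good_component(2) [OF C b K that] by (simp add: eb_singleton)
    ultimately show ?thesis using pb by blast
  qed
  ultimately show ?thesis using that [of b P] b PN by blast
qed

text \<open>Outside \<open>S\<close> and \<open>P\<close> some tree \<open>T\<close> has positive
  \<open>ff\<close>, but each vertex of \<open>S\<close> sends at most one edge into it: too few for
  the degrees that positive \<open>ff\<close> demands.\<close>

lemma contradiction: False
proof -
  obtain b P0 where b: "b \<in> N" and P0: "P0 \<subseteq> N" "9 * k + 12 \<le> 2 * card P0"
    "\<And>p. p \<in> P0 \<Longrightarrow> R p b \<and> dg R N p = 1 \<and> (\<forall>Q\<in>QQ. dg R Q p = 2)" using pendant_set by blast
  have degP: "deg p + 1 = 2 * k" if "p \<in> P0" for p
  proof -
    have "(\<Sum>Q\<in>QQ. dg R Q p) = 2 * t" using P0(3) [OF that] by (simp add: t_def)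
    then show ?thesis using deg_N [of p] P0(1) P0(3) [OF that] that k_t by (simp add: subset_iff)
  qed
  have "P0 \<noteq> {}" using P0(2) by auto
  then obtain p0 where p0: "p0 \<in> P0" by blast
  define S where "S = {q \<in> V. R p0 q}"
  define P where "P = {p \<in> P0. \<forall>q\<in>S. R p q}"
  have finS: "finite S" and finP: "finite P" and SV: "S \<subseteq> V"
    using finite_subset [OF P0(1)] by (auto simp: S_def P_def)
  have cardS: "card S + 1 = 2 * k" using degP [OF p0] by (simp add: S_def dg_def)
  have bS: "b \<in> S" using P0(3) [OF p0] NV [OF b] by (simp add: S_def)
  have p0W: "p0 \<in> W0" using p0 P0(1) P0(3) [OF p0] by (auto simp: W0_def)
  have nonhub: "dg R N x \<le> 1" if "Q \<in> QQ" "x \<in> Q" "\<not> R p0 x" for Q x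
    using pair_le [OF p0W that(1) _ that(2,3)] P0(3) [OF p0] that(1) dg_mono [OF finU N_sub, of R x] by simp
  have cardP: "2 * k \<le> card P"
  proof -
    let ?H = "\<lambda>Q. {x \<in> Q. \<not> R p0 x}"
    \<comment> \<open>A vertex of \<open>P0\<close> with another neighbourhood is joined to a vertex
      \<open>x\<close> of some cycle that \<open>p0\<close> misses. Such an \<open>x\<close> has at
      most one neighbour in \<open>N\<close>, and each cycle has at most two of them, so at most
      \<open>2t\<close> vertices of \<open>P0\<close> are lost.\<close>
    have "P0 - P \<subseteq> (\<Union>Q\<in>QQ. \<Union>x\<in>?H Q. {v \<in> N. R x v})"
    proof
      fix p assume p: "p \<in> P0 - P"
      then obtain q where q: "q \<in> V" "R p0 q" "\<not> R p q" by (auto simp: P_def S_def)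
      have "q \<notin> N"
      proof
        assume qN: "q \<in> N"
        have "q \<noteq> b" using q(3) P0(3) p by blast
        then have "2 \<le> dg R N p0"
          using qN q(2) b P0(3) [OF p0] dg_ge_2_iff [OF finN, of R p0] by blast
        then show False using P0(3) [OF p0] by simp
      qed
      moreover have "q \<notin> Z" using Z_isolated [of q p0] q(2) W0_U [OF p0W] sym by blast
      ultimately have "q \<in> \<Union>QQ" using q(1) NZ(1) by (auto simp: U_def)
      then obtain Q where Q: "Q \<in> QQ" "q \<in> Q" by blast
      have fin: "finite Q" using QQ_facts Q by blast
      have "\<not> {x \<in> Q. R p x} \<subseteq> {x \<in> Q. R p0 x}"
      proof
        assume "{x \<in> Q. R p x} \<subseteq> {x \<in> Q. R p0 x}"
        moreover have "card {x \<in> Q. R p x} = card {x \<in> Q. R p0 x}"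
          using P0(3) [OF p0] P0(3) [of p] p Q(1) by (simp add: dg_def)
        ultimately have "{x \<in> Q. R p x} = {x \<in> Q. R p0 x}" using fin by (intro card_subset_eq) auto
        then show False using q Q(2) by blast
      qed
      then obtain x where "x \<in> Q" "R p x" "\<not> R p0 x" by blast
      then show "p \<in> (\<Union>Q\<in>QQ. \<Union>x\<in>?H Q. {v \<in> N. R x v})"
        using Q(1) p P0(1) sym by blast
    qed
    then have "card (P0 - P) \<le> card (\<Union>Q\<in>QQ. \<Union>x\<in>?H Q. {v \<in> N. R x v})"
      by (intro card_mono finite_UN_I finQQ) (use QQ_facts(4) in auto)
    also have "\<dots> \<le> (\<Sum>Q\<in>QQ. card (\<Union>x\<in>?H Q. {v \<in> N. R x v}))" by (rule card_UN_le) simp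
    also have "\<dots> \<le> (\<Sum>Q\<in>QQ. 2)"
    proof (rule sum_mono)
      fix Q assume Q: "Q \<in> QQ"
      have fin: "finite Q" using QQ_facts Q by blast
      have "card (\<Union>x\<in>?H Q. {v \<in> N. R x v}) \<le> (\<Sum>x\<in>?H Q. card {v \<in> N. R x v})"
        by (rule card_UN_le) (use fin in simp)
      also have "\<dots> \<le> (\<Sum>x\<in>?H Q. 1)"
        by (rule sum_mono) (use nonhub [OF Q] in \<open>simp add: dg_def\<close>)
      also have "\<dots> = card (?H Q)" by simp
      also have "card (?H Q) = card Q - dg R Q p0"
      proof -
        have "?H Q = Q - {x \<in> Q. R p0 x}" by blast
        then show ?thesis unfolding dg_def using fin by (simp add: card_Diff_subset)
      qed
      also have "\<dots> \<le> 2" using card_Q_le [OF Q] P0(3) [OF p0] Q by simp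
      finally show "card (\<Union>x\<in>?H Q. {v \<in> N. R x v}) \<le> 2" .
    qed
    also have "\<dots> = 2 * t" by (simp add: t_def)
    finally have "card (P0 - P) \<le> 2 * t" .
    moreover have "card P0 = card (P0 - P) + card P"
      using card_Diff_subset [of P P0] card_mono [of P0 P] finP finite_subset [OF P0(1)] by (auto simp: P_def)
    ultimately show ?thesis using P0(2) k_t by linarith
  qed
  have PV: "P \<subseteq> V" using P0(1) NV by (auto simp: P_def)
  have nbrP: "{q \<in> V. R p q} = S" if "p \<in> P" for p
  proof -
    have "S \<subseteq> {q \<in> V. R p q}" using that by (auto simp: P_def S_def)
    moreover have "card {q \<in> V. R p q} = card S"
      using degP [of p] that cardS by (simp add: P_def dg_def)
    ultimately have "S = {q \<in> V. R p q}" by (intro card_subset_eq) auto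
    then show ?thesis ..
  qed
  have SP: "S \<inter> P = {}" using irr by (auto simp: P_def)
  define X where "X = V - S - P"
  have finX: "finite X" by (simp add: X_def)
  \<comment> \<open>As \<open>card S = 2t + 1\<close>, the vertex \<open>s\<close> can be spared:
    \<open>S - {s}\<close> and \<open>P\<close> still contain \<open>t\<close> disjoint
    quadrilaterals, and \<open>D\<close> would be the \<open>k\<close>-th dense set.\<close>
  have no_dense: "\<not> dense R D" if D: "D \<subseteq> insert s X" and s: "s \<in> S" for D s
  proof
    assume de: "dense R D"
    have "packs R ((S - {s}) \<union> P) t"
    proof (rule complete_bipartite_packs)
      show "card (S - {s}) = 2 * t" using cardS s finS k_t by simp
      show "2 * t \<le> card P" using cardP k_t by simp
      show "R a p" if "a \<in> S - {s}" "p \<in> P" for a p using that sym by (auto simp: P_def)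
    qed (use finS finP SP in auto)
    then have "packs R ((S - {s}) \<union> P \<union> D) (Suc t)"
    proof (rule packs_Suc_Un [OF _ de])
      show "((S - {s}) \<union> P) \<inter> D = {}" using D s SP by (auto simp: X_def)
    qed
    moreover have "(S - {s}) \<union> P \<union> D \<subseteq> V" using D s SV PV by (auto simp: X_def)
    ultimately have "packs R V (Suc t)" by (rule packs_mono)
    then show False using nopack k_t by simp
  qed
  have X_forest: "\<not> dense R D" if "D \<subseteq> X" for D using no_dense [of D b] bS that by blast
  let ?f = "\<lambda>v. ff k (deg v)"
  have Vsplit: "V = (S \<union> P) \<union> X" "(S \<union> P) \<inter> X = {}" using SV PV by (auto simp: X_def)
  \<comment> \<open>Vertices of \<open>P\<close> have degree \<open>2k - 1\<close> and weight 0, and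
    \<open>S\<close> contributes at most \<open>2k - 1\<close>; the last unit of the required
    \<open>2k\<close> must come from \<open>X\<close>.\<close>
  have "1 \<le> (\<Sum>v\<in>X. ?f v)"
  proof -
    have "(\<Sum>v\<in>V. ?f v) = (\<Sum>v\<in>S \<union> P. ?f v) + (\<Sum>v\<in>X. ?f v)"
      unfolding Vsplit(1) by (rule sum.union_disjoint) (use finS finP finX Vsplit(2) in auto)
    also have "(\<Sum>v\<in>S \<union> P. ?f v) = (\<Sum>v\<in>S. ?f v) + (\<Sum>v\<in>P. ?f v)"
      by (rule sum.union_disjoint) (use finS finP SP in auto)
    also have "(\<Sum>v\<in>P. ?f v) = 0"
    proof (rule sum.neutral, rule ballI)
      fix p assume "p \<in> P"
      then have "deg p + 1 = 2 * k" using degP by (simp add: P_def)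
      then show "?f p = 0" by (simp add: ff_def)
    qed
    also have "(\<Sum>v\<in>S. ?f v) \<le> int (card S)"
      using sum_bounded_above [of S ?f 1] by (simp add: ff_def)
    finally have "(\<Sum>v\<in>V. ?f v) \<le> int (card S) + (\<Sum>v\<in>X. ?f v)" by simp
    moreover have "2 * int k \<le> (\<Sum>v\<in>V. ?f v)" using rich by (simp add: rich_def)
    ultimately show ?thesis using cardS by linarith
  qed
  then have "\<exists>T\<in>comps X. 1 \<le> (\<Sum>v\<in>T. ?f v)"
    unfolding sum_comps [OF finX] using sum_nonpos [of "comps X" "\<lambda>T. \<Sum>v\<in>T. ?f v"] by force
  then obtain T where T: "iscomp X T" "1 \<le> (\<Sum>v\<in>T. ?f v)" by (auto simp: comps_def)
  note T' = iscompD [OF T(1)]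
  have dgS: "dg R T s \<le> 1" if "s \<in> S" for s
  proof (rule forest_dg [OF T'(2)])
    show "\<not> dense R (insert s T)" using no_dense [OF _ that, of "insert s T"] T'(1) by blast
    show "s \<notin> T" using T'(1) that by (auto simp: X_def)
  qed
  have degT: "deg v = dg R T v + dg R S v" if v: "v \<in> T" for v
  proof -
    have vX: "v \<in> X" using v T'(1) by blast
    have "\<not> R v p" if "p \<in> P" for p
      using nbrP [OF that] vX sym [of v p] by (auto simp: X_def)
    then have "dg R P v = 0" using dg_pos_iff [OF finP, of R v] by auto
    then have "dg R (S \<union> P) v = dg R S v" using dg_Un [OF finS finP SP, of R v] by simp
    then have "deg v = dg R S v + dg R X v"
      using dg_Un [OF _ finX Vsplit(2), of R v] finS finP Vsplit(1) by simp
    then show ?thesis using dg_comp [OF T(1) v] by simp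
  qed
  have "eb R T S \<le> card S"
  proof -
    have "eb R T S = eb R S T" using finS T'(3) by (intro dg_swap)
    also have "\<dots> \<le> 1 * card S" by (rule eb_le_card) (rule dgS)
    finally show ?thesis by simp
  qed
  moreover have "(\<Sum>v\<in>T. deg v) = eb R T T + eb R T S"
    using degT by (simp add: eb_def sum.distrib)
  moreover have "eb R T T + 2 = 2 * card T" using tree_eb [OF T'(2)] X_forest T'(1) by blast
  ultimately have up: "(\<Sum>v\<in>T. deg v) + 2 \<le> 2 * card T + card S" by simp
  define H where "H = {v \<in> T. 2 * k \<le> deg v + 1}"
  have HT: "H \<subseteq> T" "finite H" using T'(3) by (auto simp: H_def)
  \<comment> \<open>Pointwise: outside \<open>H\<close> the weight is -1 and the minimum degree 2
    suffices; in \<open>H\<close> the left side is \<open>ff + 2k - 1\<close>, which equals the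
    degree at \<open>2k - 1\<close> and \<open>2k\<close>.\<close>
  have "(\<Sum>v\<in>T. ?f v + 3 + (if v \<in> H then 2 * int k - 4 else 0)) \<le> (\<Sum>v\<in>T. int (deg v))"
  proof (rule sum_mono)
    fix v assume v: "v \<in> T"
    have "2 \<le> deg v" using min_deg v T'(1) by (auto simp: X_def)
    then show "?f v + 3 + (if v \<in> H then 2 * int k - 4 else 0) \<le> int (deg v)"
      using v by (auto simp: H_def ff_def)
  qed
  moreover have "(\<Sum>v\<in>T. if v \<in> H then 2 * int k - 4 else 0) = (2 * int k - 4) * int (card H)"
  proof -
    have "T \<inter> H = H" using HT by blast
    then show ?thesis using T'(3) by (simp add: sum.If_cases mult.commute)
  qed
  ultimately have "1 + 3 * int (card T) + (2 * int k - 4) * int (card H) \<le> (\<Sum>v\<in>T. int (deg v))"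
    using T(2) by (simp add: sum.distrib)
  moreover have "(\<Sum>v\<in>T. int (deg v)) + 2 \<le> 2 * int (card T) + int (card S)"
    using up by (simp flip: of_nat_sum)
  ultimately have bound: "3 + int (card T) + (2 * int k - 4) * int (card H) \<le> 2 * int k - 1"
    using cardS by linarith
  have "card H \<noteq> 0"
  proof
    assume "card H = 0"
    then have "H = {}" using HT by simp
    then have "?f v \<le> 0" if "v \<in> T" for v using that by (auto simp: H_def ff_def)
    then have "(\<Sum>v\<in>T. ?f v) \<le> 0" by (rule sum_nonpos)
    then show False using T(2) by simp
  qed
  then have "1 \<le> int (card H)" by simp
  then have "(2 * int k - 4) * 1 \<le> (2 * int k - 4) * int (card H)" using k2 by (intro mult_left_mono) auto
  then have "2 * int k - 4 \<le> (2 * int k - 4) * int (card H)" by simp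
  moreover have "int (card H) \<le> int (card T)" using card_mono [OF T'(3) HT(1)] by simp
  \<comment> \<open>The product is abstracted to \<open>w\<close> to make the problem linear. What
    remains is \<open>c \<le> 0\<close> for the order \<open>c\<close> of \<open>T\<close>, although
    \<open>T\<close> contains a vertex of \<open>H\<close>.\<close>
  moreover have False
    if "3 + c + w \<le> 2 * m - 1" "2 * m - 4 \<le> w" "1 \<le> h" "h \<le> c" for c w m h :: int
    using that by linarith
  ultimately show False using bound \<open>1 \<le> int (card H)\<close> by blast
qed

end

lemma rich_packs:
  fixes R :: "'a \<Rightarrow> 'a \<Rightarrow> bool"
  assumes "rel R" "finite V" "2 \<le> k" "rich R V k" shows "packs R V k"
  using assms
proof (induction "card V + eb R V V" arbitrary: R V rule: less_induct)
  case less
  show ?case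
  proof (rule ccontr)
    assume "\<not> packs R V k"
    then have "graph R V k" using less.prems by (simp add: graph_def graph_axioms_def)
    moreover have "min_graph_axioms R V k"
      using less.hyps less.prems(3) by (simp add: min_graph_axioms_def)
    ultimately have "min_graph R V k" by (rule min_graph.intro)
    then have "irred R V k" by (rule min_graph.irred)
    then obtain QQ where "system R V k QQ" using irred.system_exists by blast
    then show False by (rule system.contradiction)
  qed
qed

section \<open>Cycles in simple graphs\<close>

context simple_graph
begin

definition adj :: "'a \<Rightarrow> 'a \<Rightarrow> bool" where "adj v w \<longleftrightarrow> {v, w} \<in> E"

lemma rel_adj: "rel adj"
proof
  show "adj x y \<Longrightarrow> adj y x" for x y by (simp add: adj_def insert_commute)
  show "\<not> adj x x" for x using edge_card [of "{x}"] by (auto simp: adj_def)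
qed

lemma degree_dg: "degree E v = dg adj V v"
proof -
  have "bij_betw (\<lambda>w. {v, w}) {w \<in> V. adj v w} {e \<in> E. v \<in> e}"
  proof (rule bij_betwI')
    fix x y assume "x \<in> {w \<in> V. adj v w}" "y \<in> {w \<in> V. adj v w}"
    then show "({v, x} = {v, y}) = (x = y)" by (auto simp: doubleton_eq_iff)
  next
    fix x assume "x \<in> {w \<in> V. adj v w}"
    then show "{v, x} \<in> {e \<in> E. v \<in> e}" by (simp add: adj_def)
  next
    fix e assume e: "e \<in> {e \<in> E. v \<in> e}"
    then have "card e = 2" "e \<subseteq> V" using edge_card edge_subset by auto
    then obtain x where "e = {v, x}" using e by (auto simp: card_2_iff)
    then show "\<exists>x\<in>{w \<in> V. adj v w}. e = {v, x}"
      using e \<open>e \<subseteq> V\<close> by (intro bexI [of _ x]) (auto simp: adj_def)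
  qed
  then show ?thesis by (simp add: degree_def dg_def bij_betw_same_card)
qed

lemma cyc_cycles:
  assumes "rel.cyc adj xs" "set xs \<subseteq> V"
  shows "(set xs, {{xs ! j, xs ! (Suc j mod length xs)} | j. j < length xs}) \<in> cycles V E"
proof -
  have c: "distinct xs" "3 \<le> length xs" "successively adj xs" "adj (last xs) (hd xs)"
    using assms(1) rel.cyc_def [OF rel_adj] by auto
  have "{xs ! j, xs ! (Suc j mod length xs)} \<in> E" if j: "j < length xs" for j
  proof (cases "Suc j < length xs")
    case True
    then show ?thesis using c(3) by (auto simp: successively_conv_nth adj_def)
  next
    case False
    \<comment> \<open>The closing edge: the index wraps around to 0.\<close>
    then have "Suc j = length xs" using j by simp
    moreover from this have "j = length xs - 1" by simp
    moreover have "xs \<noteq> []" using c(2) by auto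
    ultimately show ?thesis using c(4) by (simp add: adj_def last_conv_nth hd_conv_nth)
  qed
  then show ?thesis using assms(2) c(1,2) unfolding cycles_def is_cycle_def by blast
qed

lemma packs_disjoint_cycles:
  assumes "packs adj V n" shows "n \<le> max_disjoint_cycles V E"
proof -
  obtain F where F: "finite F" "card F = n" "\<forall>X\<in>F. X \<subseteq> V \<and> dense adj X" "pairwise disjnt F"
    using packsE [OF assms] .
  have "\<forall>X\<in>F. \<exists>xs. rel.cyc adj xs \<and> set xs \<subseteq> X"
    using F(3) rel.dense_cyc [OF rel_adj] by metis
  then obtain c where c: "\<And>X. X \<in> F \<Longrightarrow> rel.cyc adj (c X) \<and> set (c X) \<subseteq> X"
    using bchoice by meson
  define g where "g X = (set (c X), {{c X ! j, c X ! (Suc j mod length (c X))} | j. j < length (c X)})" for X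
  have ne: "set (c X) \<noteq> {}" if "X \<in> F" for X
    using c [OF that] rel.cyc_def [OF rel_adj] by fastforce
  have dis: "set (c X) \<inter> set (c Y) = {}" if "X \<in> F" "Y \<in> F" "X \<noteq> Y" for X Y
    using pairwiseD [OF F(4) that] c [OF that(1)] c [OF that(2)] unfolding disjnt_def by blast
  have inj: "inj_on g F"
  proof (rule inj_onI, rule ccontr)
    fix X Y assume XY: "X \<in> F" "Y \<in> F" "g X = g Y" "X \<noteq> Y"
    then have "set (c X) = set (c Y)" by (simp add: g_def)
    then show False using dis [OF XY(1,2,4)] ne [OF XY(1)] by simp
  qed
  have "g ` F \<subseteq> cycles V E"
  proof
    fix y assume "y \<in> g ` F"
    then obtain X where X: "X \<in> F" "y = g X" by blast
    have "set (c X) \<subseteq> V" using c [OF X(1)] F(3) X(1) by blast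
    then show "y \<in> cycles V E" using cyc_cycles [of "c X"] c [OF X(1)] X(2) by (simp add: g_def)
  qed
  moreover have "pairwise (\<lambda>C D. fst C \<inter> fst D = {}) (g ` F)"
  proof (rule pairwiseI)
    fix A B assume "A \<in> g ` F" "B \<in> g ` F" "A \<noteq> B"
    then obtain X Y where "X \<in> F" "Y \<in> F" "X \<noteq> Y" "A = g X" "B = g Y" by blast
    then show "fst A \<inter> fst B = {}" using dis by (simp add: g_def)
  qed
  ultimately have "disjoint_cycles V E (g ` F)" by (simp add: disjoint_cycles_def)
  moreover have "card (g ` F) = n" using F(2) inj by (simp add: card_image)
  ultimately show ?thesis unfolding le_max_disjoint_cycles_iff by (metis order_refl)
qed

lemma rich_of_counts:
  assumes "2 \<le> k" "k \<ge> i" "int (card V) \<ge> 16 * k + 3 * i"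
    and "int (card (high_verts V E k)) \<ge> int (card (low_verts V E k)) + 3 * k - i"
  shows "rich adj V (nat k)"
proof -
  let ?d = "dg adj V"
  have ff: "ff (nat k) (?d v) = (if v \<in> high_verts V E k then 1 else 0) - (if v \<in> low_verts V E k then 1 else 0)"
    if "v \<in> V" for v
    using that assms(1) by (auto simp: high_verts_def low_verts_def degree_dg ff_def)
  have sub: "V \<inter> high_verts V E k = high_verts V E k" "V \<inter> low_verts V E k = low_verts V E k"
    by (auto simp: high_verts_def low_verts_def)
  have "(\<Sum>v\<in>V. ff (nat k) (?d v)) = (\<Sum>v\<in>V. (if v \<in> high_verts V E k then 1 else 0) - (if v \<in> low_verts V E k then 1 else 0))"
    by (rule sum.cong) (use ff in auto)
  also have "\<dots> = int (card (high_verts V E k)) - int (card (low_verts V E k))"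
    using finite_verts sub by (simp add: sum_subtractf sum.If_cases)
  finally have D: "3 * k - i \<le> (\<Sum>v\<in>V. ff (nat k) (?d v))" using assms(4) by simp
  have "(\<Sum>v\<in>V. 1 + 3 * ff (nat k) (?d v)) \<le> (\<Sum>v\<in>V. 2 * om (nat k) (?d v))"
    by (rule sum_mono) (auto simp: ff_def om_def)
  then have "int (card V) + 3 * (\<Sum>v\<in>V. ff (nat k) (?d v)) \<le> 2 * (\<Sum>v\<in>V. om (nat k) (?d v))"
    by (simp add: sum.distrib sum_distrib_left)
  then show ?thesis using D assms by (simp add: rich_def)
qed

end

theorem theorem3p4:
  fixes V :: "'a set" and E :: "'a set set" and i k :: int
  assumes "simple_graph V E"
    and "k \<ge> i" and "k \<ge> 2"
    and "int (card V) \<ge> 16 * k + 3 * i"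
    and "int (card (high_verts V E k)) \<ge> int (card (low_verts V E k)) + 3 * k - i"
  shows "int (max_disjoint_cycles V E) \<ge> k"
proof -
  interpret simple_graph V E by fact
  have "rich adj V (nat k)" using assms(2-5) by (intro rich_of_counts)
  then have "packs adj V (nat k)" using assms(3) by (intro rich_packs rel_adj finite_verts) auto
  then have "nat k \<le> max_disjoint_cycles V E" by (rule packs_disjoint_cycles)
  then show ?thesis by simp
qed

end
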